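(* The scheme $\widehat{\mathscr X}$ is a Poisson scheme over $R=\mathbb C[t_i:i\in I]$, with the Poisson structure inherited from the Poisson structure on the affine patches $U_{\mathbf s}=\operatorname{Spec}R[\tilde X_{i;\mathbf s}:i\in I]$ given by the $R$-bilinear Poisson bracket $$\{\tilde X^{v_1}_{\mathbf s},\tilde X^{v_2}_{\mathbf s}\}_{\mathbf s}:=2\{v_1,v_2\}\,\tilde X^{v_1+v_2}_{\mathbf s}$$ on monomials; that is, these brackets on the patches agree under the gluing maps and define a global $R$-Poisson structure on $\widehat{\mathscr X}$.
   Context: Poisson schemes: let $A$ be a commutative ring with $1$. A sheaf $\mathcal F$ of $A$-algebras on a space $X$ is an $A$-Poisson sheaf if each $\mathcal F(U)$ is endowed with an $A$-bilinear Poisson bracket $\{\cdot,\cdot\}_U$ such that for $V\subset U$ and $f,g\in\mathcal F(U)$ one has $\{f|_V,g|_V\}_V=\{f,g\}_U|_V$. A scheme $X$ over $A$ is a Poisson scheme over $A$ if $\mathcal O_X$ is an $A$-Poisson sheaf. Fixed data: a finite set $I$ with a subset $I_{\mathrm{uf}}$; a lattice $N$ of rank $|I|$ with a saturated sublattice $N_{\mathrm{uf}}$ of rank $|I_{\mathrm{uf}}|$; a skew-symmetric bilinear form $\{\cdot,\cdot\}:N\times N\to\mathbb Q$; positive integers $(d_i)_{i\in I}$ with gcd $1$; a finite-index sublattice $N^\circ\subseteq N$ with $\{N_{\mathrm{uf}},N^\circ\}\subset\mathbb Z$ and $\{N,N_{\mathrm{uf}}\cap N^\circ\}\subset\mathbb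 Z$. A seed is $\mathbf s=(e_{i;\mathbf s})_{i\in I}$, a basis of $N$ such that $(e_{i;\mathbf s})_{i\in I_{\mathrm{uf}}}$ is a basis of $N_{\mathrm{uf}}$ and $(d_ie_{i;\mathbf s})_{i\in I}$ is a basis of $N^\circ$. Put $\epsilon_{ij}=\{e_{i;\mathbf s},e_{j;\mathbf s}\}d_j$ and $[r]_+=\max(0,r)$. Mutation of $\mathbf s$ in direction $k\in I_{\mathrm{uf}}$: $e_{k;\mathbf s'}=-e_{k;\mathbf s}$, $e_{i;\mathbf s'}=e_{i;\mathbf s}+[\epsilon_{ik}]_+e_{k;\mathbf s}$ for $i\neq k$. $\mathbf c$-vectors: fix an initial seed $\mathbf s_0$. The vectors $\mathbf c_{i;\mathbf s}=(c_{ij})_{j\in I}\in\mathbb Z^I$ for seeds reached from $\mathbf s_0$ by mutations are determined by: $\mathbf c_{i;\mathbf s_0}$ is the $i$-th standard basis vector; under mutation in direction $k$, $c'_{kj}=-c_{kj}$ and $c'_{ij}=c_{ij}+\frac12(|\epsilon_{ik}|c_{kj}+\epsilon_{ik}|c_{kj}|)$ for $i\neq k$. They are known to be sign coherent (all entries $\ge0$ or all $\le0$). For a sign coherent vector $\mathbf x$, $[\mathbf x]_+=\mathbf x$ if its entries are nonnegative and $[\mathbf x]_+=0$ otherwise; $\mathbf t^{\mathbf x}=\prod_it_i^{x_i}$. The family: to each seed $\mathbf s$ reached from $\mathbf s_0$ attach $U_{\mathbf s}=\operatorname{Spec}R[\tilde X_{i;\mathbf s}:i\in I]$, with monomials $\tilde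 X_{\mathbf s}^v=\prod_i\tilde X_{i;\mathbf s}^{a_i}$ for $v=\sum_ia_ie_{i;\mathbf s}$, $a_i\in\mathbb Z_{\ge0}$. If $\mathbf s'$ is the mutation of $\mathbf s$ in direction $k$, the birational map $\mu_k:U_{\mathbf s}\dashrightarrow U_{\mathbf s'}$ is defined by $\mu_k^*(\tilde X_{k;\mathbf s'})=\tilde X_{k;\mathbf s}^{-1}$ and, for $i\ne k$, $$\mu_k^*(\tilde X_{i;\mathbf s'})=\tilde X_{i;\mathbf s}\left(\mathbf t^{[\operatorname{sgn}(\epsilon_{ik})\mathbf c_{k;\mathbf s}]_+}+\mathbf t^{[-\operatorname{sgn}(\epsilon_{ik})\mathbf c_{k;\mathbf s}]_+}\tilde X_{k;\mathbf s}^{-\operatorname{sgn}(\epsilon_{ik})}\right)^{-\epsilon_{ik}}.$$ $\widehat{\mathscr X}$ is the $R$-scheme obtained by gluing all the $U_{\mathbf s}$ along the composites of these birational maps, any two patches being glued along the largest open subsets on which the composite birational map restricts to an isomorphism. (Seeds with the same cluster up to relabeling, i.e. corresponding to the same maximal cone of the $\mathbf g$-vector fan, give the same patch.) *)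

theory Defs
  imports
    "HOL-Algebra.Algebraic_Closure_Type"
    "HOL-Analysis.Abstract_Topology"
    "HOL-Library.Poly_Mapping"
    "HOL-Computational_Algebra.Fraction_Field"
    Complex_Main
begin

section \<open>Affine schemes\<close>

text \<open>The points of the spectrum of \<open>B\<close> are the \<open>p\<close> with \<open>primeideal p B\<close>; the open sets are the
  complements of the closed sets \<open>V(S)\<close>.\<close>

definition spec_top :: "('a, 'm) ring_scheme \<Rightarrow> 'a set topology" where
  "spec_top B = topology (\<lambda>U. \<exists>S \<subseteq> carrier B. U = {p. primeideal p B \<and> \<not> S \<subseteq> p})"

text \<open>The fraction \<open>a/s\<close> in the localization of \<open>B\<close> at the prime \<open>p\<close>, as an equivalence class of
  pairs.\<close>

definition loc_frac :: "('a, 'm) ring_scheme \<Rightarrow> 'a set \<Rightarrow> 'a \<Rightarrow> 'a \<Rightarrow> ('a \<times> 'a) set" where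
  "loc_frac B p a s =
     {(b, t). b \<in> carrier B \<and> t \<in> carrier B - p \<and>
        (\<exists>u \<in> carrier B - p. u \<otimes>\<^bsub>B\<^esub> (a \<otimes>\<^bsub>B\<^esub> t \<ominus>\<^bsub>B\<^esub> b \<otimes>\<^bsub>B\<^esub> s) = \<zero>\<^bsub>B\<^esub>)}"

text \<open>In the operations below all members of the union are the same class, because the result does
  not depend on the representatives.\<close>

definition localization :: "('a, 'm) ring_scheme \<Rightarrow> 'a set \<Rightarrow> ('a \<times> 'a) set ring" where
  "localization B p =
     \<lparr> carrier = {loc_frac B p a s | a s. a \<in> carrier B \<and> s \<in> carrier B - p},
       monoid.mult = (\<lambda>x y. \<Union>(a, s) \<in> x. \<Union>(b, t) \<in> y. loc_frac B p (a \<otimes>\<^bsub>B\<^esub> b) (s \<otimes>\<^bsub>B\<^esub> t)),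
       monoid.one = loc_frac B p \<one>\<^bsub>B\<^esub> \<one>\<^bsub>B\<^esub>,
       ring.zero = loc_frac B p \<zero>\<^bsub>B\<^esub> \<one>\<^bsub>B\<^esub>,
       ring.add = (\<lambda>x y. \<Union>(a, s) \<in> x. \<Union>(b, t) \<in> y.
                loc_frac B p (a \<otimes>\<^bsub>B\<^esub> t \<oplus>\<^bsub>B\<^esub> b \<otimes>\<^bsub>B\<^esub> s) (s \<otimes>\<^bsub>B\<^esub> t)) \<rparr>"

text \<open>Sections over \<open>U\<close> are the functions into the local rings that are locally given by fractions.\<close>

definition structure_sheaf ::
    "('a, 'm) ring_scheme \<Rightarrow> 'a set set \<Rightarrow> ('a set \<Rightarrow> ('a \<times> 'a) set) ring" where
  "structure_sheaf B U =
     \<lparr> carrier = {\<sigma> \<in> (\<Pi>\<^sub>E p \<in> U. carrier (localization B p)).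
         \<forall>p \<in> U. \<exists>V. openin (spec_top B) V \<and> p \<in> V \<and> V \<subseteq> U \<and>
           (\<exists>a \<in> carrier B. \<exists>s \<in> carrier B. \<forall>q \<in> V. s \<notin> q \<and> \<sigma> q = loc_frac B q a s)},
       monoid.mult = (\<lambda>\<sigma> \<tau>. \<lambda>p \<in> U. \<sigma> p \<otimes>\<^bsub>localization B p\<^esub> \<tau> p),
       monoid.one = (\<lambda>p \<in> U. \<one>\<^bsub>localization B p\<^esub>),
       ring.zero = (\<lambda>p \<in> U. \<zero>\<^bsub>localization B p\<^esub>),
       ring.add = (\<lambda>\<sigma> \<tau>. \<lambda>p \<in> U. \<sigma> p \<oplus>\<^bsub>localization B p\<^esub> \<tau> p) \<rparr>"


section \<open>Poisson schemes over a commutative ring\<close>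

locale algebra_sheaf =
  fixes R :: "('r, 'm) ring_scheme" and T :: "'x topology"
    and F :: "'x set \<Rightarrow> ('r, 's) module" and res :: "'x set \<Rightarrow> 'x set \<Rightarrow> 's \<Rightarrow> 's"
  assumes algebra: "openin T U \<Longrightarrow> algebra R (F U)"
    and res_hom: "\<lbrakk>openin T U; openin T V; V \<subseteq> U\<rbrakk> \<Longrightarrow> res U V \<in> ring_hom (F U) (F V)"
    and res_smult: "\<lbrakk>openin T U; openin T V; V \<subseteq> U; r \<in> carrier R; f \<in> carrier (F U)\<rbrakk>
          \<Longrightarrow> res U V (r \<odot>\<^bsub>F U\<^esub> f) = r \<odot>\<^bsub>F V\<^esub> res U V f"
    and res_id: "\<lbrakk>openin T U; f \<in> carrier (F U)\<rbrakk> \<Longrightarrow> res U U f = f"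
    and res_res: "\<lbrakk>openin T U; openin T V; openin T W; W \<subseteq> V; V \<subseteq> U; f \<in> carrier (F U)\<rbrakk>
          \<Longrightarrow> res V W (res U V f) = res U W f"
    and glueing: "\<lbrakk>\<forall>V \<in> \<C>. openin T V; \<forall>V \<in> \<C>. \<sigma> V \<in> carrier (F V);
            \<forall>V \<in> \<C>. \<forall>W \<in> \<C>. res V (V \<inter> W) (\<sigma> V) = res W (V \<inter> W) (\<sigma> W)\<rbrakk>
          \<Longrightarrow> \<exists>!f. f \<in> carrier (F (\<Union>\<C>)) \<and> (\<forall>V \<in> \<C>. res (\<Union>\<C>) V f = \<sigma> V)"

text \<open>The point \<open>x\<close> has an open neighbourhood \<open>U\<close> isomorphic, as a ringed space, to the spectrum of a
  commutative ring \<open>B\<close>. HOL cannot quantify over the type of \<open>B\<close>, hence the type argument.\<close>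

definition has_affine_nbhd ::
    "'b itself \<Rightarrow> 'x topology \<Rightarrow> ('x set \<Rightarrow> ('r, 's) module) \<Rightarrow> ('x set \<Rightarrow> 'x set \<Rightarrow> 's \<Rightarrow> 's)
     \<Rightarrow> 'x \<Rightarrow> bool" where
  "has_affine_nbhd (chart_type :: 'b itself) T F res x \<longleftrightarrow>
    (\<exists>U (B :: 'b ring) h \<phi>.
      openin T U \<and> x \<in> U \<and> cring B \<and>
      homeomorphic_map (subtopology T U) (spec_top B) h \<and>
      (\<forall>V. openin (spec_top B) V \<longrightarrow>
         \<phi> V \<in> ring_iso (structure_sheaf B V) (F {y \<in> U. h y \<in> V})) \<and>
      (\<forall>V W. openin (spec_top B) V \<and> openin (spec_top B) W \<and> W \<subseteq> V \<longrightarrow>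
         (\<forall>\<sigma> \<in> carrier (structure_sheaf B V).
            \<phi> W (restrict \<sigma> W) = res {y \<in> U. h y \<in> V} {y \<in> U. h y \<in> W} (\<phi> V \<sigma>))))"

text \<open>A scheme over \<open>R\<close> is a scheme whose structure sheaf is a sheaf of \<open>R\<close>-algebras. Its stalks are
  local rings because it is locally isomorphic to a spectrum.\<close>

locale scheme_over = algebra_sheaf R T F res
  for chart_type :: "'b itself" and R :: "('r, 'm) ring_scheme" and T :: "'x topology"
    and F :: "'x set \<Rightarrow> ('r, 's) module" and res :: "'x set \<Rightarrow> 'x set \<Rightarrow> 's \<Rightarrow> 's" +
  assumes locally_affine: "x \<in> topspace T \<Longrightarrow> has_affine_nbhd chart_type T F res x"

locale poisson_algebra = algebra R M
  for R :: "('r, 'm) ring_scheme" and M :: "('r, 's) module" +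
  fixes br :: "'s \<Rightarrow> 's \<Rightarrow> 's"
  assumes br_closed: "\<lbrakk>f \<in> carrier M; g \<in> carrier M\<rbrakk> \<Longrightarrow> br f g \<in> carrier M"
    and br_add_left: "\<lbrakk>f \<in> carrier M; g \<in> carrier M; h \<in> carrier M\<rbrakk>
          \<Longrightarrow> br (f \<oplus>\<^bsub>M\<^esub> g) h = br f h \<oplus>\<^bsub>M\<^esub> br g h"
    and br_add_right: "\<lbrakk>f \<in> carrier M; g \<in> carrier M; h \<in> carrier M\<rbrakk>
          \<Longrightarrow> br f (g \<oplus>\<^bsub>M\<^esub> h) = br f g \<oplus>\<^bsub>M\<^esub> br f h"
    and br_smult_left: "\<lbrakk>r \<in> carrier R; f \<in> carrier M; g \<in> carrier M\<rbrakk>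
          \<Longrightarrow> br (r \<odot>\<^bsub>M\<^esub> f) g = r \<odot>\<^bsub>M\<^esub> br f g"
    and br_smult_right: "\<lbrakk>r \<in> carrier R; f \<in> carrier M; g \<in> carrier M\<rbrakk>
          \<Longrightarrow> br f (r \<odot>\<^bsub>M\<^esub> g) = r \<odot>\<^bsub>M\<^esub> br f g"
    and br_alternating: "f \<in> carrier M \<Longrightarrow> br f f = \<zero>\<^bsub>M\<^esub>"
    and br_jacobi: "\<lbrakk>f \<in> carrier M; g \<in> carrier M; h \<in> carrier M\<rbrakk>
          \<Longrightarrow> br f (br g h) \<oplus>\<^bsub>M\<^esub> br g (br h f) \<oplus>\<^bsub>M\<^esub> br h (br f g) = \<zero>\<^bsub>M\<^esub>"
    and br_leibniz: "\<lbrakk>f \<in> carrier M; g \<in> carrier M; h \<in> carrier M\<rbrakk>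
          \<Longrightarrow> br (f \<otimes>\<^bsub>M\<^esub> g) h = f \<otimes>\<^bsub>M\<^esub> br g h \<oplus>\<^bsub>M\<^esub> br f h \<otimes>\<^bsub>M\<^esub> g"

locale poisson_sheaf = algebra_sheaf R T F res
  for R :: "('r, 'm) ring_scheme" and T :: "'x topology"
    and F :: "'x set \<Rightarrow> ('r, 's) module" and res :: "'x set \<Rightarrow> 'x set \<Rightarrow> 's \<Rightarrow> 's" +
  fixes br :: "'x set \<Rightarrow> 's \<Rightarrow> 's \<Rightarrow> 's"
  assumes poisson: "openin T U \<Longrightarrow> poisson_algebra R (F U) (br U)"
    and res_br: "\<lbrakk>openin T U; openin T V; V \<subseteq> U; f \<in> carrier (F U); g \<in> carrier (F U)\<rbrakk>
          \<Longrightarrow> br V (res U V f) (res U V g) = res U V (br U f g)"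

locale poisson_scheme_over =
  scheme_over chart_type R T F res + poisson_sheaf R T F res br
  for chart_type :: "'b itself" and R :: "('r, 'm) ring_scheme" and T :: "'x topology"
    and F :: "'x set \<Rightarrow> ('r, 's) module" and res :: "'x set \<Rightarrow> 'x set \<Rightarrow> 's \<Rightarrow> 's"
    and br :: "'x set \<Rightarrow> 's \<Rightarrow> 's \<Rightarrow> 's"


section \<open>Lattices, fixed data and seeds\<close>

definition zmul :: "int \<Rightarrow> 'n \<Rightarrow> 'n::ab_group_add" where
  "zmul m v = (if 0 \<le> m then (((+) v) ^^ nat m) 0 else - (((+) v) ^^ nat (- m)) 0)"

lemma funpow_add_shift: "(((+) v) ^^ n) (0::'n::ab_group_add) + w = (((+) v) ^^ n) w"
  by (induction n) (auto simp: add.assoc)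

lemma funpow_add_split:
  "(((+) v) ^^ (m + n)) (0::'n::ab_group_add) = (((+) v) ^^ m) 0 + (((+) v) ^^ n) 0"
  by (simp add: funpow_add funpow_add_shift)

lemma zmul_diff: "zmul (int m - int n) v = (((+) v) ^^ m) 0 - (((+) v) ^^ n) (0::'n::ab_group_add)"
proof (cases "n \<le> m")
  case True
  then obtain k where "m = n + k" using le_Suc_ex by blast
  then show ?thesis by (simp add: zmul_def funpow_add_split)
next
  case False
  then obtain k where "n = m + k" "k > 0" by (metis less_imp_add_positive linorder_not_le)
  then show ?thesis by (simp add: zmul_def funpow_add_split)
qed

lemma zmul_add_left: "zmul (a + b) v = zmul a v + zmul b (v::'n::ab_group_add)"
proof -
  obtain m n where a: "a = int m - int n" by (metis int_diff_cases)
  obtain k l where b: "b = int k - int l" by (metis int_diff_cases)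
  have "a + b = int (m + k) - int (n + l)" using a b by simp
  then show ?thesis unfolding a b
    by (simp only: zmul_diff funpow_add_split) simp
qed

lemma zmul_add_right: "zmul a (v + w) = zmul a v + zmul a (w::'n::ab_group_add)"
proof -
  have "(((+) (v + w)) ^^ n) 0 = (((+) v) ^^ n) 0 + (((+) w) ^^ n) 0" for n
    by (induction n) (auto simp: algebra_simps)
  then show ?thesis by (simp add: zmul_def)
qed

lemma zmul_one: "zmul 1 v = (v::'n::ab_group_add)"
  by (simp add: zmul_def)

lemma zmul_minus_left: "zmul (- a) v = - zmul a (v::'n::ab_group_add)"
  using zmul_add_left[of "-a" a v] by (simp add: zmul_def eq_neg_iff_add_eq_0)

lemma zmul_zmul: "zmul a (zmul b v) = zmul (a * b) (v::'n::ab_group_add)"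
proof -
  have nat: "zmul (int n) (zmul b v) = zmul (int n * b) v" for n
    by (induction n)
      (simp_all add: zmul_add_left zmul_one algebra_simps, simp add: zmul_def)
  show ?thesis
  proof (cases "0 \<le> a")
    case True
    then show ?thesis using nat[of "nat a"] by simp
  next
    case False
    then have "a = - int (nat (- a))" by simp
    then show ?thesis using nat[of "nat (- a)"] by (metis minus_mult_left zmul_minus_left)
  qed
qed

interpretation zmod: Modules.module zmul
  by unfold_locales (simp_all add: zmul_add_left zmul_add_right zmul_zmul zmul_one)

text \<open>The lattice \<open>N\<close> is the whole type \<open>'n\<close>, and the finite index set \<open>I\<close> is the whole type \<open>'i\<close>.\<close>

record ('i, 'n) fixed_data =
  unfrozen :: "'i set"
  form :: "'n \<Rightarrow> 'n \<Rightarrow> rat"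
  mults :: "'i \<Rightarrow> nat"
  N_uf :: "'n set"
  N_circ :: "'n set"

definition zbasis :: "'i set \<Rightarrow> ('i \<Rightarrow> 'n::ab_group_add) \<Rightarrow> 'n set \<Rightarrow> bool" where
  "zbasis J b S \<longleftrightarrow> inj_on b J \<and> zmod.independent (b ` J) \<and> zmod.span (b ` J) = S"

definition lattice_of_rank :: "nat \<Rightarrow> 'n::ab_group_add set \<Rightarrow> bool" where
  "lattice_of_rank r S \<longleftrightarrow> (\<exists>b :: nat \<Rightarrow> 'n. zbasis {..<r} b S)"

definition valid_fixed_data :: "('i::finite, 'n::ab_group_add) fixed_data \<Rightarrow> bool" where
  "valid_fixed_data D \<longleftrightarrow>
     lattice_of_rank (card (UNIV :: 'i set)) (UNIV :: 'n set) \<and>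
     lattice_of_rank (card (unfrozen D)) (N_uf D) \<and>
     (\<forall>m v. m \<noteq> 0 \<and> zmul m v \<in> N_uf D \<longrightarrow> v \<in> N_uf D) \<and>
     (\<forall>u v w. form D (u + v) w = form D u w + form D v w) \<and>
     (\<forall>u v w. form D u (v + w) = form D u v + form D u w) \<and>
     (\<forall>u v. form D u v = - form D v u) \<and>
     (\<forall>i. mults D i > 0) \<and> Gcd (range (mults D)) = 1 \<and>
     zmod.subspace (N_circ D) \<and> finite (range (\<lambda>v. (\<lambda>x. v + x) ` N_circ D)) \<and>
     (\<forall>u \<in> N_uf D. \<forall>v \<in> N_circ D. form D u v \<in> \<int>) \<and>
     (\<forall>u. \<forall>v \<in> N_uf D \<inter> N_circ D. form D u v \<in> \<int>)"

definition is_seed :: "('i::finite, 'n::ab_group_add) fixed_data \<Rightarrow> ('i \<Rightarrow> 'n) \<Rightarrow> bool" where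
  "is_seed D e \<longleftrightarrow>
     zbasis UNIV e UNIV \<and> zbasis (unfrozen D) e (N_uf D) \<and>
     zbasis UNIV (\<lambda>i. zmul (int (mults D i)) (e i)) (N_circ D)"

text \<open>The number \<open>{e\<^sub>i, e\<^sub>j} d\<^sub>j\<close> is an integer when \<open>j\<close> is unfrozen, which is the only case used, so
  the floor only changes the type.\<close>

definition eps :: "('i, 'n) fixed_data \<Rightarrow> ('i \<Rightarrow> 'n) \<Rightarrow> 'i \<Rightarrow> 'i \<Rightarrow> int" where
  "eps D e i j = \<lfloor>form D (e i) (e j) * of_nat (mults D j)\<rfloor>"

definition mutate_seed ::
    "('i, 'n::ab_group_add) fixed_data \<Rightarrow> 'i \<Rightarrow> ('i \<Rightarrow> 'n) \<Rightarrow> ('i \<Rightarrow> 'n)" where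
  "mutate_seed D k e = (\<lambda>i. if i = k then - e k else e i + zmul (max 0 (eps D e i k)) (e k))"

text \<open>The numerator is always even, so \<open>div\<close> is exact.\<close>

definition mutate_c ::
    "('i, 'n) fixed_data \<Rightarrow> 'i \<Rightarrow> ('i \<Rightarrow> 'n) \<Rightarrow> ('i \<Rightarrow> 'i \<Rightarrow> int) \<Rightarrow> ('i \<Rightarrow> 'i \<Rightarrow> int)" where
  "mutate_c D k e c = (\<lambda>i j. if i = k then - c k j
     else c i j + (\<bar>eps D e i k\<bar> * c k j + eps D e i k * \<bar>c k j\<bar>) div 2)"

text \<open>A seed reached from the initial seed \<open>e0\<close> is addressed by the word of its mutation directions;
  the head of the word is the last mutation performed.\<close>

definition words :: "('i, 'n) fixed_data \<Rightarrow> 'i list set" where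
  "words D = lists (unfrozen D)"

primrec seed_at :: "('i, 'n::ab_group_add) fixed_data \<Rightarrow> ('i \<Rightarrow> 'n) \<Rightarrow> 'i list \<Rightarrow> ('i \<Rightarrow> 'n)" where
  "seed_at D e0 [] = e0"
| "seed_at D e0 (k # w) = mutate_seed D k (seed_at D e0 w)"

primrec c_at ::
    "('i, 'n::ab_group_add) fixed_data \<Rightarrow> ('i \<Rightarrow> 'n) \<Rightarrow> 'i list \<Rightarrow> ('i \<Rightarrow> 'i \<Rightarrow> int)" where
  "c_at D e0 [] = (\<lambda>i j. if i = j then 1 else 0)"
| "c_at D e0 (k # w) = mutate_c D k (seed_at D e0 w) (c_at D e0 w)"


section \<open>The patches and their birational maps\<close>

text \<open>\<open>'i coeff_ring\<close> is the polynomial ring \<open>R\<close> over the complex numbers in the \<open>t\<^sub>i\<close>, and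
  \<open>'i patch_ring\<close> is the polynomial ring over \<open>R\<close> in the variables \<open>X\<^sub>i\<close> of a patch. The library
  proves that these are integral domains only for linearly ordered \<open>'i\<close>; the order plays no other
  role.\<close>

type_synonym 'i coeff_ring = "('i \<Rightarrow>\<^sub>0 nat) \<Rightarrow>\<^sub>0 complex"
type_synonym 'i patch_ring = "('i \<Rightarrow>\<^sub>0 nat) \<Rightarrow>\<^sub>0 'i coeff_ring"
type_synonym 'i function_field = "'i patch_ring fract"

definition R_poly :: "'i::{finite, linorder} coeff_ring ring" where
  "R_poly = ring_of_type_algebra"

definition patch :: "'i::{finite, linorder} patch_ring ring" where
  "patch = ring_of_type_algebra"

definition coeff_emb :: "'i coeff_ring \<Rightarrow> 'i::{finite, linorder} patch_ring" where
  "coeff_emb r = Poly_Mapping.single 0 r"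

definition patch_algebra ::
    "('i::{finite, linorder} coeff_ring, 'i patch_ring) module" where
  "patch_algebra = \<lparr> carrier = UNIV, monoid.mult = (*), monoid.one = 1, ring.zero = 0, ring.add = (+),
     module.smult = (\<lambda>r a. coeff_emb r * a) \<rparr>"

definition to_K :: "'i patch_ring \<Rightarrow> 'i::{finite, linorder} function_field" where
  "to_K a = Fract a 1"

definition t_K :: "'i \<Rightarrow> 'i::{finite, linorder} function_field" where
  "t_K i = to_K (coeff_emb (Poly_Mapping.single (Poly_Mapping.single i 1) 1))"

definition X_K :: "'i \<Rightarrow> 'i::{finite, linorder} function_field" where
  "X_K i = to_K (Poly_Mapping.single (Poly_Mapping.single i 1) 1)"

definition pos_part :: "('i \<Rightarrow> int) \<Rightarrow> ('i \<Rightarrow> int)" where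
  "pos_part x = (if \<forall>j. 0 \<le> x j then x else (\<lambda>_. 0))"

definition t_pow :: "('i \<Rightarrow> int) \<Rightarrow> 'i::{finite, linorder} function_field" where
  "t_pow x = (\<Prod>i \<in> UNIV. t_K i powi x i)"

text \<open>The \<open>R\<close>-algebra homomorphism to the function field that sends \<open>X\<^sub>i\<close> to \<open>g i\<close>, and its extension
  to the function field (meaningful when the homomorphism is injective).\<close>

definition subst ::
    "('i \<Rightarrow> 'i function_field) \<Rightarrow> 'i patch_ring \<Rightarrow> 'i::{finite, linorder} function_field" where
  "subst g a = (\<Sum>m \<in> Poly_Mapping.keys a.
     to_K (coeff_emb (Poly_Mapping.lookup a m)) * (\<Prod>i \<in> UNIV. g i ^ Poly_Mapping.lookup m i))"

definition subst_K ::
    "('i \<Rightarrow> 'i function_field) \<Rightarrow> 'i function_field \<Rightarrow> 'i::{finite, linorder} function_field" where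
  "subst_K g x = (THE y. \<forall>a b. b \<noteq> 0 \<and> x = Fract a b \<longrightarrow> y = subst g a / subst g b)"

text \<open>The comorphism of the mutation in direction \<open>k\<close> of the seed \<open>e\<close> with \<open>c\<close>-vectors \<open>c\<close>. The function
  fields of all patches are the same type; the argument is a rational function on the mutated patch,
  the value one on the original patch.\<close>

definition mutation_var :: "('i, 'n) fixed_data \<Rightarrow> ('i \<Rightarrow> 'n) \<Rightarrow> ('i \<Rightarrow> 'i \<Rightarrow> int) \<Rightarrow> 'i
    \<Rightarrow> 'i \<Rightarrow> 'i::{finite, linorder} function_field" where
  "mutation_var D e c k i =
     (if i = k then inverse (X_K k)
      else X_K i *
        (t_pow (pos_part (\<lambda>j. sgn (eps D e i k) * c k j))
         + t_pow (pos_part (\<lambda>j. - sgn (eps D e i k) * c k j)) * X_K k powi (- sgn (eps D e i k)))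
        powi (- eps D e i k))"

definition mutation_comorphism :: "('i, 'n) fixed_data \<Rightarrow> ('i \<Rightarrow> 'n) \<Rightarrow> ('i \<Rightarrow> 'i \<Rightarrow> int) \<Rightarrow> 'i
    \<Rightarrow> 'i function_field \<Rightarrow> 'i::{finite, linorder} function_field" where
  "mutation_comorphism D e c k = subst_K (mutation_var D e c k)"

text \<open>The comorphism of the composite birational map from the initial patch to the patch at \<open>w\<close>.\<close>

primrec comorphism_from_initial :: "('i, 'n::ab_group_add) fixed_data \<Rightarrow> ('i \<Rightarrow> 'n) \<Rightarrow> 'i list
    \<Rightarrow> 'i function_field \<Rightarrow> 'i::{finite, linorder} function_field" where
  "comorphism_from_initial D e0 [] = id"
| "comorphism_from_initial D e0 (k # w) =
     comorphism_from_initial D e0 w \<circ> mutation_comorphism D (seed_at D e0 w) (c_at D e0 w) k"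

text \<open>The comorphism of the composite birational map from the patch at \<open>w\<close> to the patch at \<open>w'\<close>
  (through the initial patch): it maps rational functions on the latter to rational functions on the
  former.\<close>

definition comorphism :: "('i, 'n::ab_group_add) fixed_data \<Rightarrow> ('i \<Rightarrow> 'n) \<Rightarrow> 'i list \<Rightarrow> 'i list
    \<Rightarrow> 'i function_field \<Rightarrow> 'i::{finite, linorder} function_field" where
  "comorphism D e0 w w' =
     inv_into UNIV (comorphism_from_initial D e0 w) \<circ> comorphism_from_initial D e0 w'"


section \<open>Gluing\<close>

text \<open>The image of an element of a local ring of a patch in the function field.\<close>

definition germ_val ::
    "('i patch_ring \<times> 'i patch_ring) set \<Rightarrow> 'i::{finite, linorder} function_field" where
  "germ_val z = (THE x. \<forall>(a, s) \<in> z. x = Fract a s)"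

text \<open>The birational map with comorphism \<open>\<theta>\<close> restricts to the isomorphism of schemes
  \<open>f: U \<rightarrow> U'\<close> between open subschemes of two patches.\<close>

definition restricts_to_iso ::
    "('i function_field \<Rightarrow> 'i::{finite, linorder} function_field)
     \<Rightarrow> 'i patch_ring set set \<Rightarrow> 'i patch_ring set set
     \<Rightarrow> ('i patch_ring set \<Rightarrow> 'i patch_ring set) \<Rightarrow> bool" where
  "restricts_to_iso \<theta> U U' f \<longleftrightarrow>
     openin (spec_top patch) U \<and> openin (spec_top patch) U' \<and>
     homeomorphic_map (subtopology (spec_top patch) U) (subtopology (spec_top patch) U') f \<and>
     (\<forall>V. openin (spec_top patch) V \<and> V \<subseteq> U' \<longrightarrow>
        (\<exists>\<phi> \<in> ring_iso (structure_sheaf patch V) (structure_sheaf patch {p \<in> U. f p \<in> V}).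
           \<forall>\<sigma> \<in> carrier (structure_sheaf patch V). \<forall>p \<in> U. f p \<in> V \<longrightarrow>
             germ_val (\<phi> \<sigma> p) = \<theta> (germ_val (\<sigma> (f p)))))"

text \<open>Two restrictions to isomorphisms agree where both are defined, so gluing along the largest open
  subset is gluing along the union of all of them.\<close>

definition glue_rel :: "('i::{finite, linorder}, 'n::ab_group_add) fixed_data \<Rightarrow> ('i \<Rightarrow> 'n)
    \<Rightarrow> (('i list \<times> 'i patch_ring set) \<times> ('i list \<times> 'i patch_ring set)) set" where
  "glue_rel D e0 = {((w, p), (w', p')). w \<in> words D \<and> w' \<in> words D \<and>
     (\<exists>U U' f. restricts_to_iso (comorphism D e0 w w') U U' f \<and> p \<in> U \<and> p' = f p)}"

type_synonym 'i Xhat_point = "('i list \<times> 'i patch_ring set) set"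
type_synonym 'i Xhat_section =
  "'i list \<Rightarrow> 'i patch_ring set \<Rightarrow> ('i patch_ring \<times> 'i patch_ring) set"

definition Xhat_points :: "('i::{finite, linorder}, 'n::ab_group_add) fixed_data \<Rightarrow> ('i \<Rightarrow> 'n)
    \<Rightarrow> 'i Xhat_point set" where
  "Xhat_points D e0 =
     (words D \<times> {p. primeideal p (patch :: 'i patch_ring ring)}) // glue_rel D e0"

definition in_patch :: "('i::{finite, linorder}, 'n::ab_group_add) fixed_data \<Rightarrow> ('i \<Rightarrow> 'n)
    \<Rightarrow> 'i list \<Rightarrow> 'i Xhat_point set \<Rightarrow> 'i patch_ring set set" where
  "in_patch D e0 w W = {p. primeideal p patch \<and> glue_rel D e0 `` {(w, p)} \<in> W}"

definition Xhat_top :: "('i::{finite, linorder}, 'n::ab_group_add) fixed_data \<Rightarrow> ('i \<Rightarrow> 'n)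
    \<Rightarrow> 'i Xhat_point topology" where
  "Xhat_top D e0 = topology (\<lambda>W. W \<subseteq> Xhat_points D e0 \<and>
     (\<forall>w \<in> words D. openin (spec_top patch) (in_patch D e0 w W)))"

text \<open>A section over \<open>W\<close> is a family of sections on the patches, compatible with the gluing
  isomorphisms.\<close>

definition Xhat_sheaf :: "('i::{finite, linorder}, 'n::ab_group_add) fixed_data \<Rightarrow> ('i \<Rightarrow> 'n)
    \<Rightarrow> 'i Xhat_point set \<Rightarrow> ('i coeff_ring, 'i Xhat_section) module" where
  "Xhat_sheaf D e0 W =
     \<lparr> carrier =
         {\<sigma> \<in> (\<Pi>\<^sub>E w \<in> words D. carrier (structure_sheaf patch (in_patch D e0 w W))).
           \<forall>w p w' p'. ((w, p), (w', p')) \<in> glue_rel D e0 \<and> p \<in> in_patch D e0 w W \<longrightarrow>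
             germ_val (\<sigma> w p) = comorphism D e0 w w' (germ_val (\<sigma> w' p'))},
       monoid.mult = (\<lambda>\<sigma> \<tau>. \<lambda>w \<in> words D. \<sigma> w \<otimes>\<^bsub>structure_sheaf patch (in_patch D e0 w W)\<^esub> \<tau> w),
       monoid.one = (\<lambda>w \<in> words D. \<one>\<^bsub>structure_sheaf patch (in_patch D e0 w W)\<^esub>),
       ring.zero = (\<lambda>w \<in> words D. \<zero>\<^bsub>structure_sheaf patch (in_patch D e0 w W)\<^esub>),
       ring.add = (\<lambda>\<sigma> \<tau>. \<lambda>w \<in> words D. \<sigma> w \<oplus>\<^bsub>structure_sheaf patch (in_patch D e0 w W)\<^esub> \<tau> w),
       module.smult = (\<lambda>r \<sigma>. \<lambda>w \<in> words D. \<lambda>p \<in> in_patch D e0 w W.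
         loc_frac patch p (coeff_emb r) 1 \<otimes>\<^bsub>localization patch p\<^esub> \<sigma> w p) \<rparr>"

definition Xhat_res :: "('i::{finite, linorder}, 'n::ab_group_add) fixed_data \<Rightarrow> ('i \<Rightarrow> 'n)
    \<Rightarrow> 'i Xhat_point set \<Rightarrow> 'i Xhat_point set \<Rightarrow> 'i Xhat_section \<Rightarrow> 'i Xhat_section" where
  "Xhat_res D e0 W W' \<sigma> = (\<lambda>w \<in> words D. restrict (\<sigma> w) (in_patch D e0 w W'))"

text \<open>The open subset of the glued scheme that is the image of the patch at \<open>w\<close>, and the section over
  it given by the regular function \<open>a\<close> on that patch.\<close>

definition patch_open :: "('i::{finite, linorder}, 'n::ab_group_add) fixed_data \<Rightarrow> ('i \<Rightarrow> 'n)
    \<Rightarrow> 'i list \<Rightarrow> 'i Xhat_point set" where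
  "patch_open D e0 w = (\<lambda>p. glue_rel D e0 `` {(w, p)}) ` {p. primeideal p patch}"

definition patch_section :: "('i::{finite, linorder}, 'n::ab_group_add) fixed_data \<Rightarrow> ('i \<Rightarrow> 'n)
    \<Rightarrow> 'i list \<Rightarrow> 'i patch_ring \<Rightarrow> 'i Xhat_section" where
  "patch_section D e0 w a = (THE \<sigma>. \<sigma> \<in> carrier (Xhat_sheaf D e0 (patch_open D e0 w)) \<and>
     (\<forall>p. primeideal p patch \<longrightarrow> \<sigma> w p = loc_frac patch p a 1))"


section \<open>The brackets on the patches\<close>

definition lattice_vec :: "('i::finite \<Rightarrow> 'n::ab_group_add) \<Rightarrow> ('i \<Rightarrow>\<^sub>0 nat) \<Rightarrow> 'n" where
  "lattice_vec e m = (\<Sum>i \<in> UNIV. zmul (int (Poly_Mapping.lookup m i)) (e i))"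

definition monomial :: "('i \<Rightarrow>\<^sub>0 nat) \<Rightarrow> 'i::{finite, linorder} patch_ring" where
  "monomial m = Poly_Mapping.single m 1"

definition rat_const :: "rat \<Rightarrow> 'i::{finite, linorder} coeff_ring" where
  "rat_const q = Poly_Mapping.single 0 (of_rat q)"

text \<open>The \<open>R\<close>-bilinear extension of the given bracket of monomials of the seed \<open>e\<close>.\<close>

definition patch_bracket :: "('i, 'n) fixed_data \<Rightarrow> ('i \<Rightarrow> 'n::ab_group_add)
    \<Rightarrow> 'i patch_ring \<Rightarrow> 'i patch_ring \<Rightarrow> 'i::{finite, linorder} patch_ring" where
  "patch_bracket D e f g = (\<Sum>m \<in> Poly_Mapping.keys f. \<Sum>n \<in> Poly_Mapping.keys g.
     coeff_emb (Poly_Mapping.lookup f m * Poly_Mapping.lookup g n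
       * rat_const (2 * form D (lattice_vec e m) (lattice_vec e n))) * monomial (m + n))"

end

theory Submission
  imports Defs
begin

text \<open>
  All patches have the same function field \<open>K\<close>, and the comorphism \<open>\<theta>\<^sub>w\<close> of the birational map from the
  initial patch to the patch at \<open>w\<close> is an automorphism of \<open>K\<close> over \<open>R\<close>. The proof carries everything
  into \<open>K\<close> along these automorphisms; there, both the glued scheme and its bracket become global
  objects.

  The geometric half. The coordinate ring of a patch is a domain, so its local rings are subrings of
  \<open>K\<close>, and a section over a nonempty open set is a single element of \<open>K\<close> that lies in the local rings of
  all points of the set (\<open>carrier_structure_sheaf\<close>). Two points \<open>p\<close> and \<open>p'\<close> of the patches at \<open>w\<close> and
  \<open>w'\<close> are glued if and only if \<open>\<theta>\<^sub>w\<close> and \<open>\<theta>\<^sub>w\<^sub>'\<close> carry their local rings to the same subring of \<open>K\<close>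
  (\<open>glue_rel_iff\<close>). One direction looks at stalks; the other one uses that a polynomial ring is finitely
  generated, so that a birational map which is an isomorphism of local rings at a point is one near
  that point (\<open>openin_transport\<close>). Consequently the points of the glued scheme are certain local subrings
  of \<open>K\<close>, its sections over a nonempty open set are the elements of \<open>K\<close> that lie in all of them
  (\<open>carrier_Xhat_sheaf\<close>), the sheaf condition holds because all nonempty open sets contain the generic
  point, and the patches are open affine subschemes (\<open>has_affine_nbhd_Xhat\<close>).

  The Poisson half. The logarithmic derivations \<open>D\<^sub>i = X\<^sub>i \<partial>/\<partial>X\<^sub>i\<close> commute, and the bracket of a seed is
  \<open>{f, g} = \<Sum>\<^sub>i\<^sub>j \<Lambda>\<^sub>i\<^sub>j D\<^sub>i f D\<^sub>j g\<close> with the constant skew matrix \<open>\<Lambda>\<^sub>i\<^sub>j = 2 {e\<^sub>i, e\<^sub>j}\<close>. Such an expression is a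
  Poisson bracket, and it makes sense on all of \<open>K\<close> (\<open>poisson_deriv_bracket\<close>). A mutation in direction
  \<open>k\<close> turns the variables into \<open>X^{e\<^sub>i'} P^{-\<epsilon>\<^sub>i\<^sub>k}\<close>, with one binomial \<open>P\<close> in \<open>X\<^sub>k\<close> for all \<open>i\<close>. Since
  \<open>{log X^v, log P} = 2 {v, e\<^sub>k} X\<^sub>k P'/P\<close>, the powers of \<open>P\<close> contribute a multiple of
  \<open>\<epsilon>\<^sub>i\<^sub>k {e\<^sub>j, e\<^sub>k} - \<epsilon>\<^sub>j\<^sub>k {e\<^sub>i, e\<^sub>k}\<close> to the bracket of two new variables, which is zero because
  \<open>\<epsilon>\<^sub>i\<^sub>k = {e\<^sub>i, e\<^sub>k} d\<^sub>k\<close>; what remains is the bracket of the mutated seed (\<open>seed_matrix_mutate\<close>,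
  \<open>mutation_comorphism_poisson\<close>). So the bracket of the initial seed on \<open>K\<close> is, seen from any patch, the
  bracket of that patch. By the quotient rule it preserves every local ring, hence the sections over
  every open set, and this defines the global bracket. It is unique because a derivation in each
  argument is determined on fractions by its values on the coordinate ring of one patch
  (\<open>Xhat_bracket_unique\<close>).
\<close>

section \<open>Prime spectra of integral domains\<close>

lemma type_ring_sel [simp]:
  "carrier ring_of_type_algebra = UNIV"
  "x \<otimes>\<^bsub>ring_of_type_algebra\<^esub> y = x * y"
  "x \<oplus>\<^bsub>ring_of_type_algebra\<^esub> y = x + y"
  "\<one>\<^bsub>ring_of_type_algebra\<^esub> = 1"
  "\<zero>\<^bsub>ring_of_type_algebra\<^esub> = 0"
  by (simp_all add: ring_of_type_algebra_def)

lemma type_ring_a_inv [simp]: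
  "\<ominus>\<^bsub>ring_of_type_algebra\<^esub> (x::'a::comm_ring_1) = - x"
proof -
  interpret cring "ring_of_type_algebra :: 'a ring" by (rule cring_from_type_algebra)
  show ?thesis by (rule minus_equality) simp_all
qed

lemma type_ring_a_minus [simp]:
  "(x::'a::comm_ring_1) \<ominus>\<^bsub>ring_of_type_algebra\<^esub> y = x - y"
  by (simp add: a_minus_def)

abbreviation prime_pt :: "'a::comm_ring_1 set \<Rightarrow> bool" where
  "prime_pt p \<equiv> primeideal p ring_of_type_algebra"

lemma prime_pt_iff:
  "prime_pt (p :: 'a::comm_ring_1 set) \<longleftrightarrow>
     0 \<in> p \<and> (\<forall>a \<in> p. \<forall>b \<in> p. a + b \<in> p) \<and> (\<forall>a \<in> p. \<forall>b. b * a \<in> p) \<and> 1 \<notin> p \<and>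
     (\<forall>a b. a * b \<in> p \<longrightarrow> a \<in> p \<or> b \<in> p)" (is "_ \<longleftrightarrow> ?P")
proof
  assume "prime_pt p"
  then interpret primeideal p "ring_of_type_algebra :: 'a ring" .
  have "1 \<notin> p" using I_notcarr one_imp_carrier by auto
  moreover have "a * b \<in> p \<longrightarrow> a \<in> p \<or> b \<in> p" for a b using I_prime[of a b] by simp
  moreover have "\<forall>a \<in> p. \<forall>b. b * a \<in> p" using I_l_closed by simp
  moreover have "\<forall>a \<in> p. \<forall>b \<in> p. a + b \<in> p" using additive_subgroup.a_closed[OF is_additive_subgroup] by simp
  moreover have "0 \<in> p" using additive_subgroup.zero_closed[OF is_additive_subgroup] by simp
  ultimately show ?P by blast
next
  assume P: ?P
  interpret cring "ring_of_type_algebra :: 'a ring" by (rule cring_from_type_algebra)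
  have neg: "- a \<in> p" if "a \<in> p" for a using P that by (metis mult_minus1)
  show "prime_pt p"
  proof (rule primeidealI)
    show "ideal p ring_of_type_algebra"
    proof (rule idealI)
      show "subgroup p (add_monoid (ring_of_type_algebra :: 'a ring))"
      proof (rule subgroup.intro)
        fix a assume "a \<in> p"
        then show "inv\<^bsub>add_monoid ring_of_type_algebra\<^esub> a \<in> p"
          unfolding a_inv_def[symmetric] using neg by simp
      qed (use P in auto)
    qed (use P in \<open>auto simp: mult.commute intro: ring_axioms\<close>)
    show "cring (ring_of_type_algebra :: 'a ring)" by (rule cring_from_type_algebra)
    show "carrier ring_of_type_algebra \<noteq> p" using P by auto
  qed (use P in auto)
qed

context
  fixes p :: "'a::comm_ring_1 set"
  assumes p: "prime_pt p"
begin

lemma prime_zero: "0 \<in> p" using p by (auto simp: prime_pt_iff)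
lemma prime_one: "1 \<notin> p" using p by (auto simp: prime_pt_iff)
lemma prime_mult_iff: "a * b \<in> p \<longleftrightarrow> a \<in> p \<or> b \<in> p"
  using p unfolding prime_pt_iff by (metis mult.commute)
lemma prime_add: "a \<in> p \<Longrightarrow> b \<in> p \<Longrightarrow> a + b \<in> p" using p by (auto simp: prime_pt_iff)
lemma prime_nonzero: "s \<notin> p \<Longrightarrow> s \<noteq> 0" using prime_zero by auto

end

lemma zero_prime: "prime_pt {0 :: 'a::idom}"
  by (auto simp: prime_pt_iff)


subsection \<open>The Zariski topology\<close>

abbreviation Spec :: "'a::comm_ring_1 set topology" where
  "Spec \<equiv> spec_top ring_of_type_algebra"

lemma openin_Spec:
  "openin Spec (U :: 'a::comm_ring_1 set set) \<longleftrightarrow> (\<exists>S. U = {p. prime_pt p \<and> \<not> S \<subseteq> p})"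
proof -
  let ?O = "\<lambda>U :: 'a set set. \<exists>S. U = {p. prime_pt p \<and> \<not> S \<subseteq> p}"
  have "istopology ?O"
    unfolding istopology_def
  proof safe
    fix S T :: "'a set"
    have "{p. prime_pt p \<and> \<not> S \<subseteq> p} \<inter> {p. prime_pt p \<and> \<not> T \<subseteq> p}
        = {p. prime_pt p \<and> \<not> {a * b | a b. a \<in> S \<and> b \<in> T} \<subseteq> p}" (is "?l = ?r")
    proof (intro equalityI subsetI)
      fix p assume "p \<in> ?l"
      then show "p \<in> ?r" using prime_mult_iff[of p] by (auto simp: subset_iff)
    next
      fix p assume "p \<in> ?r"
      then show "p \<in> ?l" using prime_mult_iff[of p] by (auto simp: subset_iff)
    qed
    then show "\<exists>Sa. {p. prime_pt p \<and> \<not> S \<subseteq> p} \<inter> {p. prime_pt p \<and> \<not> T \<subseteq> p} =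
        {p. prime_pt p \<and> \<not> Sa \<subseteq> p}" by blast
  next
    fix \<K> :: "'a set set set"
    assume "\<forall>K\<in>\<K>. ?O K"
    then obtain f where f: "\<And>K. K \<in> \<K> \<Longrightarrow> K = {p. prime_pt p \<and> \<not> f K \<subseteq> p}" by metis
    have "\<Union>\<K> = {p. prime_pt p \<and> \<not> (\<Union>K\<in>\<K>. f K) \<subseteq> p}" using f by blast
    then show "?O (\<Union>\<K>)" by blast
  qed
  then show ?thesis by (simp add: spec_top_def topology_inverse')
qed

lemma openin_basic: "openin Spec {p :: 'a::comm_ring_1 set. prime_pt p \<and> s \<notin> p}"
  unfolding openin_Spec by (rule exI[of _ "{s}"]) simp

lemma openin_Spec_prime: "openin Spec U \<Longrightarrow> p \<in> U \<Longrightarrow> prime_pt p"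
  by (auto simp: openin_Spec)

lemma openin_Spec_subset: "openin Spec V \<Longrightarrow> V \<subseteq> {p. prime_pt p}"
  using openin_Spec_prime by blast

lemma openin_Spec_all: "openin Spec {p :: 'a::comm_ring_1 set. prime_pt p}"
  proof -
  have "{p :: 'a set. prime_pt p} = {p. prime_pt p \<and> 1 \<notin> p}" using prime_one by blast
  then show ?thesis using openin_basic[of 1] by simp
qed

lemma topspace_Spec: "topspace Spec = {p :: 'a::comm_ring_1 set. prime_pt p}"
  using openin_Spec_all openin_Spec_prime by (metis (no_types, lifting) Collect_cong mem_Collect_eq
      openin_subset openin_topspace subsetD subset_antisym subsetI)

text \<open>The spectrum of a domain is irreducible: the zero ideal is its generic point.\<close>

lemma generic_in_open: "openin Spec U \<Longrightarrow> U \<noteq> {} \<Longrightarrow> {0 :: 'a::idom} \<in> U"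
  using zero_prime prime_zero unfolding openin_Spec by blast


subsection \<open>Local rings inside the fraction field\<close>

text \<open>The localization of a domain at a prime embeds into the fraction field, where the local rings at
  all primes can be compared. The equivalence class that represents \<open>x\<close> in the localization
  consists of the ways to write \<open>x\<close> with a denominator outside of the prime.\<close>

definition local_ring :: "'a::idom set \<Rightarrow> 'a fract set" where
  "local_ring p = {Fract a s | a s. s \<notin> p}"

definition germ :: "'a::idom set \<Rightarrow> 'a fract \<Rightarrow> ('a \<times> 'a) set" where
  "germ p x = {(a, s). s \<notin> p \<and> x = Fract a s}"

lemma local_ringE:
  assumes "x \<in> local_ring p" obtains a s where "x = Fract a s" "s \<notin> p"
  using assms by (auto simp: local_ring_def)

lemma local_ringI: "s \<notin> p \<Longrightarrow> Fract a s \<in> local_ring p"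
  by (auto simp: local_ring_def)

context
  fixes p :: "'a::idom set"
  assumes p: "prime_pt p"
begin

lemma local_ring_base: "Fract a 1 \<in> local_ring p"
  using prime_one[OF p] by (rule local_ringI)

lemma local_ring_0: "0 \<in> local_ring p" and local_ring_1: "1 \<in> local_ring p"
  using local_ring_base[of 0] local_ring_base[of 1] by (simp_all add: fract_expand)

lemma local_ring_add: "x \<in> local_ring p \<Longrightarrow> y \<in> local_ring p \<Longrightarrow> x + y \<in> local_ring p"
  by (elim local_ringE)
    (auto simp: prime_nonzero[OF p] prime_mult_iff[OF p] intro!: local_ringI)

lemma local_ring_mult: "x \<in> local_ring p \<Longrightarrow> y \<in> local_ring p \<Longrightarrow> x * y \<in> local_ring p"
  by (elim local_ringE) (auto simp: prime_mult_iff[OF p] intro!: local_ringI)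

lemma local_ring_uminus: "x \<in> local_ring p \<Longrightarrow> - x \<in> local_ring p"
  by (elim local_ringE) (auto intro!: local_ringI)

lemma inverse_in_local_ring: "inverse (Fract a 1) \<in> local_ring p \<longleftrightarrow> a = 0 \<or> a \<notin> p"
proof
  assume "inverse (Fract a 1) \<in> local_ring p"
  then obtain b s where bs: "Fract 1 a = Fract b s" "s \<notin> p" by (auto elim: local_ringE)
  show "a = 0 \<or> a \<notin> p"
  proof (rule ccontr)
    assume "\<not> ?thesis"
    then have "s = b * a" "a \<in> p" using bs prime_nonzero[OF p] by (auto simp: eq_fract)
    then show False using bs prime_mult_iff[OF p] by auto
  qed
qed (auto simp: fract_collapse local_ring_0 intro: local_ringI)

text \<open>A prime is recovered from its local ring, as the set of the non-units.\<close>

lemma mem_prime_iff: "a \<in> p \<longleftrightarrow> a = 0 \<or> inverse (Fract a 1) \<notin> local_ring p"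
  using inverse_in_local_ring[of a] prime_zero[OF p] by auto

lemma germ_eq_iff: "x \<in> local_ring p \<Longrightarrow> germ p x = germ p y \<longleftrightarrow> x = y"
  by (elim local_ringE) (auto simp: germ_def)

lemma germ_nonempty: "x \<in> local_ring p \<Longrightarrow> germ p x \<noteq> {}"
  by (elim local_ringE) (auto simp: germ_def)

text \<open>The factor \<open>u\<close> in the definition of the equivalence classes is nonzero and can be cancelled in a
  domain.\<close>

lemma loc_frac_eq_germ: "s \<notin> p \<Longrightarrow> loc_frac ring_of_type_algebra p a s = germ p (Fract a s)"
  unfolding loc_frac_def germ_def
  using prime_one[OF p] by (auto simp: eq_fract prime_nonzero[OF p])

lemma carrier_localization: "carrier (localization ring_of_type_algebra p) = germ p ` local_ring p"
proof -
  have "{loc_frac ring_of_type_algebra p a s | a s. s \<notin> p} = {germ p (Fract a s) | a s. s \<notin> p}"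
    using loc_frac_eq_germ by blast
  also have "\<dots> = germ p ` local_ring p"
    unfolding local_ring_def by blast
  finally show ?thesis by (simp add: localization_def)
qed

lemma localization_mult:
  assumes "x \<in> local_ring p" "y \<in> local_ring p"
  shows "germ p x \<otimes>\<^bsub>localization ring_of_type_algebra p\<^esub> germ p y = germ p (x * y)"
proof -
  have "(\<Union>(a, s) \<in> germ p x. \<Union>(b, t) \<in> germ p y. loc_frac ring_of_type_algebra p (a * b) (s * t))
      = (\<Union>z \<in> germ p x. \<Union>z' \<in> germ p y. germ p (x * y))"
    by (intro SUP_cong refl) (auto simp: germ_def loc_frac_eq_germ prime_mult_iff[OF p])
  then show ?thesis using germ_nonempty[OF assms(1)] germ_nonempty[OF assms(2)]
    by (simp add: localization_def)
qed

lemma localization_add: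
  assumes "x \<in> local_ring p" "y \<in> local_ring p"
  shows "germ p x \<oplus>\<^bsub>localization ring_of_type_algebra p\<^esub> germ p y = germ p (x + y)"
proof -
  have "(\<Union>(a, s) \<in> germ p x. \<Union>(b, t) \<in> germ p y.
          loc_frac ring_of_type_algebra p (a * t + b * s) (s * t))
      = (\<Union>z \<in> germ p x. \<Union>z' \<in> germ p y. germ p (x + y))"
    by (intro SUP_cong refl)
      (auto simp: germ_def loc_frac_eq_germ prime_mult_iff[OF p] prime_nonzero[OF p])
  then show ?thesis using germ_nonempty[OF assms(1)] germ_nonempty[OF assms(2)]
    by (simp add: localization_def)
qed

lemma localization_one: "\<one>\<^bsub>localization ring_of_type_algebra p\<^esub> = germ p 1"
  by (simp add: localization_def loc_frac_eq_germ prime_one[OF p] fract_collapse)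

lemma localization_zero: "\<zero>\<^bsub>localization ring_of_type_algebra p\<^esub> = germ p 0"
  by (simp add: localization_def loc_frac_eq_germ prime_one[OF p] fract_collapse)

end

lemma local_ring_inject:
  assumes "prime_pt p" "prime_pt q" "local_ring p = local_ring q" shows "p = q"
  using assms mem_prime_iff by (metis subsetI subset_antisym)

lemma local_ring_generic: "local_ring {0} = UNIV"
  by (auto simp: local_ring_def) (metis Fract_cases)

text \<open>The points where \<open>x\<close> is not regular are the primes that contain every denominator of \<open>x\<close>.\<close>

lemma openin_regular: "openin Spec {p. prime_pt p \<and> x \<in> local_ring p}"
proof -
  have "{p. prime_pt p \<and> x \<in> local_ring p} = {p. prime_pt p \<and> \<not> {s. \<exists>a. x = Fract a s} \<subseteq> p}"
    by (auto simp: local_ring_def)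
  then show ?thesis unfolding openin_Spec by blast
qed


subsection \<open>Sections of the structure sheaf are elements of the fraction field\<close>

abbreviation spec_sheaf :: "'a::idom set set \<Rightarrow> ('a set \<Rightarrow> ('a \<times> 'a) set) ring" where
  "spec_sheaf \<equiv> structure_sheaf ring_of_type_algebra"

definition regular_on :: "'a::idom set set \<Rightarrow> 'a fract set" where
  "regular_on U = {x. \<forall>p \<in> U. x \<in> local_ring p}"

definition spec_section :: "'a::idom set set \<Rightarrow> 'a fract \<Rightarrow> 'a set \<Rightarrow> ('a \<times> 'a) set" where
  "spec_section U x = (\<lambda>p \<in> U. germ p x)"

text \<open>Any two of the local representations of a section as a fraction are valid at the generic point, so
  they are the same element of the fraction field.\<close>

lemma carrier_structure_sheaf:
  fixes U :: "'a::idom set set"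
  assumes U: "openin Spec U"
  shows "carrier (spec_sheaf U) = spec_section U ` regular_on U"
proof (intro equalityI subsetI)
  fix \<sigma> assume "\<sigma> \<in> carrier (spec_sheaf U)"
  then have ext: "\<sigma> \<in> extensional U"
    and loc: "\<And>p. p \<in> U \<Longrightarrow> \<exists>V. openin Spec V \<and> p \<in> V \<and> V \<subseteq> U \<and>
           (\<exists>a s. \<forall>q \<in> V. s \<notin> q \<and> \<sigma> q = loc_frac ring_of_type_algebra q a s)"
    by (auto simp: structure_sheaf_def PiE_def)
  show "\<sigma> \<in> spec_section U ` regular_on U"
  proof (cases "U = {}")
    case True
    then have "\<sigma> = spec_section U 0" using ext by (auto simp: spec_section_def)
    then show ?thesis using True by (auto simp: regular_on_def)
  next
    case False
    \<comment> \<open>the value at the generic point, which lies in each of the covering sets \<open>V\<close>\<close>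
    define z where "z = \<sigma> {0}"
    have cover: "\<exists>a s. s \<notin> p \<and> \<sigma> p = germ p (Fract a s) \<and> z = germ {0} (Fract a s)" if "p \<in> U" for p
    proof -
      obtain V a s where V: "openin Spec V" "p \<in> V" "V \<subseteq> U"
        "\<forall>q \<in> V. s \<notin> q \<and> \<sigma> q = loc_frac ring_of_type_algebra q a s"
        using loc[OF \<open>p \<in> U\<close>] by metis
      have "{0} \<in> V" using generic_in_open V by blast
      then show ?thesis using V zero_prime openin_Spec_prime[OF U \<open>p \<in> U\<close>]
        by (metis loc_frac_eq_germ z_def)
    qed
    obtain x where x: "z = germ {0} x" using cover False by blast
    have "\<sigma> p = germ p x \<and> x \<in> local_ring p" if "p \<in> U" for p
      using cover[OF that] x germ_eq_iff[OF zero_prime] local_ring_generic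
      by (metis UNIV_I local_ringI)
    then have "\<sigma> = spec_section U x" "x \<in> regular_on U"
      using ext by (auto simp: spec_section_def regular_on_def extensional_def restrict_def fun_eq_iff)
    then show ?thesis by blast
  qed
next
  fix \<sigma> assume "\<sigma> \<in> spec_section U ` regular_on U"
  then obtain x where x: "x \<in> regular_on U" and \<sigma>: "\<sigma> = spec_section U x" by blast
  have pr: "\<And>p. p \<in> U \<Longrightarrow> prime_pt p" using U openin_Spec_prime by blast
  have "\<exists>V. openin Spec V \<and> p \<in> V \<and> V \<subseteq> U \<and>
           (\<exists>a s. \<forall>q \<in> V. s \<notin> q \<and> \<sigma> q = loc_frac ring_of_type_algebra q a s)" if "p \<in> U" for p
  proof -
    obtain a s where as: "x = Fract a s" "s \<notin> p"
      using x \<open>p \<in> U\<close> by (auto simp: regular_on_def local_ring_def)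
    show ?thesis
    proof (intro exI conjI)
      show "openin Spec (U \<inter> {p. prime_pt p \<and> s \<notin> p})" using U openin_basic by blast
      show "\<forall>q\<in>U \<inter> {p. prime_pt p \<and> s \<notin> p}. s \<notin> q \<and> \<sigma> q = loc_frac ring_of_type_algebra q a s"
        using as by (auto simp: \<sigma> spec_section_def loc_frac_eq_germ)
    qed (use as that pr in auto)
  qed
  moreover have "\<sigma> \<in> (\<Pi>\<^sub>E p \<in> U. carrier (localization ring_of_type_algebra p))"
    using x pr by (auto simp: \<sigma> spec_section_def carrier_localization regular_on_def)
  ultimately show "\<sigma> \<in> carrier (spec_sheaf U)"
    by (simp add: structure_sheaf_def)
qed

lemma spec_section_mult:
  assumes "openin Spec U" "x \<in> regular_on U" "y \<in> regular_on U"
  shows "spec_section U x \<otimes>\<^bsub>spec_sheaf U\<^esub> spec_section U y = spec_section U (x * y)"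
  using assms openin_Spec_prime[OF assms(1)]
  by (auto simp: structure_sheaf_def spec_section_def regular_on_def localization_mult fun_eq_iff restrict_def)

lemma spec_section_add:
  assumes "openin Spec U" "x \<in> regular_on U" "y \<in> regular_on U"
  shows "spec_section U x \<oplus>\<^bsub>spec_sheaf U\<^esub> spec_section U y = spec_section U (x + y)"
  using assms openin_Spec_prime[OF assms(1)]
  by (auto simp: structure_sheaf_def spec_section_def regular_on_def localization_add fun_eq_iff restrict_def)

lemma spec_section_one:
  assumes "openin Spec U"
  shows "\<one>\<^bsub>spec_sheaf U\<^esub> = spec_section U 1"
  using openin_Spec_prime[OF assms]
  by (auto simp: structure_sheaf_def spec_section_def localization_one fun_eq_iff restrict_def)

lemma spec_section_zero:
  assumes "openin Spec U"
  shows "\<zero>\<^bsub>spec_sheaf U\<^esub> = spec_section U 0"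
  using openin_Spec_prime[OF assms]
  by (auto simp: structure_sheaf_def spec_section_def localization_zero fun_eq_iff restrict_def)

lemma spec_section_restrict: "V \<subseteq> U \<Longrightarrow> restrict (spec_section U x) V = spec_section V x"
  by (auto simp: spec_section_def restrict_def fun_eq_iff)

lemma spec_section_eq_iff:
  assumes "openin Spec U" "x \<in> regular_on U"
  shows "spec_section U x = spec_section U y \<longleftrightarrow> U = {} \<or> x = y"
proof (cases "U = {}")
  case False
  then have "{0} \<in> U" using generic_in_open assms by blast
  moreover have "germ {0} x = germ {0} y \<longleftrightarrow> x = y"
    by (rule germ_eq_iff[OF zero_prime]) (simp add: local_ring_generic)
  ultimately show ?thesis by (auto simp: spec_section_def dest: fun_cong[of _ _ "{0}"])
qed (auto simp: spec_section_def)

lemma regular_on_mono: "V \<subseteq> U \<Longrightarrow> regular_on U \<subseteq> regular_on V"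
  by (auto simp: regular_on_def)


section \<open>Algebras and Poisson algebras presented as images of subrings\<close>

text \<open>Every ring of sections below is the image of a subring \<open>S\<close> of a function field under a map \<open>h\<close> that
  respects the operations, and its axioms are inherited because they are equations. The map \<open>h\<close> may
  fail to be injective: over the empty set it maps the whole of \<open>S\<close> to a single section.\<close>

locale ring_image =
  fixes S :: "'k::comm_ring_1 set" and h :: "'k \<Rightarrow> 's" and M :: "('s, 'm) ring_scheme"
  assumes zero_mem: "0 \<in> S" and one_mem: "1 \<in> S"
    and add_mem: "\<lbrakk>x \<in> S; y \<in> S\<rbrakk> \<Longrightarrow> x + y \<in> S"
    and mult_mem: "\<lbrakk>x \<in> S; y \<in> S\<rbrakk> \<Longrightarrow> x * y \<in> S"
    and uminus_mem: "x \<in> S \<Longrightarrow> - x \<in> S"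
    and carrier_image: "carrier M = h ` S"
    and image_add: "\<lbrakk>x \<in> S; y \<in> S\<rbrakk> \<Longrightarrow> h x \<oplus>\<^bsub>M\<^esub> h y = h (x + y)"
    and image_mult: "\<lbrakk>x \<in> S; y \<in> S\<rbrakk> \<Longrightarrow> h x \<otimes>\<^bsub>M\<^esub> h y = h (x * y)"
    and image_zero: "\<zero>\<^bsub>M\<^esub> = h 0" and image_one: "\<one>\<^bsub>M\<^esub> = h 1"
begin

lemma cring: "cring M"
proof (rule cringI)
  show "abelian_group M"
  proof (rule abelian_groupI)
    fix x assume "x \<in> carrier M"
    then obtain a where "a \<in> S" "x = h a" by (auto simp: carrier_image)
    then show "\<exists>y\<in>carrier M. y \<oplus>\<^bsub>M\<^esub> x = \<zero>\<^bsub>M\<^esub>"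
      by (intro bexI[of _ "h (- a)"]) (auto simp: carrier_image image_add image_zero uminus_mem)
  qed (auto simp: carrier_image image_add image_zero add_mem zero_mem ac_simps)
  show "comm_monoid M"
    by (rule comm_monoidI)
      (auto simp: carrier_image image_mult image_one mult_mem one_mem ac_simps)
qed (auto simp: carrier_image image_mult image_add mult_mem add_mem algebra_simps)

end

text \<open>The last assumption says that \<open>h x \<mapsto> h' (\<theta> x)\<close> is well defined and injective. It is what remains of
  the injectivity of \<open>h\<close> and \<open>h'\<close> over the empty set.\<close>

lemma ring_image_iso:
  assumes M: "ring_image S h M" and M': "ring_image S' h' M'"
    and \<theta>: "\<theta> ` S = S'" "\<And>x y. \<theta> (x + y) = \<theta> x + \<theta> y" "\<And>x y. \<theta> (x * y) = \<theta> x * \<theta> y" "\<theta> 1 = 1"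
    and eq: "\<And>x y. \<lbrakk>x \<in> S; y \<in> S\<rbrakk> \<Longrightarrow> h x = h y \<longleftrightarrow> h' (\<theta> x) = h' (\<theta> y)"
  shows "\<exists>\<phi> \<in> ring_iso M M'. \<forall>x \<in> S. \<phi> (h x) = h' (\<theta> x)"
proof -
  interpret M: ring_image S h M by (rule M)
  interpret M': ring_image S' h' M' by (rule M')
  define \<phi> where "\<phi> \<sigma> = h' (\<theta> (inv_into S h \<sigma>))" for \<sigma>
  have \<phi>: "\<phi> (h x) = h' (\<theta> x)" if "x \<in> S" for x
    unfolding \<phi>_def using eq[of "inv_into S h (h x)" x] that
    by (simp add: f_inv_into_f inv_into_into)
  have mem: "\<theta> x \<in> S'" if "x \<in> S" for x using \<theta>(1) that by blast
  have "\<phi> \<in> ring_hom M M'"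
    by (rule ring_hom_memI)
      (auto simp: M.carrier_image M'.carrier_image \<phi> M.image_add M'.image_add M.image_mult
        M'.image_mult M.image_one M'.image_one M.add_mem M.mult_mem M.one_mem mem \<theta>(2-4))
  moreover have "bij_betw \<phi> (carrier M) (carrier M')"
    unfolding bij_betw_def M.carrier_image M'.carrier_image
  proof
    show "inj_on \<phi> (h ` S)" using eq by (auto simp: inj_on_def \<phi>)
    show "\<phi> ` h ` S = h' ` S'" using \<phi> by (auto simp: \<theta>(1)[symmetric] image_image)
  qed
  ultimately show ?thesis using \<phi> by (auto simp: ring_iso_def)
qed

locale algebra_image = ring_image S h M
  for S :: "'k::comm_ring_1 set" and h :: "'k \<Rightarrow> 's" and M :: "('r::comm_ring_1, 's) module" +
  fixes \<iota> :: "'r \<Rightarrow> 'k"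
  assumes scalar_mem: "\<iota> r \<in> S"
    and scalar_add: "\<iota> (r + s) = \<iota> r + \<iota> s" and scalar_mult: "\<iota> (r * s) = \<iota> r * \<iota> s"
    and scalar_one: "\<iota> 1 = 1"
    and image_smult: "x \<in> S \<Longrightarrow> r \<odot>\<^bsub>M\<^esub> h x = h (\<iota> r * x)"
begin

lemma algebra: "algebra ring_of_type_algebra M"
  by (rule algebraI)
    (auto simp: cring cring_from_type_algebra carrier_image image_add image_mult image_smult
      scalar_mem scalar_add scalar_mult scalar_one add_mem mult_mem algebra_simps)

end

locale poisson_bracket =
  fixes \<iota> :: "'r::comm_ring_1 \<Rightarrow> 'k::comm_ring_1" and b :: "'k \<Rightarrow> 'k \<Rightarrow> 'k"
  assumes add_left: "b (x + y) z = b x z + b y z"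
    and add_right: "b x (y + z) = b x y + b x z"
    and scalar_left: "b (\<iota> r * x) y = \<iota> r * b x y"
    and scalar_right: "b x (\<iota> r * y) = \<iota> r * b x y"
    and alternating: "b x x = 0"
    and jacobi: "b x (b y z) + b y (b z x) + b z (b x y) = 0"
    and leibniz: "b (x * y) z = x * b y z + b x z * y"
begin

lemma skew: "b x y = - b y x"
proof -
  have "b (x + y) (x + y) = b x x + b y x + (b x y + b y y)"
    by (simp only: add_left add_right)
  then show ?thesis by (simp add: alternating eq_neg_iff_add_eq_0 add.commute)
qed

end

lemma (in algebra_image) poisson_algebra:
  assumes "poisson_bracket \<iota> b" and closed: "\<And>x y. \<lbrakk>x \<in> S; y \<in> S\<rbrakk> \<Longrightarrow> b x y \<in> S"
    and br: "\<And>x y. \<lbrakk>x \<in> S; y \<in> S\<rbrakk> \<Longrightarrow> br (h x) (h y) = h (b x y)"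
  shows "poisson_algebra ring_of_type_algebra M br"
proof -
  interpret poisson_bracket \<iota> b by fact
  show ?thesis
  proof (intro poisson_algebra.intro poisson_algebra_axioms.intro)
    fix f g k assume "f \<in> carrier M" "g \<in> carrier M" "k \<in> carrier M"
    then obtain x y z where xyz: "f = h x" "g = h y" "k = h z" "x \<in> S" "y \<in> S" "z \<in> S"
      by (auto simp: carrier_image)
    show "br f (br g k) \<oplus>\<^bsub>M\<^esub> br g (br k f) \<oplus>\<^bsub>M\<^esub> br k (br f g) = \<zero>\<^bsub>M\<^esub>"
      using xyz by (simp add: br closed image_add add_mem jacobi image_zero)
    show "br (f \<otimes>\<^bsub>M\<^esub> g) k = f \<otimes>\<^bsub>M\<^esub> br g k \<oplus>\<^bsub>M\<^esub> br f k \<otimes>\<^bsub>M\<^esub> g"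
      using xyz by (simp add: br closed image_add image_mult mult_mem leibniz)
  qed (auto simp: algebra carrier_image image_add image_mult image_smult image_zero br closed
      scalar_mem add_mem mult_mem add_left add_right scalar_left scalar_right alternating)
qed


section \<open>Brackets made of commuting derivations\<close>

text \<open>The target is a module over the source by means of \<open>\<phi>\<close>. Composing a derivation with a homomorphism,
  on either side, gives a map of this kind.\<close>

definition derivation_along :: "('a::comm_ring_1 \<Rightarrow> 'b::comm_ring_1) \<Rightarrow> ('a \<Rightarrow> 'b) \<Rightarrow> bool" where
  "derivation_along \<phi> d \<longleftrightarrow>
     (\<forall>x y. d (x + y) = d x + d y) \<and> (\<forall>x y. d (x * y) = \<phi> x * d y + d x * \<phi> y)"

abbreviation derivation :: "('a::comm_ring_1 \<Rightarrow> 'a) \<Rightarrow> bool" where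
  "derivation \<equiv> derivation_along (\<lambda>x. x)"

lemma derivation_along_add: "derivation_along \<phi> d \<Longrightarrow> d (x + y) = d x + d y"
  and derivation_along_mult: "derivation_along \<phi> d \<Longrightarrow> d (x * y) = \<phi> x * d y + d x * \<phi> y"
  by (simp_all add: derivation_along_def)

lemma derivation_along_0: assumes "derivation_along \<phi> d" shows "d 0 = 0"
  using derivation_along_add[OF assms, of 0 0] by simp

lemma derivation_along_sum: 
  assumes "derivation_along \<phi> d" shows "d (\<Sum>i\<in>I. f i) = (\<Sum>i\<in>I. d (f i))"
  by (induction I rule: infinite_finite_induct)
    (simp_all add: derivation_along_add[OF assms] derivation_along_0[OF assms])

text \<open>The quotient rule. If \<open>d\<close> is a derivation, all representations of \<open>x\<close> as a fraction give the same value.\<close>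

definition fract_derivation :: "('a::idom \<Rightarrow> 'a) \<Rightarrow> 'a fract \<Rightarrow> 'a fract" where
  "fract_derivation d x =
     (THE y. \<forall>a b. b \<noteq> 0 \<and> x = Fract a b \<longrightarrow> y = Fract (d a * b - a * d b) (b * b))"

lemma fract_derivation_Fract:
  assumes d: "derivation d" and b: "b \<noteq> 0"
  shows "fract_derivation d (Fract a b) = Fract (d a * b - a * d b) (b * b)"
  unfolding fract_derivation_def
proof (rule the_equality)
  show "\<forall>a' b'. b' \<noteq> 0 \<and> Fract a b = Fract a' b' \<longrightarrow>
    Fract (d a * b - a * d b) (b * b) = Fract (d a' * b' - a' * d b') (b' * b')"
  proof (intro allI impI, elim conjE)
    fix a' b' assume b': "b' \<noteq> 0" "Fract a b = Fract a' b'"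
    then have eq: "a * b' = a' * b" using b by (simp add: eq_fract)
    \<comment> \<open>differentiate \<open>a b' = a' b\<close> and eliminate \<open>d a\<close>\<close>
    have "a * d b' + d a * b' = a' * d b + d a' * b"
      using arg_cong[OF eq, of d] by (simp add: derivation_along_mult[OF d])
    then have h: "d a * b' = a' * d b + d a' * b - a * d b'" by (simp add: algebra_simps)
    have "(d a * b - a * d b) * (b' * b') = b * b' * (d a * b') - (a * b') * d b * b'"
      by (simp add: algebra_simps)
    also have "\<dots> = b * b' * (a' * d b + d a' * b - a * d b') - (a' * b) * d b * b'"
      by (simp only: h eq)
    also have "\<dots> = b * b' * (d a' * b) - b * d b' * (a * b')"
      by (simp add: algebra_simps)
    also have "\<dots> = (d a' * b' - a' * d b') * (b * b)"
      unfolding eq by (simp add: algebra_simps)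
    finally have "(d a * b - a * d b) * (b' * b') = (d a' * b' - a' * d b') * (b * b)" .
    then show "Fract (d a * b - a * d b) (b * b) = Fract (d a' * b' - a' * d b') (b' * b')"
      using b b' by (simp add: eq_fract)
  qed
qed (use b in blast)

lemma fract_derivation_base:
  assumes d: "derivation d"
  shows "fract_derivation d (Fract a 1) = Fract (d a) 1"
proof -
  have "d 1 = d 1 + d 1"
    using derivation_along_mult[OF d, of 1 1] by (simp only: mult_1 mult_1_right)
  then have "d 1 = 0" by (metis add_left_cancel add.right_neutral)
  then show ?thesis by (simp add: fract_derivation_Fract[OF d])
qed

lemma derivation_fract_derivation:
  assumes d: "derivation d" shows "derivation (fract_derivation d)"
  unfolding derivation_along_def
proof (intro conjI allI)
  fix x y :: "'a fract"
  obtain a b where x: "x = Fract a b" "b \<noteq> 0" by (cases x)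
  obtain a' b' where y: "y = Fract a' b'" "b' \<noteq> 0" by (cases y)
  note simps = fract_derivation_Fract[OF d] derivation_along_mult[OF d] derivation_along_add[OF d]
  show "fract_derivation d (x + y) = fract_derivation d x + fract_derivation d y"
    using x y by (simp add: simps eq_fract) (simp add: algebra_simps)
  show "fract_derivation d (x * y) = x * fract_derivation d y + fract_derivation d x * y"
    using x y by (simp add: simps eq_fract) (simp add: algebra_simps)
qed

text \<open>Writing \<open>x = a/b\<close> and applying the product rule to \<open>x b = a\<close> recovers \<open>d x\<close> from \<open>d a\<close>
  and \<open>d b\<close>.\<close>

lemma derivation_along_fract_eq:
  fixes d d' :: "'a::idom fract \<Rightarrow> 'k::field"
  assumes "derivation_along \<phi> d" "derivation_along \<phi> d'"
    and \<phi>: "\<And>a. a \<noteq> 0 \<Longrightarrow> \<phi> (Fract a 1) \<noteq> 0"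
    and eq: "\<And>a. d (Fract a 1) = d' (Fract a 1)"
  shows "d x = d' x"
proof -
  obtain a b where x: "x = Fract a b" "b \<noteq> 0" by (cases x)
  have xb: "x * Fract b 1 = Fract a 1" using x by (simp add: eq_fract)
  have "\<phi> x * d (Fract b 1) + d x * \<phi> (Fract b 1) = \<phi> x * d' (Fract b 1) + d' x * \<phi> (Fract b 1)"
    using eq[of a] unfolding xb[symmetric]
    by (simp add: derivation_along_mult[OF assms(1)] derivation_along_mult[OF assms(2)])
  then show ?thesis using \<phi>[OF x(2)] by (simp add: eq)
qed

lemma derivation_compose_diff:
  assumes d: "derivation d" and e: "derivation e"
  shows "derivation (\<lambda>x. d (e x) - e (d x))"
  unfolding derivation_along_def
  by (simp add: derivation_along_add[OF d] derivation_along_add[OF e] derivation_along_mult[OF d]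
      derivation_along_mult[OF e] algebra_simps)

text \<open>The commutator of the extensions is a derivation that vanishes on the domain, hence on its fractions.\<close>

lemma fract_derivation_commute:
  assumes d: "derivation d" and e: "derivation e" and comm: "\<And>a. d (e a) = e (d a)"
  shows "fract_derivation d (fract_derivation e x) = fract_derivation e (fract_derivation d x)"
proof -
  have "fract_derivation d (fract_derivation e x) - fract_derivation e (fract_derivation d x) = 0"
  proof (rule derivation_along_fract_eq[where \<phi> = "\<lambda>x. x" and d' = "\<lambda>_. 0"
        and d = "\<lambda>x. fract_derivation d (fract_derivation e x) - fract_derivation e (fract_derivation d x)"])
    show "derivation (\<lambda>x. fract_derivation d (fract_derivation e x)
        - fract_derivation e (fract_derivation d x))"
      by (intro derivation_compose_diff derivation_fract_derivation d e)
    show "derivation (\<lambda>_::'a fract. 0)" by (simp add: derivation_along_def)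
  qed (simp_all add: fract_derivation_base d e comm fract_expand eq_fract)
  then show ?thesis by simp
qed

definition deriv_bracket ::
    "('i::finite \<Rightarrow> 'k \<Rightarrow> 'k) \<Rightarrow> ('i \<Rightarrow> 'i \<Rightarrow> 'k) \<Rightarrow> 'k \<Rightarrow> 'k \<Rightarrow> 'k::comm_ring_1" where
  "deriv_bracket d \<Lambda> f g = (\<Sum>i\<in>UNIV. \<Sum>j\<in>UNIV. \<Lambda> i j * d i f * d j g)"

lemma derivation_along_lincomb:
  assumes "\<And>i. i \<in> I \<Longrightarrow> derivation_along \<phi> (d i)"
  shows "derivation_along \<phi> (\<lambda>x. \<Sum>i\<in>I. c i * d i x)"
  unfolding derivation_along_def
proof (intro conjI allI)
  fix x y
  show "(\<Sum>i\<in>I. c i * d i (x + y)) = (\<Sum>i\<in>I. c i * d i x) + (\<Sum>i\<in>I. c i * d i y)"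
    by (simp add: sum.distrib[symmetric] derivation_along_add[OF assms] distrib_left cong: sum.cong)
  have "(\<Sum>i\<in>I. c i * d i (x * y)) = (\<Sum>i\<in>I. \<phi> x * (c i * d i y) + c i * d i x * \<phi> y)"
    by (intro sum.cong refl) (simp add: derivation_along_mult[OF assms] algebra_simps)
  then show "(\<Sum>i\<in>I. c i * d i (x * y)) = \<phi> x * (\<Sum>i\<in>I. c i * d i y) + (\<Sum>i\<in>I. c i * d i x) * \<phi> y"
    by (simp add: sum.distrib sum_distrib_left sum_distrib_right)
qed

lemma derivation_bracket_left:
  assumes "\<And>i. derivation (d i)" shows "derivation (\<lambda>f. deriv_bracket d \<Lambda> f g)"
proof -
  have "(\<lambda>f. deriv_bracket d \<Lambda> f g) = (\<lambda>f. \<Sum>i\<in>UNIV. (\<Sum>j\<in>UNIV. \<Lambda> i j * d j g) * d i f)"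
    unfolding deriv_bracket_def by (simp add: sum_distrib_left sum_distrib_right ac_simps fun_eq_iff)
  then show ?thesis by (simp only:) (rule derivation_along_lincomb[OF assms])
qed

lemma derivation_bracket_right:
  assumes "\<And>i. derivation (d i)" shows "derivation (\<lambda>g. deriv_bracket d \<Lambda> f g)"
proof -
  have "(\<lambda>g. deriv_bracket d \<Lambda> f g) = (\<lambda>g. \<Sum>j\<in>UNIV. (\<Sum>i\<in>UNIV. \<Lambda> i j * d i f) * d j g)"
    unfolding deriv_bracket_def by (subst sum.swap) (simp add: sum_distrib_left sum_distrib_right ac_simps fun_eq_iff)
  then show ?thesis by (simp only:) (rule derivation_along_lincomb[OF assms])
qed

text \<open>Because the coefficients are constants and the derivations commute, \<open>{f, {g, h}}\<close> is the
  difference \<open>T f g h - T f h g\<close> of two contractions of \<open>\<Lambda> \<otimes> \<Lambda>\<close> with one second derivative, and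
  \<open>T\<close> is symmetric in its outer arguments; so the cyclic sum telescopes to zero.\<close>

lemma poisson_deriv_bracket:
  fixes d :: "'i::finite \<Rightarrow> 'k::idom \<Rightarrow> 'k"
  assumes d: "\<And>i. derivation (d i)" and comm: "\<And>i j x. d i (d j x) = d j (d i x)"
    and const: "\<And>i j k. d k (\<Lambda> i j) = 0" and skew: "\<And>i j. \<Lambda> i j = - \<Lambda> j i"
    and scal: "\<And>i r. d i (\<iota> r) = 0" and two: "(2::'k) \<noteq> 0"
  shows "poisson_bracket \<iota> (deriv_bracket d \<Lambda>)"
proof -
  let ?b = "deriv_bracket d \<Lambda>"
  note dl = derivation_bracket_left[of d \<Lambda>, OF d] and dr = derivation_bracket_right[of d \<Lambda>, OF d]
  have sk: "?b f g = - ?b g f" for f g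
  proof -
    have "?b g f = (\<Sum>j\<in>UNIV. \<Sum>i\<in>UNIV. \<Lambda> i j * d i g * d j f)"
      unfolding deriv_bracket_def by (rule sum.swap)
    also have "\<dots> = - ?b f g"
      unfolding deriv_bracket_def sum_negf[symmetric]
    proof (intro sum.cong refl)
      fix i j show "\<Lambda> i j * d i g * d j f = - (\<Lambda> j i * d j f * d i g)"
        using skew[of i j] by (simp add: mult.assoc mult.left_commute mult.commute)
    qed
    finally show ?thesis by simp
  qed
  have alt: "?b f f = 0" for f
  proof -
    have "2 * ?b f f = 0" using sk[of f f] by (metis mult_2 add.right_inverse)
    then show ?thesis using two by simp
  qed
  have scl: "?b (\<iota> r) g = 0" for r g by (simp add: deriv_bracket_def scal)
  define T where "T f g h = (\<Sum>i\<in>UNIV. \<Sum>j\<in>UNIV. \<Sum>k\<in>UNIV. \<Sum>l\<in>UNIV.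
      \<Lambda> i j * \<Lambda> k l * d i f * d j (d k g) * d l h)" for f g h
  have expand: "?b f (?b g h) = T f g h - T f h g" for f g h
  proof -
    have dj: "d j (?b g h) = (\<Sum>k\<in>UNIV. \<Sum>l\<in>UNIV. \<Lambda> k l * (d j (d k g) * d l h)) +
        (\<Sum>k\<in>UNIV. \<Sum>l\<in>UNIV. \<Lambda> k l * (d k g * d j (d l h)))" for j
      unfolding deriv_bracket_def
      by (simp add: derivation_along_sum[OF d] derivation_along_mult[OF d] const sum.distrib[symmetric]
          algebra_simps)
    have "(\<Sum>k\<in>UNIV. \<Sum>l\<in>UNIV. \<Lambda> k l * (d k g * d j (d l h))) =
        - (\<Sum>k\<in>UNIV. \<Sum>l\<in>UNIV. \<Lambda> k l * (d j (d k h) * d l g))" for j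
    proof -
      have "(\<Sum>k\<in>UNIV. \<Sum>l\<in>UNIV. \<Lambda> k l * (d k g * d j (d l h))) =
          (\<Sum>l\<in>UNIV. \<Sum>k\<in>UNIV. \<Lambda> k l * (d k g * d j (d l h)))" by (rule sum.swap)
      also have "\<dots> = (\<Sum>l\<in>UNIV. \<Sum>k\<in>UNIV. - (\<Lambda> l k * (d j (d l h) * d k g)))"
      proof (intro sum.cong refl)
        fix k l show "\<Lambda> k l * (d k g * d j (d l h)) = - (\<Lambda> l k * (d j (d l h) * d k g))"
          using skew[of k l] by (simp add: mult.commute)
      qed
      finally show ?thesis by (simp add: sum_negf)
    qed
    then have dj': "d j (?b g h) = (\<Sum>k\<in>UNIV. \<Sum>l\<in>UNIV. \<Lambda> k l * (d j (d k g) * d l h)) -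
        (\<Sum>k\<in>UNIV. \<Sum>l\<in>UNIV. \<Lambda> k l * (d j (d k h) * d l g))" for j
      by (simp add: dj)
    have T: "(\<Sum>i\<in>UNIV. \<Sum>j\<in>UNIV. \<Lambda> i j * d i f * (\<Sum>k\<in>UNIV. \<Sum>l\<in>UNIV. \<Lambda> k l * (d j (d k g) * d l h)))
        = T f g h" for f g h
      unfolding T_def by (simp add: sum_distrib_left ac_simps)
    show ?thesis
      unfolding deriv_bracket_def[of d \<Lambda> f "?b g h"] dj'
      by (simp add: right_diff_distrib sum_subtractf T)
  qed
  have sym: "T f g h = T h g f" for f g h
  proof -
    let ?F = "\<lambda>i j k l. \<Lambda> i j * \<Lambda> k l * d i f * d j (d k g) * d l h"
    have F: "?F i j k l = \<Lambda> l k * \<Lambda> j i * d l h * d k (d j g) * d i f" for i j k l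
      using skew[of i j] skew[of k l] comm[of j k g] by (simp add: ac_simps)
    let ?G = "\<lambda>l k j i. \<Lambda> l k * \<Lambda> j i * d l h * d k (d j g) * d i f"
    have "T f g h = (\<Sum>i\<in>UNIV. \<Sum>j\<in>UNIV. \<Sum>k\<in>UNIV. \<Sum>l\<in>UNIV. ?G l k j i)"
      unfolding T_def F ..
    also have "\<dots> = (\<Sum>i\<in>UNIV. \<Sum>j\<in>UNIV. \<Sum>l\<in>UNIV. \<Sum>k\<in>UNIV. ?G l k j i)"
      by (rule sum.cong[OF refl], rule sum.cong[OF refl], rule sum.swap)
    also have "\<dots> = (\<Sum>i\<in>UNIV. \<Sum>l\<in>UNIV. \<Sum>j\<in>UNIV. \<Sum>k\<in>UNIV. ?G l k j i)"
      by (rule sum.cong[OF refl], rule sum.swap)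
    also have "\<dots> = (\<Sum>i\<in>UNIV. \<Sum>l\<in>UNIV. \<Sum>k\<in>UNIV. \<Sum>j\<in>UNIV. ?G l k j i)"
      by (rule sum.cong[OF refl], rule sum.cong[OF refl], rule sum.swap)
    also have "\<dots> = (\<Sum>l\<in>UNIV. \<Sum>i\<in>UNIV. \<Sum>k\<in>UNIV. \<Sum>j\<in>UNIV. ?G l k j i)"
      by (rule sum.swap)
    also have "\<dots> = (\<Sum>l\<in>UNIV. \<Sum>k\<in>UNIV. \<Sum>i\<in>UNIV. \<Sum>j\<in>UNIV. ?G l k j i)"
      by (rule sum.cong[OF refl], rule sum.swap)
    also have "\<dots> = T h g f"
      unfolding T_def by (rule sum.cong[OF refl], rule sum.cong[OF refl], rule sum.swap)
    finally show ?thesis .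
  qed
  show ?thesis
  proof
    show "?b x (?b y z) + ?b y (?b z x) + ?b z (?b x y) = 0" for x y z
      unfolding expand using sym[of x y z] sym[of x z y] sym[of y x z] by simp
    show "?b (\<iota> r * x) y = \<iota> r * ?b x y" for r x y
      using derivation_along_mult[OF dl, of "\<iota> r" x] by (simp add: scl)
    show "?b x (\<iota> r * y) = \<iota> r * ?b x y" for r x y
      using derivation_along_mult[OF dr, of _ "\<iota> r"] by (simp add: scl sk[of x "\<iota> r"])
    show "?b (x * y) z = x * ?b y z + ?b x z * y" for x y z
      using derivation_along_mult[OF dl] by simp
  qed (use derivation_along_add[OF dl] derivation_along_add[OF dr] alt in auto)
qed


section \<open>The function field of a patch\<close>

lemma poly_mapping_add_induct [case_names zero add single]:
  assumes "P 0" "\<And>a b. P a \<Longrightarrow> P b \<Longrightarrow> P (a + b)" "\<And>m c. P (Poly_Mapping.single m c)"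
  shows "P (a :: 'm \<Rightarrow>\<^sub>0 'c::comm_monoid_add)"
proof (induction a rule: Poly_Mapping.update_induct)
  case (update f a b)
  have "Poly_Mapping.update a b f = f + Poly_Mapping.single a b"
    using update(1) by (intro poly_mapping_eqI)
      (auto simp: lookup_update lookup_add lookup_single in_keys_iff when_def)
  then show ?case using assms update by metis
qed (rule assms)

lemma single_eq_coeff_mult: "Poly_Mapping.single m c = coeff_emb c * monomial m"
  by (simp add: coeff_emb_def monomial_def mult_single)

lemma monomial_add: "monomial (m + n) = monomial m * monomial n"
  by (simp add: monomial_def mult_single)

definition X_poly :: "'i \<Rightarrow> 'i::{finite, linorder} patch_ring" where
  "X_poly i = monomial (Poly_Mapping.single i 1)"

lemma coeff_emb_hom:
  "coeff_emb (r + s) = coeff_emb r + coeff_emb s" "coeff_emb (r * s) = coeff_emb r * coeff_emb s"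
  "coeff_emb 1 = 1" "coeff_emb 0 = 0"
  by (simp_all add: coeff_emb_def single_add mult_single)

lemma patch_induct [case_names coeff var add mult]:
  assumes c: "\<And>r. P (coeff_emb r)" and x: "\<And>i. P (X_poly i)"
    and add: "\<And>a b. P a \<Longrightarrow> P b \<Longrightarrow> P (a + b)" and mult: "\<And>a b. P a \<Longrightarrow> P b \<Longrightarrow> P (a * b)"
  shows "P (a :: 'i::{finite, linorder} patch_ring)"
proof -
  have one: "P 1" using c[of 1] by (simp add: coeff_emb_hom)
  have "P (monomial m)" for m :: "'i \<Rightarrow>\<^sub>0 nat"
  proof (induction m rule: poly_mapping_add_induct)
    case zero
    then show ?case using one by (simp add: monomial_def)
  next
    case (add m n)
    then show ?case by (simp add: monomial_add mult)
  next
    case (single i k)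
    show ?case
    proof (induction k)
      case 0
      then show ?case using one by (simp add: monomial_def)
    next
      case (Suc k)
      have "Poly_Mapping.single i (Suc k) = Poly_Mapping.single i 1 + Poly_Mapping.single i k"
        by (simp flip: single_add)
      then show ?case using mult[OF x Suc] by (simp add: monomial_add X_poly_def)
    qed
  qed
  then show ?thesis
  proof (induction a rule: poly_mapping_add_induct)
    case zero
    then show ?case using c[of 0] by (simp add: coeff_emb_hom)
  qed (auto simp: single_eq_coeff_mult intro: add mult c)
qed

lemma to_K_hom:
  "to_K (a + b) = to_K a + to_K b" "to_K (a * b) = to_K a * to_K b" "to_K 1 = 1" "to_K 0 = 0"
  by (simp_all add: to_K_def fract_collapse)

lemma to_K_eq_iff: "to_K a = to_K b \<longleftrightarrow> a = b"
  by (simp add: to_K_def eq_fract)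

lemma to_K_eq_0_iff: "to_K a = 0 \<longleftrightarrow> a = 0"
  using to_K_eq_iff[of a 0] by (simp add: to_K_hom)

lemma Fract_eq_to_K: "b \<noteq> 0 \<Longrightarrow> Fract a b = to_K a / to_K b"
  by (simp add: to_K_def)

abbreviation const_K :: "'i coeff_ring \<Rightarrow> 'i::{finite, linorder} function_field" where
  "const_K r \<equiv> to_K (coeff_emb r)"

lemma const_K_hom:
  "const_K (r + s) = const_K r + const_K s" "const_K (r * s) = const_K r * const_K s"
  "const_K 1 = 1" "const_K 0 = 0"
  by (simp_all add: coeff_emb_hom to_K_hom)

lemma X_K_eq: "X_K i = to_K (X_poly i)"
  by (simp add: X_K_def X_poly_def monomial_def)

lemma X_K_nonzero: "X_K i \<noteq> 0"
proof -
  have "Poly_Mapping.lookup (X_poly i) (Poly_Mapping.single i 1) = 1"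
    by (simp add: X_poly_def monomial_def)
  then have "X_poly i \<noteq> 0" by (metis lookup_zero zero_neq_one)
  then show ?thesis by (simp add: X_K_eq to_K_eq_0_iff)
qed

lemma two_function_field_nonzero: "(2 :: 'i::{finite, linorder} function_field) \<noteq> 0"
proof -
  have two: "(2 :: 'i patch_ring) \<noteq> 0" by simp
  have "(2 :: 'i function_field) = to_K 1 + to_K 1" by (simp only: to_K_hom one_add_one)
  also have "\<dots> = to_K 2" by (simp only: to_K_hom(1)[symmetric] one_add_one)
  finally show ?thesis using two to_K_eq_0_iff[of 2] by metis
qed


subsection \<open>Substitution homomorphisms\<close>

definition ring_morphism :: "('a::comm_ring_1 \<Rightarrow> 'b::comm_ring_1) \<Rightarrow> bool" where
  "ring_morphism \<phi> \<longleftrightarrow> \<phi> 1 = 1 \<and> (\<forall>x y. \<phi> (x + y) = \<phi> x + \<phi> y) \<and> (\<forall>x y. \<phi> (x * y) = \<phi> x * \<phi> y)"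

lemma ring_morphismD:
  assumes "ring_morphism \<phi>"
  shows "\<phi> 1 = 1" "\<phi> (x + y) = \<phi> x + \<phi> y" "\<phi> (x * y) = \<phi> x * \<phi> y" "\<phi> 0 = 0" "\<phi> (- x) = - \<phi> x"
    "\<phi> (x ^ n) = \<phi> x ^ n"
proof -
  show a: "\<phi> (x + y) = \<phi> x + \<phi> y" for x y using assms by (simp add: ring_morphism_def)
  show 1: "\<phi> 1 = 1" and m: "\<phi> (x * y) = \<phi> x * \<phi> y" for x y
    using assms by (simp_all add: ring_morphism_def)
  show z: "\<phi> 0 = 0" using a[of 0 0] by simp
  show "\<phi> (- x) = - \<phi> x" using a[of x "- x"] by (simp add: z eq_neg_iff_add_eq_0 add.commute)
  show "\<phi> (x ^ n) = \<phi> x ^ n" by (induction n) (simp_all add: 1 m)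
qed

lemma ring_morphism_field:
  assumes \<phi>: "ring_morphism (\<phi> :: 'a::field \<Rightarrow> 'b::field)"
  shows "\<phi> x = 0 \<longleftrightarrow> x = 0" "\<phi> (inverse x) = inverse (\<phi> x)" "\<phi> (x / y) = \<phi> x / \<phi> y" "inj \<phi>"
proof -
  have nz: "\<phi> x \<noteq> 0" if "x \<noteq> 0" for x
    using ring_morphismD(3)[OF \<phi>, of x "inverse x"] that by (auto simp: ring_morphismD[OF \<phi>])
  then show z: "\<phi> x = 0 \<longleftrightarrow> x = 0" for x using ring_morphismD(4)[OF \<phi>] by blast
  show inv: "\<phi> (inverse x) = inverse (\<phi> x)" for x
  proof (cases "x = 0")
    case False
    then have "\<phi> x * \<phi> (inverse x) = 1"
      using ring_morphismD(3)[OF \<phi>, of x "inverse x"] by (simp add: ring_morphismD[OF \<phi>])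
    then show ?thesis by (simp add: inverse_unique)
  qed (simp add: ring_morphismD[OF \<phi>])
  show "\<phi> (x / y) = \<phi> x / \<phi> y" for x y
    by (simp add: divide_inverse ring_morphismD[OF \<phi>] inv)
  show "inj \<phi>"
  proof (rule injI)
    fix x y assume "\<phi> x = \<phi> y"
    then have "\<phi> (x + - y) = 0" by (simp only: ring_morphismD[OF \<phi>]) simp
    then show "x = y" unfolding z by simp
  qed
qed

lemma ring_morphism_comp: "ring_morphism \<phi> \<Longrightarrow> ring_morphism \<psi> \<Longrightarrow> ring_morphism (\<phi> \<circ> \<psi>)"
  by (simp add: ring_morphism_def)

lemma ring_morphism_inv:
  assumes \<phi>: "ring_morphism \<phi>" and bij: "bij \<phi>" shows "ring_morphism (inv_into UNIV \<phi>)"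
proof -
  have eq: "inv_into UNIV \<phi> y = x \<longleftrightarrow> y = \<phi> x" for x y using bij by (metis bij_inv_eq_iff)
  have f: "\<phi> (inv_into UNIV \<phi> y) = y" for y using bij by (simp add: bij_is_surj surj_f_inv_f)
  show ?thesis unfolding ring_morphism_def eq
    by (simp add: ring_morphismD[OF \<phi>] f)
qed

lemma subst_add: "subst g (a + b) = subst g a + subst g b"
  unfolding subst_def by (rule setsum_keys_plus_distrib) (simp_all add: const_K_hom distrib_right)

lemma subst_single:
  "subst g (Poly_Mapping.single m c) = const_K c * (\<Prod>i \<in> UNIV. g i ^ Poly_Mapping.lookup m i)"
  by (simp add: subst_def const_K_hom)

lemma subst_0: "subst g 0 = 0"
  by (simp add: subst_def)

lemma subst_mult: "subst g (a * b) = subst g a * subst g b"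
proof (induction a rule: poly_mapping_add_induct)
  case (single m c)
  show ?case
  proof (induction b rule: poly_mapping_add_induct)
    case (single n d)
    show ?case
      by (simp add: mult_single subst_single const_K_hom lookup_add power_add prod.distrib)
  qed (simp_all add: subst_0 subst_add distrib_left)
qed (simp_all add: subst_0 subst_add distrib_right)

lemma subst_coeff: "subst g (coeff_emb r) = const_K r"
  by (simp add: subst_single coeff_emb_def)

lemma ring_morphism_subst: "ring_morphism (subst g)"
  using subst_coeff[of g 1]
  by (simp add: ring_morphism_def subst_add subst_mult coeff_emb_hom to_K_hom)

lemma subst_X: "subst g (X_poly i) = g i"
proof -
  have "(\<Prod>j\<in>UNIV. g j ^ Poly_Mapping.lookup (Poly_Mapping.single i 1) j) =
      (\<Prod>j\<in>UNIV. if j = i then g j else 1)"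
    by (intro prod.cong refl) (auto simp: lookup_single when_def)
  then show ?thesis by (simp add: X_poly_def monomial_def subst_single const_K_hom)
qed

context
  fixes g :: "'i::{finite, linorder} \<Rightarrow> 'i function_field"
  assumes inj: "\<And>a. subst g a = 0 \<Longrightarrow> a = 0"
begin

lemma subst_K_Fract:
  assumes "b \<noteq> 0" shows "subst_K g (Fract a b) = subst g a / subst g b"
  unfolding subst_K_def
proof (rule the_equality)
  have *: "subst g a / subst g b = subst g a' / subst g b'"
    if "b' \<noteq> 0" "Fract a b = Fract a' b'" for a' b'
  proof -
    have "a * b' = a' * b" using that assms by (simp add: eq_fract)
    then have "subst g a * subst g b' = subst g a' * subst g b" by (simp flip: subst_mult)
    moreover have "subst g b \<noteq> 0" "subst g b' \<noteq> 0" using inj that(1) assms by blast+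
    ultimately show ?thesis by (simp add: frac_eq_eq)
  qed
  then show "\<forall>a' b'. b' \<noteq> 0 \<and> Fract a b = Fract a' b' \<longrightarrow>
      subst g a / subst g b = subst g a' / subst g b'"
    by blast
qed (use assms in blast)

lemma subst_K_to_K: "subst_K g (to_K a) = subst g a"
  unfolding to_K_def by (simp add: subst_K_Fract ring_morphismD[OF ring_morphism_subst])

lemma ring_morphism_subst_K: "ring_morphism (subst_K g)"
  unfolding ring_morphism_def
proof (intro conjI allI)
  show "subst_K g 1 = 1"
    using subst_K_to_K[of 1] by (simp add: to_K_hom ring_morphismD[OF ring_morphism_subst])
  fix x y :: "'i function_field"
  obtain a b where x: "x = Fract a b" "b \<noteq> 0" by (cases x)
  obtain a' b' where y: "y = Fract a' b'" "b' \<noteq> 0" by (cases y)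
  have "subst g b \<noteq> 0" "subst g b' \<noteq> 0" using inj x y by auto
  then show "subst_K g (x + y) = subst_K g x + subst_K g y"
    "subst_K g (x * y) = subst_K g x * subst_K g y"
    using x y by (simp_all add: subst_K_Fract subst_add subst_mult add_frac_eq mult.commute)
qed

end

text \<open>If every value \<open>g i\<close> is a fraction \<open>b/s\<close> that the substitution of \<open>g'\<close> can be applied to, with
  result \<open>X\<^sub>i\<close>, then the same holds for all values of \<open>subst g\<close>. So \<open>subst g'\<close> undoes \<open>subst g\<close>,
  although neither is yet known to be injective and hence to extend to the function field.\<close>

lemma subst_left_inverse:
  assumes "\<And>i. \<exists>b s. subst g' s \<noteq> 0 \<and> g i * to_K s = to_K b \<and> subst g' b = X_K i * subst g' s"
  shows "\<exists>b s. subst g' s \<noteq> 0 \<and> subst g a * to_K s = to_K b \<and> subst g' b = to_K a * subst g' s"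
proof (induction a rule: patch_induct)
  case (coeff r)
  show ?case
    by (rule exI[of _ "coeff_emb r"], rule exI[of _ 1])
      (simp add: subst_coeff to_K_hom ring_morphismD[OF ring_morphism_subst])
next
  case (var i)
  then show ?case using assms[of i] by (simp add: subst_X X_K_eq)
next
  case (add a a')
  then obtain b s b' s' where *: "subst g' s \<noteq> 0" "subst g a * to_K s = to_K b"
    "subst g' b = to_K a * subst g' s" "subst g' s' \<noteq> 0" "subst g a' * to_K s' = to_K b'"
    "subst g' b' = to_K a' * subst g' s'" by blast
  have "subst g (a + a') * to_K (s * s') = (subst g a * to_K s) * to_K s' + (subst g a' * to_K s') * to_K s"
    by (simp add: subst_add to_K_hom algebra_simps)
  then show ?case using *
    by (intro exI[of _ "b * s' + b' * s"] exI[of _ "s * s'"])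
      (simp add: subst_mult subst_add to_K_hom algebra_simps)
next
  case (mult a a')
  then obtain b s b' s' where *: "subst g' s \<noteq> 0" "subst g a * to_K s = to_K b"
    "subst g' b = to_K a * subst g' s" "subst g' s' \<noteq> 0" "subst g a' * to_K s' = to_K b'"
    "subst g' b' = to_K a' * subst g' s'" by blast
  have "subst g (a * a') * to_K (s * s') = (subst g a * to_K s) * (subst g a' * to_K s')"
    by (simp add: subst_mult to_K_hom algebra_simps)
  then show ?case using *
    by (intro exI[of _ "b * b'"] exI[of _ "s * s'"]) (simp add: subst_mult to_K_hom algebra_simps)
qed

lemma subst_inj_of_left_inverse:
  assumes "\<And>i. \<exists>b s. subst g' s \<noteq> 0 \<and> g i * to_K s = to_K b \<and> subst g' b = X_K i * subst g' s"
    and "subst g a = 0"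
  shows "a = 0"
proof -
  obtain b s where bs: "subst g' s \<noteq> 0" "subst g a * to_K s = to_K b"
    "subst g' b = to_K a * subst g' s" using subst_left_inverse[OF assms(1)] by blast
  then have "b = 0" using assms(2) by (metis mult_zero_left to_K_eq_0_iff)
  then show ?thesis using bs by (simp add: subst_0 to_K_eq_0_iff)
qed

lemma subst_K_left_inverse:
  assumes "\<And>i. \<exists>b s. subst g' s \<noteq> 0 \<and> g i * to_K s = to_K b \<and> subst g' b = X_K i * subst g' s"
    and inj': "\<And>a. subst g' a = 0 \<Longrightarrow> a = 0"
  shows "subst_K g' (subst_K g x) = x"
proof -
  note inj = subst_inj_of_left_inverse[OF assms(1)]
  have *: "subst_K g' (subst g a) = to_K a" for a
  proof -
    obtain b s where bs: "subst g' s \<noteq> 0" "subst g a * to_K s = to_K b"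
      "subst g' b = to_K a * subst g' s" using subst_left_inverse[OF assms(1)] by blast
    then have "subst_K g' (subst g a * to_K s) = to_K a * subst g' s"
      by (simp add: subst_K_to_K[OF inj'])
    then show ?thesis using bs(1)
      by (simp add: ring_morphismD[OF ring_morphism_subst_K[OF inj']] subst_K_to_K[OF inj'])
  qed
  obtain a b where x: "x = Fract a b" "b \<noteq> 0" by (cases x)
  then have "subst_K g x = subst g a / subst g b" by (simp add: subst_K_Fract[OF inj])
  then have "subst_K g' (subst_K g x) = to_K a / to_K b"
    by (simp add: ring_morphism_field[OF ring_morphism_subst_K[OF inj']] *)
  then show ?thesis using x by (simp add: Fract_eq_to_K)
qed


subsection \<open>The logarithmic derivations\<close>

text \<open>The derivation \<open>X\<^sub>i \<partial>/\<partial>X\<^sub>i\<close>, of which the monomials are eigenvectors.\<close>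

definition euler :: "'i \<Rightarrow> 'i patch_ring \<Rightarrow> 'i::{finite, linorder} patch_ring" where
  "euler i a = Poly_Mapping.mapp (\<lambda>m c. of_nat (Poly_Mapping.lookup m i) * c) a"

lemma lookup_euler: 
  "Poly_Mapping.lookup (euler i a) m = of_nat (Poly_Mapping.lookup m i) * Poly_Mapping.lookup a m"
  by (simp add: euler_def lookup_mapp when_def in_keys_iff)

lemma euler_add: "euler i (a + b) = euler i a + euler i b"
  by (rule poly_mapping_eqI) (simp add: lookup_euler lookup_add algebra_simps)

lemma euler_single:
  "euler i (Poly_Mapping.single m c) = of_nat (Poly_Mapping.lookup m i) * Poly_Mapping.single m c"
proof -
  have of_nat: "of_nat n = (Poly_Mapping.single 0 (of_nat n) :: 'i patch_ring)" for n
    by simp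
  show ?thesis
    unfolding of_nat mult_single
    by (rule poly_mapping_eqI) (auto simp: lookup_euler lookup_single when_def)
qed

lemma euler_0: "euler i 0 = 0"
  by (rule poly_mapping_eqI) (simp add: lookup_euler)

lemma derivation_euler: "derivation (euler i)"
  unfolding derivation_along_def
proof (intro conjI allI)
  fix a b
  show "euler i (a * b) = a * euler i b + euler i a * b"
  proof (induction a rule: poly_mapping_add_induct)
    case (single m c)
    show ?case
    proof (induction b rule: poly_mapping_add_induct)
      case (single n d)
      have "euler i (Poly_Mapping.single m c * Poly_Mapping.single n d) =
          of_nat (Poly_Mapping.lookup m i + Poly_Mapping.lookup n i) *
          (Poly_Mapping.single m c * Poly_Mapping.single n d)"
        by (simp add: mult_single euler_single lookup_add)
      then show ?case by (simp add: euler_single algebra_simps)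
    qed (simp_all add: euler_0 euler_add algebra_simps)
  qed (simp_all add: euler_0 euler_add algebra_simps)
qed (rule euler_add)

lemma euler_commute: "euler i (euler j a) = euler j (euler i a)"
  by (rule poly_mapping_eqI) (simp add: lookup_euler)

definition euler_K :: "'i \<Rightarrow> 'i function_field \<Rightarrow> 'i::{finite, linorder} function_field" where
  "euler_K i = fract_derivation (euler i)"

lemma derivation_euler_K: "derivation (euler_K i)"
  unfolding euler_K_def by (intro derivation_fract_derivation derivation_euler)

lemma euler_K_to_K: "euler_K i (to_K a) = to_K (euler i a)"
  by (simp add: euler_K_def to_K_def fract_derivation_base derivation_euler)

lemma euler_K_commute: "euler_K i (euler_K j x) = euler_K j (euler_K i x)"
  unfolding euler_K_def by (intro fract_derivation_commute derivation_euler euler_commute)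

lemma euler_K_const: "euler_K i (const_K r) = 0"
  by (simp add: euler_K_to_K coeff_emb_def euler_single to_K_hom)

lemma euler_K_X: "euler_K i (X_K j) = (if i = j then 1 else 0) * X_K j"
  by (auto simp: X_K_eq X_poly_def euler_K_to_K monomial_def euler_single to_K_hom lookup_single when_def)

text \<open>In the following rules \<open>l\<close> is the logarithmic derivative of \<open>x\<close>. The form \<open>d x = l x\<close> avoids a
  division and covers \<open>x = 0\<close>.\<close>

lemma derivation_power:
  assumes d: "derivation d" and x: "d x = l * (x::'k::field)" shows "d (x ^ n) = of_nat n * l * x ^ n"
proof (induction n)
  case 0
  have "d 1 = d 1 + d 1" using derivation_along_mult[OF d, of 1 1] by (simp only: mult_1 mult_1_right)
  then show ?case by (metis add_left_cancel add.right_neutral mult_zero_left of_nat_0 power_0)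
next
  case (Suc n)
  then show ?case by (simp add: derivation_along_mult[OF d] x algebra_simps)
qed

lemma derivation_inverse:
  assumes d: "derivation d" and x: "d x = l * (x::'k::field)" 
  shows "d (inverse x) = - l * inverse x"
proof (cases "x = 0")
  case True
  then show ?thesis using derivation_along_0[OF d] by simp
next
  case False
  have "d (x * inverse x) = 0" using derivation_power[OF d x, of 0] False by simp
  then have "x * (d (inverse x) + l * inverse x) = 0"
    by (simp add: derivation_along_mult[OF d] x algebra_simps)
  then show ?thesis using False by (simp add: eq_neg_iff_add_eq_0)
qed

lemma derivation_power_int:
  assumes d: "derivation d" and x: "d x = l * (x::'k::field)" 
  shows "d (x powi n) = of_int n * l * x powi n"
proof (cases "0 \<le> n")
  case True
  then show ?thesis using derivation_power[OF d x, of "nat n"] by (simp add: power_int_def)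
next
  case False
  then show ?thesis using derivation_power[OF d derivation_inverse[OF d x], of "nat (- n)"]
    by (simp add: power_int_def)
qed

lemma derivation_mult_log:
  assumes "derivation d" "d x = l * x" "d y = m * y" shows "d (x * y) = (l + m) * (x * y)"
  by (simp add: derivation_along_mult[OF assms(1)] assms algebra_simps)

abbreviation bracket_K :: "('i \<Rightarrow> 'i \<Rightarrow> 'i function_field) \<Rightarrow> 'i function_field \<Rightarrow> 'i function_field
    \<Rightarrow> 'i::{finite, linorder} function_field" where
  "bracket_K \<equiv> deriv_bracket euler_K"

lemma bracket_K_eigen:
  assumes "\<And>a. euler_K a x = l a * x" "\<And>a. euler_K a y = m a * y"
  shows "bracket_K \<Lambda> x y = (\<Sum>a\<in>UNIV. \<Sum>b\<in>UNIV. \<Lambda> a b * l a * m b) * (x * y)"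
  by (simp add: deriv_bracket_def assms sum_distrib_right mult.assoc mult.left_commute mult.commute
      sum_distrib_left)

lemma bracket_K_X: "bracket_K \<Lambda> (X_K i) (X_K j) = \<Lambda> i j * (X_K i * X_K j)"
proof -
  have "\<Lambda> a b * (if a = i then 1 else 0) * (if b = j then 1 else 0) =
      (if b = j then if a = i then \<Lambda> i j else 0 else 0)" for a b by simp
  then show ?thesis by (subst bracket_K_eigen[OF euler_K_X euler_K_X]) simp
qed

lemma bracket_K_const: "bracket_K \<Lambda> (const_K r) x = 0" "bracket_K \<Lambda> x (const_K r) = 0"
  by (simp_all add: deriv_bracket_def euler_K_const)

lemma poisson_bracket_K:
  assumes "\<And>i j. \<Lambda> i j = - \<Lambda> j i" "\<And>i j. \<exists>r. \<Lambda> i j = const_K r"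
  shows "poisson_bracket const_K (bracket_K \<Lambda>)"
proof (rule poisson_deriv_bracket)
  show "euler_K k (\<Lambda> i j) = 0" for i j k using assms(2)[of i j] euler_K_const by metis
  show "euler_K i (euler_K j x) = euler_K j (euler_K i x)" for i j x by (rule euler_K_commute)
qed (rule assms(1) derivation_euler_K euler_K_const two_function_field_nonzero)+

lemma derivation_along_K_eq:
  fixes d d' :: "'i::{finite, linorder} function_field \<Rightarrow> 'i function_field"
  assumes \<phi>: "ring_morphism \<phi>" and d: "derivation_along \<phi> d" "derivation_along \<phi> d'"
    and "\<And>r. d (const_K r) = d' (const_K r)" "\<And>i. d (X_K i) = d' (X_K i)"
  shows "d x = d' x"
proof (rule derivation_along_fract_eq[OF d])
  have "d (to_K a) = d' (to_K a)" for a
    by (induction a rule: patch_induct)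
      (simp_all add: assms to_K_hom derivation_along_add[OF d(1)] derivation_along_add[OF d(2)]
        derivation_along_mult[OF d(1)] derivation_along_mult[OF d(2)] flip: X_K_eq)
  then show "d (Fract a 1) = d' (Fract a 1)" for a by (simp add: to_K_def)
  show "\<phi> (Fract a 1) \<noteq> 0" if "a \<noteq> 0" for a
    using that ring_morphism_field(1)[OF \<phi>] to_K_eq_0_iff[of a] by (simp add: to_K_def)
qed

text \<open>Both sides are derivations in each argument along \<open>\<phi>\<close>, so it suffices to compare them on the
  variables.\<close>

lemma poisson_morphism_of_vars:
  assumes \<phi>: "ring_morphism \<phi>" and const: "\<And>r. \<phi> (const_K r) = const_K r"
    and vars: "\<And>i j. bracket_K \<Lambda> (\<phi> (X_K i)) (\<phi> (X_K j)) = \<phi> (bracket_K \<Lambda>' (X_K i) (X_K j))"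
  shows "bracket_K \<Lambda> (\<phi> f) (\<phi> g) = \<phi> (bracket_K \<Lambda>' f g)"
proof -
  note l = derivation_bracket_left[of euler_K, OF derivation_euler_K]
    and r = derivation_bracket_right[of euler_K, OF derivation_euler_K]
  note D = derivation_along_add[OF l] derivation_along_mult[OF l]
    derivation_along_add[OF r] derivation_along_mult[OF r] ring_morphismD[OF \<phi>]
  have *: "bracket_K \<Lambda> (\<phi> (X_K i)) (\<phi> g) = \<phi> (bracket_K \<Lambda>' (X_K i) g)" for i g
  proof (rule derivation_along_K_eq[OF \<phi>, where x = g
        and d = "\<lambda>g. bracket_K \<Lambda> (\<phi> (X_K i)) (\<phi> g)"
        and d' = "\<lambda>g. \<phi> (bracket_K \<Lambda>' (X_K i) g)"])
    show "derivation_along \<phi> (\<lambda>g. bracket_K \<Lambda> (\<phi> (X_K i)) (\<phi> g))"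
      "derivation_along \<phi> (\<lambda>g. \<phi> (bracket_K \<Lambda>' (X_K i) g))"
      by (simp_all add: derivation_along_def D)
  qed (simp_all add: const bracket_K_const vars D)
  show ?thesis
  proof (rule derivation_along_K_eq[OF \<phi>, where x = f and d = "\<lambda>f. bracket_K \<Lambda> (\<phi> f) (\<phi> g)"
        and d' = "\<lambda>f. \<phi> (bracket_K \<Lambda>' f g)"])
    show "derivation_along \<phi> (\<lambda>f. bracket_K \<Lambda> (\<phi> f) (\<phi> g))"
      "derivation_along \<phi> (\<lambda>f. \<phi> (bracket_K \<Lambda>' f g))"
      by (simp_all add: derivation_along_def D)
  qed (simp_all add: const bracket_K_const * D)
qed


section \<open>Mutations as Poisson automorphisms of the function field\<close>

lemma ring_morphism_to_K: "ring_morphism to_K"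
  by (simp add: ring_morphism_def to_K_hom)

text \<open>A family of substitutions that contains the mutations and is closed under inverses for a reason that
  involves neither seeds nor \<open>c\<close>-vectors.\<close>

definition mut_var :: "'i \<Rightarrow> 'i coeff_ring \<Rightarrow> 'i coeff_ring \<Rightarrow> ('i \<Rightarrow> int) \<Rightarrow> ('i \<Rightarrow> int)
    \<Rightarrow> 'i \<Rightarrow> 'i::{finite, linorder} function_field" where
  "mut_var k \<alpha> \<beta> p q i =
     (if i = k then inverse (X_K k)
      else X_K i * X_K k powi p i * (const_K \<alpha> + const_K \<beta> * X_K k) powi q i)"

lemma binomial_eq: "const_K \<alpha> + const_K \<beta> * X_K k = to_K (coeff_emb \<alpha> + coeff_emb \<beta> * X_poly k)"
  by (simp add: to_K_hom X_K_eq)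

lemma binomial_nonzero:
  assumes "\<alpha> \<noteq> 0" shows "const_K \<alpha> + const_K \<beta> * X_K k \<noteq> 0"
proof -
  have "Poly_Mapping.single k (1::nat) \<noteq> 0" by (metis lookup_single_eq lookup_zero zero_neq_one)
  then have "Poly_Mapping.lookup (coeff_emb \<alpha> + coeff_emb \<beta> * X_poly k) 0 = \<alpha>"
    unfolding X_poly_def single_eq_coeff_mult[symmetric]
    by (simp add: coeff_emb_def lookup_add lookup_single when_def)
  then show ?thesis using assms unfolding binomial_eq to_K_eq_0_iff by (metis lookup_zero)
qed

lemma power_nat_split:
  assumes "(x::'k::field) \<noteq> 0" shows "x ^ nat n = x powi n * x ^ nat (- n)"
  using assms by (cases "0 \<le> n") (auto simp: power_int_def power_inverse)

text \<open>In the coordinates \<open>X\<^sub>k' = 1/X\<^sub>k\<close> the binomial \<open>\<alpha> + \<beta> X\<^sub>k\<close> is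
  \<open>(\<beta> + \<alpha> X\<^sub>k') / X\<^sub>k'\<close>; hence the inverse map has the same shape, with \<open>\<alpha>\<close> and \<open>\<beta>\<close> exchanged.\<close>

lemma mut_var_left_inverse:
  fixes k :: "'i::{finite, linorder}" and p q :: "'i \<Rightarrow> int"
  assumes "\<alpha> \<noteq> 0" "\<beta> \<noteq> 0"
  defines "g \<equiv> mut_var k \<alpha> \<beta> p q" and "g' \<equiv> mut_var k \<beta> \<alpha> (\<lambda>i. p i + q i) (\<lambda>i. - q i)"
  shows "\<exists>b s. subst g' s \<noteq> 0 \<and> g i * to_K s = to_K b \<and> subst g' b = X_K i * subst g' s"
proof (cases "i = k")
  case True
  show ?thesis
    by (rule exI[of _ 1], rule exI[of _ "X_poly k"])
      (simp add: True subst_X g_def g'_def mut_var_def X_K_nonzero to_K_hom flip: X_K_eq,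
       simp add: ring_morphismD[OF ring_morphism_subst] X_K_nonzero)
next
  case False
  note S = ring_morphismD[OF ring_morphism_subst] and T = ring_morphismD[OF ring_morphism_to_K]
  define B where "B = coeff_emb \<alpha> + coeff_emb \<beta> * X_poly k"
  define u where "u = X_K k"
  define v where "v = inverse u"
  define P where "P = const_K \<alpha> + const_K \<beta> * u"
  define Q where "Q = const_K \<beta> + const_K \<alpha> * u"
  define n1 n2 where "n1 = nat (- p i)" and "n2 = nat (- q i)"
  have u: "u \<noteq> 0" and v: "v \<noteq> 0" and P: "P \<noteq> 0" and Q: "Q \<noteq> 0"
    using assms by (auto simp: u_def v_def P_def Q_def X_K_nonzero binomial_nonzero)
  define s where "s = X_poly k ^ n1 * B ^ n2"
  define b where "b = X_poly i * X_poly k ^ nat (p i) * B ^ nat (q i)"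
  have B: "to_K B = P" by (simp add: P_def u_def B_def binomial_eq)
  have SX: "subst g' (X_poly k) = v" by (simp add: subst_X g'_def mut_var_def v_def u_def)
  have SB: "subst g' B = Q * v"
    using u by (simp add: B_def S subst_coeff SX Q_def v_def algebra_simps)
  have Si: "subst g' (X_poly i) = X_K i * u powi (p i + q i) * Q powi (- q i)"
    using False by (simp add: subst_X g'_def mut_var_def Q_def u_def)
  have gi: "g i = X_K i * u powi p i * P powi q i"
    using False by (simp add: g_def mut_var_def P_def u_def)
  have "g i * to_K s = X_K i * (u powi p i * u ^ n1) * (P powi q i * P ^ n2)"
    by (simp add: s_def T B gi u_def mult_ac flip: X_K_eq)
  also have "\<dots> = to_K b"
    unfolding n1_def n2_def power_nat_split[OF u, symmetric] power_nat_split[OF P, symmetric]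
    by (simp add: b_def T B u_def flip: X_K_eq)
  finally have 1: "g i * to_K s = to_K b" .
  have uv: "u powi n * v powi n = 1" for n
    using u by (simp add: v_def flip: power_int_mult_distrib)
  have QQ: "Q powi (- q i) * Q powi q i = 1" using Q by (simp add: power_int_minus)
  have "subst g' b = X_K i * (u powi (p i + q i) * Q powi (- q i)) *
      (v powi p i * v ^ n1) * ((Q * v) powi q i * (Q * v) ^ n2)"
    unfolding b_def S SX SB Si n1_def n2_def using v Q
    by (simp add: power_nat_split[of v "p i"] power_nat_split[of "Q * v" "q i"] mult_ac)
  also have "\<dots> = X_K i * ((u powi p i * v powi p i) * (u powi q i * v powi q i) *
      (Q powi (- q i) * Q powi q i)) * (v ^ n1 * (Q * v) ^ n2)"
    using u by (simp add: power_int_add power_int_mult_distrib mult_ac)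
  also have "\<dots> = X_K i * subst g' s"
    by (simp only: uv QQ s_def S SX SB mult_1_right)
  finally have 2: "subst g' b = X_K i * subst g' s" .
  have "subst g' s \<noteq> 0" using v Q by (simp add: s_def S SX SB)
  then show ?thesis using 1 2 by blast
qed

lemma subst_mut_var_inj: "\<alpha> \<noteq> 0 \<Longrightarrow> \<beta> \<noteq> 0 \<Longrightarrow> subst (mut_var k \<alpha> \<beta> p q) a = 0 \<Longrightarrow> a = 0"
  using subst_inj_of_left_inverse[OF mut_var_left_inverse] by blast

lemma subst_K_mut_var:
  fixes k :: "'i::{finite, linorder}" and p q :: "'i \<Rightarrow> int"
  assumes "\<alpha> \<noteq> 0" "\<beta> \<noteq> 0"
  defines "\<phi> \<equiv> subst_K (mut_var k \<alpha> \<beta> p q)"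
  shows "ring_morphism \<phi>" "bij \<phi>" "\<phi> (const_K r) = const_K r" "\<phi> (X_K i) = mut_var k \<alpha> \<beta> p q i"
proof -
  note inj = subst_mut_var_inj[OF assms(1,2), of k p q]
  show "ring_morphism \<phi>" unfolding \<phi>_def by (rule ring_morphism_subst_K) (rule inj)
  show "\<phi> (const_K r) = const_K r" "\<phi> (X_K i) = mut_var k \<alpha> \<beta> p q i"
    by (simp_all add: \<phi>_def subst_K_to_K inj subst_coeff X_K_eq subst_X)
  let ?\<psi> = "subst_K (mut_var k \<beta> \<alpha> (\<lambda>i. p i + q i) (\<lambda>i. - q i))"
  have "?\<psi> (\<phi> x) = x" for x unfolding \<phi>_def
    by (rule subst_K_left_inverse[OF mut_var_left_inverse[OF assms(1,2)]])
      (rule subst_mut_var_inj[OF assms(2,1)])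
  moreover have "\<phi> (?\<psi> x) = x" for x
    using subst_K_left_inverse[OF mut_var_left_inverse[OF assms(2,1), of k "\<lambda>i. p i + q i" "\<lambda>i. - q i"],
        of x] inj
    by (simp add: \<phi>_def)
  ultimately show "bij \<phi>" by (intro o_bij[of ?\<psi>]) auto
qed

text \<open>Contraction of a matrix with a vector that has at most the two nonzero coordinates \<open>j\<close> and \<open>k\<close>.\<close>

lemma sum_two_deltas:
  fixes c :: "'i::finite \<Rightarrow> 'k::comm_ring_1"
  shows "(\<Sum>b\<in>UNIV. c b * (z * of_bool (b = j) + w * of_bool (b = k))) = z * c j + w * c k"
proof -
  have "(\<Sum>b\<in>UNIV. c b * (z * of_bool (b = j) + w * of_bool (b = k))) =
      (\<Sum>b\<in>UNIV. (if b = j then z * c b else 0) + (if b = k then w * c b else 0))"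
    by (intro sum.cong refl) (auto simp: algebra_simps)
  then show ?thesis by (simp add: sum.distrib)
qed

text \<open>Let \<open>P\<close> be the binomial. Its logarithmic derivatives vanish except for \<open>Q = X\<^sub>k P'/P\<close> in direction \<open>k\<close>.
  Hence the logarithmic derivatives of the new variable \<open>i\<close> form the vector that has \<open>s\<^sub>i\<close> in the place
  \<open>i\<close> plus \<open>r\<^sub>i\<close> in the place \<open>k\<close>, and the bracket of two new variables is, up to their product, the
  value of \<open>\<Lambda>\<close> on two such vectors, where the term with \<open>\<Lambda>\<^sub>k\<^sub>k\<close> drops out.\<close>

lemma bracket_mut_var:
  fixes \<Lambda> :: "'i \<Rightarrow> 'i \<Rightarrow> 'i::{finite, linorder} function_field"
    and k :: 'i and \<alpha> \<beta> :: "'i coeff_ring" and p q :: "'i \<Rightarrow> int"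
  assumes \<alpha>: "\<alpha> \<noteq> 0" and kk: "\<Lambda> k k = 0"
  defines "Q \<equiv> const_K \<beta> * X_K k / (const_K \<alpha> + const_K \<beta> * X_K k)"
  defines "s \<equiv> \<lambda>i. if i = k then - 1 else 1" and "r \<equiv> \<lambda>i. if i = k then 0 else of_int (p i) + of_int (q i) * Q"
  shows "bracket_K \<Lambda> (mut_var k \<alpha> \<beta> p q i) (mut_var k \<alpha> \<beta> p q j) =
    (s i * s j * \<Lambda> i j + s i * r j * \<Lambda> i k + r i * s j * \<Lambda> k j) *
    (mut_var k \<alpha> \<beta> p q i * mut_var k \<alpha> \<beta> p q j)"
proof -
  have X: "euler_K a (X_K i) = of_bool (a = i) * X_K i" for a i by (simp add: euler_K_X)
  note D = derivation_euler_K
  have log: "euler_K a (mut_var k \<alpha> \<beta> p q i) =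
      (s i * of_bool (a = i) + r i * of_bool (a = k)) * mut_var k \<alpha> \<beta> p q i" for a i
  proof (cases "i = k")
    case True
    then show ?thesis using derivation_inverse[OF D X, of a k] by (simp add: mut_var_def s_def r_def)
  next
    case False
    let ?P = "const_K \<alpha> + const_K \<beta> * X_K k"
    have "euler_K a ?P = of_bool (a = k) * Q * ?P"
      using binomial_nonzero[OF \<alpha>]
      by (simp add: derivation_along_add[OF D] derivation_along_mult[OF D] euler_K_const X Q_def)
    then have "euler_K a (X_K i * X_K k powi p i * ?P powi q i) =
        (of_bool (a = i) + of_int (p i) * of_bool (a = k) + of_int (q i) * (of_bool (a = k) * Q)) *
        (X_K i * X_K k powi p i * ?P powi q i)"
      by (intro derivation_mult_log[OF D] derivation_power_int[OF D] X)
    then show ?thesis using False by (simp add: mut_var_def s_def r_def algebra_simps)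
  qed
  have "(\<Sum>a\<in>UNIV. \<Sum>b\<in>UNIV. \<Lambda> a b * (s i * of_bool (a = i) + r i * of_bool (a = k)) *
      (s j * of_bool (b = j) + r j * of_bool (b = k))) =
      s i * s j * \<Lambda> i j + s i * r j * \<Lambda> i k + r i * s j * \<Lambda> k j + r i * r j * \<Lambda> k k"
  proof -
    have "(\<Sum>a\<in>UNIV. \<Sum>b\<in>UNIV. \<Lambda> a b * (s i * of_bool (a = i) + r i * of_bool (a = k)) *
        (s j * of_bool (b = j) + r j * of_bool (b = k))) =
        (\<Sum>a\<in>UNIV. (s j * \<Lambda> a j + r j * \<Lambda> a k) * (s i * of_bool (a = i) + r i * of_bool (a = k)))"
      by (rule sum.cong[OF refl], subst sum_two_deltas) (simp add: algebra_simps)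
    also have "\<dots> = s i * (s j * \<Lambda> i j + r j * \<Lambda> i k) + r i * (s j * \<Lambda> k j + r j * \<Lambda> k k)"
      by (rule sum_two_deltas)
    finally show ?thesis by (simp add: algebra_simps)
  qed
  then show ?thesis by (subst bracket_K_eigen[OF log log]) (simp add: kk)
qed


subsection \<open>Seeds and their exchange matrices\<close>

lemma rat_const_hom:
  "rat_const (a + b) = rat_const a + rat_const b" "rat_const (a * b) = rat_const a * rat_const b"
  "rat_const 1 = 1" "rat_const 0 = 0" "rat_const (- a) = - rat_const a"
  by (simp_all add: rat_const_def of_rat_add of_rat_mult of_rat_minus single_add mult_single single_uminus)

abbreviation rat_K :: "rat \<Rightarrow> 'i::{finite, linorder} function_field" where
  "rat_K q \<equiv> const_K (rat_const q)"

lemma ring_morphism_rat_K: "ring_morphism rat_K"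
  by (simp add: ring_morphism_def rat_const_hom const_K_hom coeff_emb_hom to_K_hom)

lemma rat_K_of_int: "rat_K (of_int n) = of_int n"
proof -
  have nat: "rat_K (of_nat n) = of_nat n" for n
    by (induction n) (simp_all add: rat_const_hom coeff_emb_hom to_K_hom)
  show ?thesis
  proof (cases n rule: int_cases2)
    case (nonpos m)
    have "rat_K (- of_nat m) = - of_nat m"
      by (simp only: ring_morphismD(5)[OF ring_morphism_rat_K] nat)
    then show ?thesis using nonpos by simp
  qed (simp add: nat)
qed

definition seed_matrix :: "('i, 'n) fixed_data \<Rightarrow> ('i \<Rightarrow> 'n) \<Rightarrow> 'i \<Rightarrow> 'i
    \<Rightarrow> 'i::{finite, linorder} function_field" where
  "seed_matrix D e i j = rat_K (2 * form D (e i) (e j))"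

text \<open>The part of the definition of a seed that keeps the exchange matrix integral; unlike the bases,
  it is visibly stable under mutation.\<close>

definition integral_seed :: "('i::finite, 'n::ab_group_add) fixed_data \<Rightarrow> ('i \<Rightarrow> 'n) \<Rightarrow> bool" where
  "integral_seed D e \<longleftrightarrow>
     (\<forall>i \<in> unfrozen D. e i \<in> N_uf D) \<and> (\<forall>i. zmul (int (mults D i)) (e i) \<in> N_circ D)"

lemma zbasis_mem: "zbasis J b S \<Longrightarrow> i \<in> J \<Longrightarrow> b i \<in> S"
  unfolding zbasis_def by (metis imageI zmod.span_base)

lemma integral_seed_of_seed: "is_seed D e \<Longrightarrow> integral_seed D e"
  unfolding is_seed_def integral_seed_def
  using zbasis_mem[of "unfrozen D" e "N_uf D"]
    zbasis_mem[of UNIV "\<lambda>i. zmul (int (mults D i)) (e i)" "N_circ D"] by simp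

context
  fixes D :: "('i::{finite, linorder}, 'n::ab_group_add) fixed_data"
  assumes D: "valid_fixed_data D"
begin

lemma form_add: "form D (u + v) w = form D u w + form D v w" "form D u (v + w) = form D u v + form D u w"
  and form_skew: "form D u v = - form D v u"
proof -
  have "(\<forall>u v w. form D (u + v) w = form D u w + form D v w) \<and>
     (\<forall>u v w. form D u (v + w) = form D u v + form D u w) \<and> (\<forall>u v. form D u v = - form D v u)"
    using D unfolding valid_fixed_data_def by (elim conjE) (intro conjI; assumption)
  then show "form D (u + v) w = form D u w + form D v w" "form D u (v + w) = form D u v + form D u w"
    "form D u v = - form D v u" by blast+
qed

lemma form_self: "form D u u = 0"
  using form_skew[of u u] by simp

lemma form_0: "form D 0 v = 0" "form D v 0 = 0"
  using form_add(1)[of 0 0] form_add(2)[of _ 0 0] by auto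

lemma form_minus: "form D (- u) v = - form D u v" "form D u (- v) = - form D u v"
proof -
  show *: "form D (- u) v = - form D u v" for u v
    using form_add(1)[of u "- u" v] by (simp add: form_0)
  show "form D u (- v) = - form D u v" using *[of v u] form_skew by metis
qed

lemma form_zmul_left: "form D (zmul m u) v = of_int m * form D u v"
proof -
  have nat: "form D (zmul (int n) u) v = of_nat n * form D u v" for n
  proof (induction n)
    case 0
    then show ?case by (simp add: zmul_def form_0)
  next
    case (Suc n)
    then show ?case by (simp add: zmul_add_left zmul_one form_add algebra_simps)
  qed
  show ?thesis
  proof (cases "0 \<le> m")
    case True
    then show ?thesis using nat[of "nat m"] by simp
  next
    case False
    then have "m = - int (nat (- m))" by simp
    then show ?thesis using nat[of "nat (- m)"]
      by (metis form_minus(1) mult_minus_left of_int_minus of_int_of_nat_eq zmul_minus_left)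
  qed
qed

lemma form_zmul_right: "form D u (zmul m v) = of_int m * form D u v"
  using form_zmul_left[of m v u] form_skew[of u] by simp

lemma form_sum: "form D (\<Sum>i\<in>I. f i) v = (\<Sum>i\<in>I. form D (f i) v)"
    "form D v (\<Sum>i\<in>I. f i) = (\<Sum>i\<in>I. form D v (f i))"
  by (induction I rule: infinite_finite_induct; simp add: form_0 form_add)+

lemma subspace_N_uf: "zmod.subspace (N_uf D)" and subspace_N_circ: "zmod.subspace (N_circ D)"
  using D unfolding valid_fixed_data_def lattice_of_rank_def zbasis_def
  by (metis zmod.subspace_span) (use D in \<open>simp add: valid_fixed_data_def\<close>)

context
  fixes e :: "'i \<Rightarrow> 'n" and k :: 'i
  assumes e: "integral_seed D e" and k: "k \<in> unfrozen D"
begin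

text \<open>The vector \<open>d\<^sub>k e\<^sub>k\<close> lies in both sublattices, and the form of any vector with such a vector is an
  integer; so the floor in \<open>eps\<close> is exact.\<close>

lemma eps_eq: "of_int (eps D e i k) = form D (e i) (e k) * of_nat (mults D k)"
proof -
  have "zmul (int (mults D k)) (e k) \<in> N_uf D \<inter> N_circ D"
    using e k zmod.subspace_scale[OF subspace_N_uf] by (auto simp: integral_seed_def)
  then have "form D (e i) (zmul (int (mults D k)) (e k)) \<in> \<int>"
    using D unfolding valid_fixed_data_def by blast
  then show ?thesis
    by (auto simp add: eps_def form_zmul_right mult.commute Ints_def)
qed

lemma integral_seed_mutate: "integral_seed D (mutate_seed D k e)"
proof -
  have uf: "mutate_seed D k e i \<in> N_uf D" if "i \<in> unfrozen D" for i
    using that k e zmod.subspace_scale[OF subspace_N_uf] zmod.subspace_add[OF subspace_N_uf]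
      zmod.subspace_neg[OF subspace_N_uf]
    by (auto simp: mutate_seed_def integral_seed_def)
  have circ: "zmul (int (mults D i)) (mutate_seed D k e i) \<in> N_circ D" for i
  proof (cases "i = k")
    case True
    have "zmul (int (mults D k)) (- e k) = - zmul (int (mults D k)) (e k)"
      by (metis add.right_inverse eq_neg_iff_add_eq_0 neg_eq_iff_add_eq_0 zmul_add_right zmod.scale_zero_right)
    then show ?thesis using True e zmod.subspace_neg[OF subspace_N_circ]
      by (simp add: mutate_seed_def integral_seed_def)
  next
    case False
    \<comment> \<open>\<open>d\<^sub>i \<epsilon>\<^sub>i\<^sub>k\<close> is a multiple of \<open>d\<^sub>k\<close>, since \<open>{e\<^sub>k, d\<^sub>i e\<^sub>i}\<close> is an integer; so \<open>d\<^sub>i [\<epsilon>\<^sub>i\<^sub>k]\<^sub>+ e\<^sub>k\<close> is a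
      multiple of \<open>d\<^sub>k e\<^sub>k\<close>\<close>
    have "form D (e k) (zmul (int (mults D i)) (e i)) \<in> \<int>"
      using D e k unfolding valid_fixed_data_def integral_seed_def by blast
    then obtain z where z: "of_nat (mults D i) * form D (e k) (e i) = of_int z"
      by (auto simp: form_zmul_right Ints_def)
    have "of_int (int (mults D i) * eps D e i k) = (of_int (- z * int (mults D k)) :: rat)"
      using z form_skew[of "e i" "e k"] by (simp add: eps_eq mult.assoc[symmetric])
    then have "int (mults D i) * eps D e i k = - z * int (mults D k)" by (simp only: of_int_eq_iff)
    then have "int (mults D i) * max 0 (eps D e i k) = max 0 (- z) * int (mults D k)"
      by (simp add: max_mult_distrib_left max_mult_distrib_right)
    then have "zmul (int (mults D i)) (zmul (max 0 (eps D e i k)) (e k)) =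
        zmul (max 0 (- z)) (zmul (int (mults D k)) (e k))"
      by (simp add: zmul_zmul)
    also have "\<dots> \<in> N_circ D"
      by (rule zmod.subspace_scale[OF subspace_N_circ]) (use e in \<open>simp add: integral_seed_def\<close>)
    finally show ?thesis using False e zmod.subspace_add[OF subspace_N_circ]
      by (simp add: mutate_seed_def zmul_add_right integral_seed_def)
  qed
  show ?thesis using uf circ by (simp add: integral_seed_def)
qed

end

lemma seed_matrix_skew: "seed_matrix D e i j = - seed_matrix D e j i"
proof -
  have "2 * form D (e i) (e j) = - (2 * form D (e j) (e i))" using form_skew[of "e i"] by simp
  then show ?thesis unfolding seed_matrix_def by (simp only: ring_morphismD(5)[OF ring_morphism_rat_K])
qed

lemma poisson_seed_matrix: "poisson_bracket const_K (bracket_K (seed_matrix D e))"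
  by (rule poisson_bracket_K[OF seed_matrix_skew]) (auto simp: seed_matrix_def)

text \<open>This is the reason why mutations are Poisson. If \<open>i\<close> and \<open>j\<close> differ from \<open>k\<close>, the terms without \<open>Q\<close> add
  up to the form on the mutated basis, and the coefficient \<open>\<epsilon>\<^sub>i\<^sub>k \<Lambda>\<^sub>j\<^sub>k - \<epsilon>\<^sub>j\<^sub>k \<Lambda>\<^sub>i\<^sub>k\<close> of \<open>Q\<close> vanishes: the columns
  \<open>k\<close> of \<open>\<epsilon>\<close> and of \<open>\<Lambda>\<close> are proportional, with the factor \<open>d\<^sub>k / 2\<close>.\<close>

lemma seed_matrix_mutate:
  fixes e :: "'i \<Rightarrow> 'n" and k :: 'i and Q :: "'i function_field"
  assumes e: "integral_seed D e" and k: "k \<in> unfrozen D"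
  defines "s \<equiv> \<lambda>i. if i = k then - 1 else 1"
    and "r \<equiv> \<lambda>i. if i = k then 0 else of_int (max 0 (eps D e i k)) + of_int (- eps D e i k) * Q"
    and "\<Lambda> \<equiv> seed_matrix D e"
  shows "s i * s j * \<Lambda> i j + s i * r j * \<Lambda> i k + r i * s j * \<Lambda> k j = seed_matrix D (mutate_seed D k e) i j"
proof -
  note R = ring_morphismD[OF ring_morphism_rat_K]
  define f where "f i j = form D (e i) (e j)" for i j
  define p where "p i = (of_int (max 0 (eps D e i k)) :: rat)" for i
  define q where "q i = (of_int (- eps D e i k) :: rat)" for i
  have q: "q i = - (f i k * of_nat (mults D k))" for i
    by (simp add: q_def f_def eps_eq[OF e k])
  have f: "f i j = - f j i" for i j unfolding f_def by (rule form_skew)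
  have r: "r i = (if i = k then 0 else rat_K (p i) + rat_K (q i) * Q)" for i
    by (simp only: r_def p_def q_def rat_K_of_int)
  have \<Lambda>: "\<Lambda> i j = rat_K (2 * f i j)" for i j by (simp add: \<Lambda>_def seed_matrix_def f_def)
  have kk: "f k k = 0" by (simp add: f_def form_self)
  have \<Lambda>kk: "\<Lambda> k k = 0" by (simp add: \<Lambda> kk R)
  have \<Lambda>sk: "\<Lambda> i j = - \<Lambda> j i" for i j unfolding \<Lambda>_def by (rule seed_matrix_skew)
  consider "i = k" "j = k" | "i = k" "j \<noteq> k" | "i \<noteq> k" "j = k" | "i \<noteq> k" "j \<noteq> k" by blast
  then show ?thesis
  proof cases
    case 1
    then show ?thesis by (simp add: s_def r_def \<Lambda>kk seed_matrix_def form_self R)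
  next
    case 2
    then have "form D (mutate_seed D k e i) (mutate_seed D k e j) = - f k j"
      by (simp add: mutate_seed_def form_add form_minus form_zmul_right form_self f_def)
    then have "seed_matrix D (mutate_seed D k e) i j = - \<Lambda> k j"
      by (simp add: seed_matrix_def \<Lambda> flip: R(5))
    then show ?thesis using 2 by (simp add: s_def r_def \<Lambda>kk)
  next
    case 3
    then have "form D (mutate_seed D k e i) (mutate_seed D k e j) = - f i k"
      by (simp add: mutate_seed_def form_add form_minus form_zmul_left form_self f_def)
    then have "seed_matrix D (mutate_seed D k e) i j = - \<Lambda> i k"
      by (simp add: seed_matrix_def \<Lambda> flip: R(5))
    then show ?thesis using 3 by (simp add: s_def r_def \<Lambda>kk)
  next
    case 4
    then have m: "form D (mutate_seed D k e i) (mutate_seed D k e j) = f i j + p j * f i k + p i * f k j"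
      by (simp add: mutate_seed_def form_add form_zmul_left form_zmul_right form_self f_def p_def)
    have "q j * f i k + q i * f k j = 0" using f[of k j] by (simp add: q algebra_simps)
    then have Q0: "rat_K (2 * (q j * f i k + q i * f k j)) = (0 :: 'i function_field)" by (simp add: R)
    have "\<Lambda> i j + r j * \<Lambda> i k + r i * \<Lambda> k j =
        rat_K (2 * (f i j + p j * f i k + p i * f k j)) + rat_K (2 * (q j * f i k + q i * f k j)) * Q"
      using 4 unfolding r \<Lambda> R(2,3) by (simp add: algebra_simps)
    then show ?thesis using 4 unfolding Q0 seed_matrix_def m by (simp add: s_def)
  qed
qed

end

text \<open>The exponent of \<open>t\<close> is never negative, so \<open>t_pow\<close> of it lies in the coefficient ring.\<close>

lemma t_pow_pos_part: obtains r where "t_pow (pos_part x) = const_K r" "r \<noteq> 0"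
proof -
  let ?t = "\<lambda>i. Poly_Mapping.single (Poly_Mapping.single i 1) 1 :: 'a coeff_ring"
  have pow: "const_K (r ^ n) = const_K r ^ n" for r :: "'a coeff_ring" and n
    by (induction n) (simp_all add: coeff_emb_hom to_K_hom)
  have prod: "(\<Prod>i\<in>J. const_K (f i)) = const_K (\<Prod>i\<in>J. f i)" for J and f :: "'a \<Rightarrow> 'a coeff_ring"
    by (induction J rule: infinite_finite_induct) (simp_all add: coeff_emb_hom to_K_hom)
  have nonneg: "0 \<le> pos_part x i" for i by (auto simp: pos_part_def)
  have "t_pow (pos_part x) = const_K (\<Prod>i\<in>UNIV. ?t i ^ nat (pos_part x i))"
    unfolding t_pow_def prod[symmetric] pow
    by (intro prod.cong refl) (simp add: t_K_def power_int_def nonneg)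
  moreover have "?t i \<noteq> 0" for i
    by (metis lookup_single_eq lookup_zero zero_neq_one)
  then have "(\<Prod>i\<in>UNIV. ?t i ^ nat (pos_part x i)) \<noteq> 0" by simp
  ultimately show ?thesis using that by blast
qed

text \<open>For \<open>\<epsilon>\<^sub>i\<^sub>k > 0\<close> the expression in the mutation formula is the binomial of the case \<open>\<epsilon>\<^sub>i\<^sub>k < 0\<close>
  divided by \<open>X\<^sub>k\<close>. Taking out this factor leaves powers of one binomial \<open>\<alpha> + \<beta> X\<^sub>k\<close> for all \<open>i\<close>, and
  the exponent \<open>[\<epsilon>\<^sub>i\<^sub>k]\<^sub>+\<close> of \<open>X\<^sub>k\<close> is the coefficient of \<open>e\<^sub>k\<close> in the mutated basis vector.\<close>

lemma mutation_var_eq_mut_var: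
  obtains \<alpha> \<beta> where "\<alpha> \<noteq> 0" "\<beta> \<noteq> 0"
    "mutation_var D e c k = mut_var k \<alpha> \<beta> (\<lambda>i. max 0 (eps D e i k)) (\<lambda>i. - eps D e i k)"
proof -
  obtain \<alpha> where \<alpha>: "t_pow (pos_part (\<lambda>j. - c k j)) = const_K \<alpha>" "\<alpha> \<noteq> 0" by (rule t_pow_pos_part)
  obtain \<beta> where \<beta>: "t_pow (pos_part (c k)) = const_K \<beta>" "\<beta> \<noteq> 0" by (rule t_pow_pos_part)
  have "mutation_var D e c k i = mut_var k \<alpha> \<beta> (\<lambda>i. max 0 (eps D e i k)) (\<lambda>i. - eps D e i k) i" for i
  proof (cases "i = k")
    case False
    define u where "u = X_K k"
    have u: "u \<noteq> 0" by (simp add: u_def X_K_nonzero)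
    consider "eps D e i k > 0" | "eps D e i k = 0" | "eps D e i k < 0" by linarith
    then show ?thesis
    proof cases
      case 1
      have "const_K \<beta> + const_K \<alpha> * inverse u = (const_K \<alpha> + const_K \<beta> * u) * inverse u"
        using u by (simp add: field_simps)
      then have "(const_K \<beta> + const_K \<alpha> * u powi - 1) powi - eps D e i k =
          u powi eps D e i k * (const_K \<alpha> + const_K \<beta> * u) powi - eps D e i k"
        using u by (simp add: power_int_mult_distrib power_int_minus power_int_inverse)
      then show ?thesis using 1 False
        by (simp add: mutation_var_def mut_var_def \<alpha> \<beta> flip: u_def)
    next
      case 2
      then show ?thesis using False by (simp add: mutation_var_def mut_var_def)
    next
      case 3
      then show ?thesis using False
        by (simp add: mutation_var_def mut_var_def \<alpha> \<beta>)
    qed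
  qed (simp add: mutation_var_def mut_var_def)
  then show ?thesis using \<alpha>(2) \<beta>(2) that by blast
qed

lemma mutation_comorphism_poisson:
  fixes D :: "('i::{finite, linorder}, 'n::ab_group_add) fixed_data" and e :: "'i \<Rightarrow> 'n"
    and c :: "'i \<Rightarrow> 'i \<Rightarrow> int" and k :: 'i
  assumes D: "valid_fixed_data D" and e: "integral_seed D e" and k: "k \<in> unfrozen D"
  defines "\<mu> \<equiv> mutation_comorphism D e c k"
  shows "ring_morphism \<mu>" "bij \<mu>" "\<mu> (const_K r) = const_K r"
    "bracket_K (seed_matrix D e) (\<mu> f) (\<mu> g) = \<mu> (bracket_K (seed_matrix D (mutate_seed D k e)) f g)"
proof -
  obtain \<alpha> \<beta> where ab: "\<alpha> \<noteq> 0" "\<beta> \<noteq> 0"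
    and g: "mutation_var D e c k = mut_var k \<alpha> \<beta> (\<lambda>i. max 0 (eps D e i k)) (\<lambda>i. - eps D e i k)"
    by (rule mutation_var_eq_mut_var)
  have \<mu>: "\<mu> = subst_K (mut_var k \<alpha> \<beta> (\<lambda>i. max 0 (eps D e i k)) (\<lambda>i. - eps D e i k))"
    by (simp add: \<mu>_def mutation_comorphism_def g)
  show hom: "ring_morphism \<mu>" and "bij \<mu>" and const: "\<mu> (const_K r) = const_K r" for r
    unfolding \<mu> using ab by (rule subst_K_mut_var)+
  have X: "\<mu> (X_K i) = mut_var k \<alpha> \<beta> (\<lambda>i. max 0 (eps D e i k)) (\<lambda>i. - eps D e i k) i" for i
    unfolding \<mu> by (rule subst_K_mut_var[OF ab])
  have kk: "seed_matrix D e k k = 0"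
    by (simp add: seed_matrix_def form_self[OF D] rat_const_hom coeff_emb_hom to_K_hom)
  show "bracket_K (seed_matrix D e) (\<mu> f) (\<mu> g) = \<mu> (bracket_K (seed_matrix D (mutate_seed D k e)) f g)"
  proof (rule poisson_morphism_of_vars[OF hom const])
    fix i j
    show "bracket_K (seed_matrix D e) (\<mu> (X_K i)) (\<mu> (X_K j)) =
        \<mu> (bracket_K (seed_matrix D (mutate_seed D k e)) (X_K i) (X_K j))"
      unfolding bracket_K_X ring_morphismD(3)[OF hom]
      unfolding X bracket_mut_var[OF ab(1), of "seed_matrix D e", OF kk] seed_matrix_mutate[OF D e k]
      by (simp add: seed_matrix_def const)
  qed
qed

lemma integral_seed_at:
  fixes D :: "('i::{finite, linorder}, 'n::ab_group_add) fixed_data"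
  assumes "valid_fixed_data D" "is_seed D e0" "w \<in> words D"
  shows "integral_seed D (seed_at D e0 w)"
  using assms(3) unfolding words_def
  by induction (auto simp: integral_seed_of_seed assms(2) integral_seed_mutate[OF assms(1)])

lemma comorphism_from_initial_poisson:
  fixes D :: "('i::{finite, linorder}, 'n::ab_group_add) fixed_data" and e0 :: "'i \<Rightarrow> 'n" and w :: "'i list"
  assumes D: "valid_fixed_data D" "is_seed D e0" and "w \<in> words D"
  defines "\<theta> \<equiv> comorphism_from_initial D e0 w"
  shows "ring_morphism \<theta> \<and> bij \<theta> \<and> (\<forall>r. \<theta> (const_K r) = const_K r) \<and>
    (\<forall>f g. bracket_K (seed_matrix D e0) (\<theta> f) (\<theta> g) = \<theta> (bracket_K (seed_matrix D (seed_at D e0 w)) f g))"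
  using assms(3) unfolding words_def \<theta>_def
proof induction
  case Nil
  show ?case by (simp add: ring_morphism_def bij_id[unfolded id_def])
next
  case (Cons k w)
  then have w: "w \<in> words D" by (simp add: words_def)
  note \<mu> = mutation_comorphism_poisson[OF D(1) integral_seed_at[OF D w] Cons(1), of "c_at D e0 w"]
  show ?case
    unfolding comorphism_from_initial.simps seed_at.simps
  proof (intro conjI allI)
    show "ring_morphism (comorphism_from_initial D e0 w \<circ> mutation_comorphism D (seed_at D e0 w) (c_at D e0 w) k)"
      using Cons(3) \<mu>(1) by (blast intro: ring_morphism_comp)
    show "bij (comorphism_from_initial D e0 w \<circ> mutation_comorphism D (seed_at D e0 w) (c_at D e0 w) k)"
      using Cons(3) \<mu>(2) by (blast intro: bij_comp)
  qed (use Cons(3) \<mu>(3,4) in simp_all)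
qed


subsection \<open>The bracket on the coordinate ring of a patch\<close>

lemma patch_bracket_add_left: "patch_bracket D e (f + f') g = patch_bracket D e f g + patch_bracket D e f' g"
  unfolding patch_bracket_def
  by (rule setsum_keys_plus_distrib) (simp_all add: coeff_emb_hom algebra_simps sum.distrib)

lemma patch_bracket_add_right: "patch_bracket D e f (g + g') = patch_bracket D e f g + patch_bracket D e f g'"
  unfolding patch_bracket_def sum.distrib[symmetric]
  by (intro sum.cong refl setsum_keys_plus_distrib) (simp_all add: coeff_emb_hom algebra_simps)

lemma patch_bracket_single:
  "patch_bracket D e (Poly_Mapping.single m c) (Poly_Mapping.single n d) =
   coeff_emb (c * d * rat_const (2 * form D (lattice_vec e m) (lattice_vec e n))) * monomial (m + n)"
  by (simp add: patch_bracket_def coeff_emb_hom)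

text \<open>The monomials are eigenvectors of the logarithmic derivations, with their exponents as eigenvalues, so
  on two monomials the sum over \<open>\<Lambda>\<close> is the form on the two lattice vectors.\<close>

lemma to_K_patch_bracket:
  assumes D: "valid_fixed_data D"
  shows "to_K (patch_bracket D e f g) = bracket_K (seed_matrix D e) (to_K f) (to_K g)"
proof -
  note l = derivation_bracket_left[of euler_K, OF derivation_euler_K]
    and r = derivation_bracket_right[of euler_K, OF derivation_euler_K]
  have zero: "patch_bracket D e 0 g = 0" "patch_bracket D e f 0 = 0" for f g
    by (simp_all add: patch_bracket_def)
  note D0 = to_K_hom zero derivation_along_0[OF l] derivation_along_0[OF r] patch_bracket_add_left
    patch_bracket_add_right derivation_along_add[OF l] derivation_along_add[OF r]
  show ?thesis
  proof (induction f rule: poly_mapping_add_induct)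
    case (single m c)
    show ?case
    proof (induction g rule: poly_mapping_add_induct)
      case (single n d)
      have of_nat: "to_K (of_nat n) = of_nat n" for n
        by (induction n) (simp_all add: to_K_hom)
      have eig: "euler_K a (to_K (Poly_Mapping.single m c)) =
          of_nat (Poly_Mapping.lookup m a) * to_K (Poly_Mapping.single m c)" for a m c
        by (simp add: euler_K_to_K euler_single to_K_hom of_nat)
      have rat_of_nat: "rat_K (of_nat n) = of_nat n" for n using rat_K_of_int[of "int n"] by simp
      have rat_sum: "rat_K (\<Sum>i\<in>I. h i) = (\<Sum>i\<in>I. rat_K (h i))" for I and h :: "_ \<Rightarrow> rat"
        by (induction I rule: infinite_finite_induct) (simp_all add: rat_const_hom coeff_emb_hom to_K_hom)
      have "(\<Sum>a\<in>UNIV. \<Sum>b\<in>UNIV. seed_matrix D e a b * of_nat (Poly_Mapping.lookup m a) *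
          of_nat (Poly_Mapping.lookup n b)) =
          (\<Sum>a\<in>UNIV. \<Sum>b\<in>UNIV. rat_K (2 * (of_nat (Poly_Mapping.lookup m a) *
            (of_nat (Poly_Mapping.lookup n b) * form D (e a) (e b)))))"
      proof (intro sum.cong refl)
        fix a b
        show "seed_matrix D e a b * of_nat (Poly_Mapping.lookup m a) * of_nat (Poly_Mapping.lookup n b) =
          rat_K (2 * (of_nat (Poly_Mapping.lookup m a) *
            (of_nat (Poly_Mapping.lookup n b) * form D (e a) (e b))))"
          unfolding seed_matrix_def ring_morphismD(3)[OF ring_morphism_rat_K]
          by (simp add: rat_of_nat mult_ac)
      qed
      also have "\<dots> = rat_K (2 * form D (lattice_vec e m) (lattice_vec e n))"
        unfolding rat_sum[symmetric]
        by (simp add: lattice_vec_def form_sum[OF D] form_zmul_left[OF D] form_zmul_right[OF D]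
            sum_distrib_left mult_ac) (subst sum.swap, simp)
      finally show ?case
        unfolding patch_bracket_single
        by (subst bracket_K_eigen[OF eig eig])
          (simp add: single_eq_coeff_mult to_K_hom coeff_emb_hom monomial_add mult_ac)
    qed (simp_all add: D0)
  qed (simp_all add: D0)
qed

lemma patch_algebra_image: "algebra_image UNIV id patch_algebra coeff_emb"
  by unfold_locales (auto simp: patch_algebra_def coeff_emb_hom)

lemma poisson_patch_bracket:
  assumes D: "valid_fixed_data D"
  shows "poisson_algebra R_poly patch_algebra (patch_bracket D e)"
proof -
  interpret K: poisson_bracket const_K "bracket_K (seed_matrix D e)" by (rule poisson_seed_matrix[OF D])
  interpret algebra_image UNIV id patch_algebra coeff_emb by (rule patch_algebra_image)
  note L = to_K_patch_bracket[OF D] to_K_hom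
  have eqI: "x = y" if "to_K x = to_K y" for x y :: "'a patch_ring" using that by (simp add: to_K_eq_iff)
  have "poisson_bracket coeff_emb (patch_bracket D e)"
  proof
    show "patch_bracket D e (coeff_emb r * x) y = coeff_emb r * patch_bracket D e x y" for r x y
      by (rule eqI) (simp only: L K.scalar_left)
    show "patch_bracket D e x (coeff_emb r * y) = coeff_emb r * patch_bracket D e x y" for r x y
      by (rule eqI) (simp only: L K.scalar_right)
    show "patch_bracket D e x x = 0" for x
      by (rule eqI) (simp only: L K.alternating)
    show "patch_bracket D e x (patch_bracket D e y z) + patch_bracket D e y (patch_bracket D e z x) +
        patch_bracket D e z (patch_bracket D e x y) = 0" for x y z
      by (rule eqI) (simp only: L K.jacobi)
    show "patch_bracket D e (x * y) z = x * patch_bracket D e y z + patch_bracket D e x z * y" for x y z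
      by (rule eqI) (simp only: L K.leibniz)
  qed (rule patch_bracket_add_left patch_bracket_add_right)+
  then show ?thesis unfolding R_poly_def by (rule poisson_algebra) simp_all
qed


section \<open>Gluing along an automorphism of the function field\<close>

lemma patch_eq: "patch = ring_of_type_algebra"
  by (rule patch_def)

lemma germ_val_germ:
  assumes "prime_pt p" "x \<in> local_ring p" shows "germ_val (germ p x) = x"
  unfolding germ_val_def
proof (rule the_equality)
  fix y assume "\<forall>(a, s)\<in>germ p x. y = Fract a s"
  then show "y = x" using germ_nonempty[OF assms] by (auto simp: germ_def)
qed (auto simp: germ_def)

lemma ring_image_structure_sheaf:
  assumes U: "openin Spec (U :: 'a::idom set set)"
  shows "ring_image (regular_on U) (spec_section U) (spec_sheaf U)"
  using openin_Spec_prime[OF U]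
  by unfold_locales
    (auto simp: regular_on_def local_ring_0 local_ring_1 local_ring_add local_ring_mult
      local_ring_uminus carrier_structure_sheaf[OF U] spec_section_one[OF U] spec_section_zero[OF U]
      intro!: spec_section_add[OF U, unfolded regular_on_def]
        spec_section_mult[OF U, unfolded regular_on_def])

definition max_ideal :: "'a::idom set \<Rightarrow> 'a fract set" where
  "max_ideal p = {Fract a s | a s. a \<in> p \<and> s \<notin> p}"

context
  fixes p :: "'a::idom set"
  assumes p: "prime_pt p"
begin

lemma max_ideal_Fract_iff: "s \<notin> p \<Longrightarrow> Fract a s \<in> max_ideal p \<longleftrightarrow> a \<in> p"
proof
  assume s: "s \<notin> p" "Fract a s \<in> max_ideal p"
  then obtain b t where bt: "Fract a s = Fract b t" "b \<in> p" "t \<notin> p" by (auto simp: max_ideal_def)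
  then have "a * t = b * s" using s prime_nonzero[OF p] by (simp add: eq_fract)
  then show "a \<in> p" using bt s prime_mult_iff[OF p] by metis
qed (auto simp: max_ideal_def)

lemma max_ideal_base_iff: "Fract a 1 \<in> max_ideal p \<longleftrightarrow> a \<in> p"
  by (rule max_ideal_Fract_iff) (rule prime_one[OF p])

lemma max_ideal_0: "0 \<in> max_ideal p" and one_not_max_ideal: "1 \<notin> max_ideal p"
  using max_ideal_base_iff[of 0] max_ideal_base_iff[of 1]
  by (simp_all add: fract_collapse prime_zero[OF p] prime_one[OF p])

lemma max_ideal_add: "x \<in> max_ideal p \<Longrightarrow> y \<in> max_ideal p \<Longrightarrow> x + y \<in> max_ideal p"
proof -
  assume "x \<in> max_ideal p" "y \<in> max_ideal p"
  then obtain a s b t where *: "x = Fract a s" "a \<in> p" "s \<notin> p" "y = Fract b t" "b \<in> p" "t \<notin> p"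
    by (auto simp: max_ideal_def)
  then have "x + y = Fract (a * t + b * s) (s * t)" using prime_nonzero[OF p] by simp
  then show ?thesis
    using * by (simp add: max_ideal_Fract_iff prime_mult_iff[OF p] prime_add[OF p])
qed

lemma max_ideal_mult: "x \<in> local_ring p \<Longrightarrow> y \<in> max_ideal p \<Longrightarrow> x * y \<in> max_ideal p"
  by (auto simp: max_ideal_def elim!: local_ringE) (metis mult_fract prime_mult_iff[OF p])

lemma not_max_ideal_iff:
  assumes x: "x \<in> local_ring p"
  shows "x \<notin> max_ideal p \<longleftrightarrow> x \<noteq> 0 \<and> inverse x \<in> local_ring p"
proof
  assume "x \<notin> max_ideal p"
  then obtain a s where "x = Fract a s" "s \<notin> p" "a \<notin> p"
    using x by (auto simp: max_ideal_def local_ring_def)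
  then show "x \<noteq> 0 \<and> inverse x \<in> local_ring p"
    using prime_nonzero[OF p] by (auto simp: local_ringI eq_fract Zero_fract_def)
next
  assume *: "x \<noteq> 0 \<and> inverse x \<in> local_ring p"
  show "x \<notin> max_ideal p"
    using max_ideal_mult[of "inverse x" x] one_not_max_ideal * by auto
qed

end

definition is_automorphism ::
    "('i::{finite, linorder} function_field \<Rightarrow> 'i function_field) \<Rightarrow> bool" where
  "is_automorphism \<theta> \<longleftrightarrow> ring_morphism \<theta> \<and> bij \<theta> \<and> (\<forall>r. \<theta> (const_K r) = const_K r)"

text \<open>The local ring at \<open>p\<close> contains the image of the coordinate ring as soon as it contains the images
  of the variables. This finiteness makes the conditions below open.\<close>

lemma automorphism_to_K_mem:
  assumes "is_automorphism \<theta>" and p: "prime_pt p" and "\<And>i. \<theta> (X_K i) \<in> local_ring p"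
  shows "\<theta> (to_K a) \<in> local_ring p"
proof (induction a rule: patch_induct)
  case (coeff r)
  then show ?case using assms(1) local_ring_base[OF p, of "coeff_emb r"]
    by (simp add: is_automorphism_def to_K_def)
next
  case (var i)
  then show ?case using assms(3) by (simp add: X_K_eq)
qed (use assms(1) in \<open>auto simp: to_K_hom is_automorphism_def ring_morphism_def
  local_ring_add[OF p] local_ring_mult[OF p]\<close>)

context
  fixes \<theta> \<eta> :: "'i::{finite, linorder} function_field \<Rightarrow> 'i function_field"
  assumes \<theta>: "is_automorphism \<theta>" and \<eta>: "is_automorphism \<eta>"
    and \<theta>\<eta>: "\<And>x. \<theta> (\<eta> x) = x"
begin

text \<open>The prime \<open>r' = \<theta>\<^sup>-\<^sup>1(m\<^sub>r)\<close> is the image of \<open>r\<close> under the rational map with comorphism \<open>\<theta>\<close>. The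
  hypotheses say that the map is defined at \<open>r\<close> and that its inverse is defined at \<open>r'\<close>.\<close>

lemma contraction_prime:
  fixes b s :: "'i \<Rightarrow> 'i patch_ring"
  assumes r: "prime_pt r" and def: "\<And>i. \<theta> (X_K i) \<in> local_ring r"
    and bs: "\<And>i. \<eta> (X_K i) = Fract (b i) (s i)" "\<And>i. s i \<noteq> 0"
    and unit: "\<And>i. inverse (\<theta> (to_K (s i))) \<in> local_ring r"
  defines "r' \<equiv> {a. \<theta> (to_K a) \<in> max_ideal r}"
  shows "prime_pt r'" "\<theta> ` local_ring r' = local_ring r"
proof -
  have hom: "ring_morphism \<theta>" using \<theta> by (simp add: is_automorphism_def)
  note H = ring_morphismD[OF hom] ring_morphism_field[OF hom]
  have mem: "\<theta> (to_K a) \<in> local_ring r" for a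
    by (rule automorphism_to_K_mem[OF \<theta> r def])
  have inv_mem: "inverse (\<theta> (to_K a)) \<in> local_ring r" if "a \<notin> r'" for a
    using not_max_ideal_iff[OF r mem[of a]] that by (simp add: r'_def)
  have not_r': "a \<notin> r'" if "a \<noteq> 0" "inverse (\<theta> (to_K a)) \<in> local_ring r" for a
    using not_max_ideal_iff[OF r mem[of a]] that by (simp add: r'_def H to_K_eq_0_iff)
  have prod: "a \<in> r' \<or> b \<in> r'" if "a * b \<in> r'" for a b
  proof (rule ccontr)
    assume "\<not> ?thesis"
    then have "\<theta> (to_K a) \<noteq> 0" "\<theta> (to_K b) \<noteq> 0"
      "inverse (\<theta> (to_K a)) * inverse (\<theta> (to_K b)) \<in> local_ring r"
      using not_max_ideal_iff[OF r mem] inv_mem local_ring_mult[OF r] by (auto simp: r'_def)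
    then have "a * b \<noteq> 0" "inverse (\<theta> (to_K (a * b))) \<in> local_ring r"
      by (auto simp: to_K_hom H to_K_eq_0_iff)
    then show False using not_r' that by blast
  qed
  show pr: "prime_pt r'"
    unfolding prime_pt_iff using prod
    by (auto simp: r'_def to_K_hom H max_ideal_0[OF r] one_not_max_ideal[OF r] max_ideal_add[OF r]
        max_ideal_mult[OF r] mem)
  have sub: "\<theta> x \<in> local_ring r" if x: "x \<in> local_ring r'" for x
  proof -
    obtain a t where "x = Fract a t" "t \<notin> r'" using x by (auto elim: local_ringE)
    then have "\<theta> x = \<theta> (to_K a) * inverse (\<theta> (to_K t))"
      using prime_nonzero[OF pr] by (simp add: Fract_eq_to_K H divide_inverse)
    then show ?thesis using mem inv_mem \<open>t \<notin> r'\<close> local_ring_mult[OF r] by simp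
  qed
  have max: "\<theta> x \<in> max_ideal r" if x: "x \<in> max_ideal r'" for x
  proof -
    obtain a t where at: "x = Fract a t" "t \<notin> r'" "a \<in> r'" using x by (auto simp: max_ideal_def)
    then have "\<theta> x = inverse (\<theta> (to_K t)) * \<theta> (to_K a)"
      using prime_nonzero[OF pr] by (simp add: Fract_eq_to_K H divide_inverse mult.commute)
    then show ?thesis using at inv_mem[of t] max_ideal_mult[OF r] by (simp add: r'_def)
  qed
  have \<eta>mem: "\<eta> (to_K a) \<in> local_ring r'" for a
    using not_r'[OF bs(2) unit] by (intro automorphism_to_K_mem[OF \<eta> pr]) (simp add: bs(1) local_ringI)
  have \<eta>mem': "\<eta> y \<in> local_ring r'" if y: "y \<in> local_ring r" for y
  proof -
    have hom': "ring_morphism \<eta>" using \<eta> by (simp add: is_automorphism_def)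
    obtain a t where at: "y = Fract a t" "t \<notin> r" using y by (auto elim: local_ringE)
    have "\<eta> (to_K t) \<notin> max_ideal r'"
      using max[of "\<eta> (to_K t)"] max_ideal_base_iff[OF r, of t] at by (auto simp: \<theta>\<eta> to_K_def)
    then have "inverse (\<eta> (to_K t)) \<in> local_ring r'" using not_max_ideal_iff[OF pr \<eta>mem] by blast
    moreover have "\<eta> y = \<eta> (to_K a) * inverse (\<eta> (to_K t))"
      using at prime_nonzero[OF r]
      by (simp add: Fract_eq_to_K ring_morphism_field[OF hom'] divide_inverse ring_morphismD[OF hom'])
    ultimately show ?thesis using \<eta>mem local_ring_mult[OF pr] by simp
  qed
  have "y \<in> \<theta> ` local_ring r'" if "y \<in> local_ring r" for y
    using imageI[OF \<eta>mem'[OF that], of \<theta>] by (simp only: \<theta>\<eta>)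
  moreover have "\<theta> ` local_ring r' \<subseteq> local_ring r" using sub by (rule image_subsetI)
  ultimately show "\<theta> ` local_ring r' = local_ring r" by blast
qed

text \<open>At a point \<open>q\<close> of the set finitely many rational functions are regular, and so they are near \<open>q\<close>;
  this includes the inverse of some \<open>s\<^sub>0\<close> that keeps the image of the point in \<open>V\<close>.\<close>

lemma openin_transport:
  assumes V: "openin Spec V"
  shows "openin Spec {q. prime_pt q \<and> (\<exists>q' \<in> V. \<theta> ` local_ring q' = local_ring q)}"
    (is "openin Spec ?D")
proof (subst openin_subopen, intro ballI)
  have hom: "ring_morphism \<theta>" using \<theta> by (simp add: is_automorphism_def)
  note H = ring_morphismD[OF hom] ring_morphism_field[OF hom]
  fix q assume "q \<in> ?D"
  then obtain q' where q: "prime_pt q" and q': "q' \<in> V" and eq: "\<theta> ` local_ring q' = local_ring q" by blast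
  have pq': "prime_pt q'" using openin_Spec_prime[OF V q'] .
  obtain S where S: "V = {p. prime_pt p \<and> \<not> S \<subseteq> p}" using V unfolding openin_Spec by (elim exE)
  have "\<not> S \<subseteq> q'" using q' unfolding S by simp
  then obtain s0 where s0: "s0 \<in> S" "s0 \<notin> q'" by (auto simp: subset_iff)
  have "\<exists>b s. \<eta> (X_K i) = Fract b s \<and> s \<notin> q'" for i
  proof -
    have "X_K i \<in> \<theta> ` local_ring q'"
      unfolding eq using local_ring_base[OF q, of "X_poly i"] by (simp add: X_K_eq to_K_def)
    then obtain y where "y \<in> local_ring q'" "\<theta> y = X_K i" by auto
    then have "\<eta> (X_K i) \<in> local_ring q'" using \<theta>\<eta> injD[OF H(10)] by metis
    then show ?thesis by (elim local_ringE) blast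
  qed
  then obtain b s where bs: "\<And>i. \<eta> (X_K i) = Fract (b i) (s i)" "\<And>i. s i \<notin> q'" by metis
  define G where "G = (\<Inter>i. {r. prime_pt r \<and> \<theta> (X_K i) \<in> local_ring r}) \<inter>
    (\<Inter>i. {r. prime_pt r \<and> inverse (\<theta> (to_K (s i))) \<in> local_ring r}) \<inter>
    {r. prime_pt r \<and> inverse (\<theta> (to_K s0)) \<in> local_ring r}"
  have "openin Spec G"
    unfolding G_def by (intro openin_Int openin_INT2 openin_regular) auto
  moreover have "q \<in> G"
  proof -
    have "\<theta> (X_K i) \<in> local_ring q" for i
      using local_ring_base[OF pq', of "X_poly i"] eq by (auto simp: X_K_eq to_K_def)
    moreover have "inverse (\<theta> (to_K a)) \<in> local_ring q" if "a \<notin> q'" for a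
      using that inverse_in_local_ring[OF pq', of a] unfolding eq[symmetric] H(8)[symmetric]
      by (simp add: to_K_def)
    ultimately show ?thesis using q bs s0 by (simp add: G_def)
  qed
  moreover have "G \<subseteq> ?D"
  proof
    fix r assume r: "r \<in> G"
    then have pr: "prime_pt r" by (simp add: G_def)
    define r' where "r' = {a. \<theta> (to_K a) \<in> max_ideal r}"
    have r': "prime_pt r'" "\<theta> ` local_ring r' = local_ring r"
      unfolding r'_def
      by (rule contraction_prime[OF pr _ bs(1)];
          use r bs(2) prime_nonzero[OF pq'] in \<open>auto simp: G_def\<close>)+
    have "inverse (\<theta> (to_K s0)) \<in> \<theta> ` local_ring r'" using r r' by (simp add: G_def)
    then have "inverse (to_K s0) \<in> local_ring r'"
      unfolding H(8)[symmetric] using injD[OF H(10)] by blast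
    then have "s0 \<notin> r'"
      using inverse_in_local_ring[OF r'(1), of s0] prime_nonzero[OF pq' s0(2)] by (simp add: to_K_def)
    then have "r' \<in> V" using s0 r'(1) unfolding S by (auto simp: subset_iff)
    then show "r \<in> ?D" using r'(2) pr by (intro CollectI conjI bexI[of _ r'])
  qed
  ultimately show "\<exists>G. openin Spec G \<and> q \<in> G \<and> G \<subseteq> ?D" by blast
qed

end

text \<open>An element of the local ring at \<open>f p\<close> is a section on a neighbourhood of \<open>f p\<close>, and the isomorphism of
  the sections near \<open>f p\<close> with the sections near \<open>p\<close> acts on values as \<open>\<theta>\<close>.\<close>

lemma restricts_to_iso_local_ring:
  assumes iso: "restricts_to_iso \<theta> U U' f" and p: "p \<in> U"
  shows "prime_pt p" "prime_pt (f p)" "\<theta> ` local_ring (f p) = local_ring p"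
proof -
  have U: "openin Spec U" and U': "openin Spec U'"
    and homeo: "homeomorphic_map (subtopology Spec U) (subtopology Spec U') f"
    and sheaf: "\<And>V. openin Spec V \<Longrightarrow> V \<subseteq> U' \<Longrightarrow>
       (\<exists>\<phi> \<in> ring_iso (spec_sheaf V)
              (spec_sheaf {p \<in> U. f p \<in> V}).
           \<forall>\<sigma> \<in> carrier (spec_sheaf V). \<forall>p \<in> U. f p \<in> V \<longrightarrow>
             germ_val (\<phi> \<sigma> p) = \<theta> (germ_val (\<sigma> (f p))))"
    using iso unfolding restricts_to_iso_def patch_eq by blast+
  have tops: "topspace (subtopology Spec U) = U" "topspace (subtopology Spec U') = U'"
    using openin_subset[OF U] openin_subset[OF U'] by (auto simp: topspace_subtopology)
  have fU: "f ` U = U'" and inj: "inj_on f U"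
    using homeomorphic_imp_surjective_map[OF homeo] homeomorphic_imp_injective_map[OF homeo]
    by (simp_all only: tops)
  have pre: "openin Spec {q \<in> U. f q \<in> V}" if "openin Spec V" "V \<subseteq> U'" for V
  proof -
    have "openin (subtopology Spec U') V" using that U' by (simp add: openin_open_subtopology)
    then have "openin (subtopology Spec U) {q \<in> U. f q \<in> V}"
      using homeomorphic_imp_continuous_map[OF homeo] unfolding continuous_map_def tops by blast
    then show ?thesis using U by (simp add: openin_open_subtopology)
  qed
  have im: "openin Spec (f ` W)" if "openin Spec W" "W \<subseteq> U" for W
  proof -
    have "openin (subtopology Spec U) W" using that U by (simp add: openin_open_subtopology)
    then have "openin (subtopology Spec U') (f ` W)"
      using homeomorphic_imp_open_map[OF homeo] by (simp add: open_map_def)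
    then show ?thesis using U' by (simp add: openin_open_subtopology)
  qed
  show pp: "prime_pt p" using openin_Spec_prime[OF U p] .
  have fp: "f p \<in> U'" using fU p by blast
  then show pfp: "prime_pt (f p)" using openin_Spec_prime[OF U'] by blast
  show "\<theta> ` local_ring (f p) = local_ring p"
  proof (intro equalityI image_subsetI subsetI)
    fix x assume x: "x \<in> local_ring (f p)"
    let ?V = "U' \<inter> {q. prime_pt q \<and> x \<in> local_ring q}"
    have V: "openin Spec ?V" using U' openin_regular by blast
    obtain \<phi> where \<phi>: "\<phi> \<in> ring_iso (spec_sheaf ?V)
              (spec_sheaf {p \<in> U. f p \<in> ?V})"
      and val: "\<And>\<sigma> p. \<sigma> \<in> carrier (spec_sheaf ?V) \<Longrightarrow> p \<in> U \<Longrightarrow> f p \<in> ?V \<Longrightarrow>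
             germ_val (\<phi> \<sigma> p) = \<theta> (germ_val (\<sigma> (f p)))"
      using sheaf[OF V] by blast
    let ?\<sigma> = "spec_section ?V x"
    have \<sigma>: "?\<sigma> \<in> carrier (spec_sheaf ?V)"
      unfolding carrier_structure_sheaf[OF V] by (rule imageI) (simp add: regular_on_def)
    have V': "openin Spec {p \<in> U. f p \<in> ?V}" by (rule pre[OF V]) blast
    have "\<phi> ?\<sigma> \<in> carrier (spec_sheaf {p \<in> U. f p \<in> ?V})"
      using \<phi> \<sigma> by (auto simp: ring_iso_def ring_hom_def)
    then obtain y where y: "y \<in> regular_on {p \<in> U. f p \<in> ?V}"
      and \<phi>\<sigma>: "\<phi> ?\<sigma> = spec_section {p \<in> U. f p \<in> ?V} y"
      unfolding carrier_structure_sheaf[OF V'] by blast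
    have mem: "p \<in> {p \<in> U. f p \<in> ?V}" using p fp pfp x by blast
    then have yp: "y \<in> local_ring p" using y unfolding regular_on_def by blast
    have "germ_val (\<phi> ?\<sigma> p) = y" unfolding \<phi>\<sigma> using mem germ_val_germ[OF pp yp]
      by (simp add: spec_section_def)
    moreover have "germ_val (?\<sigma> (f p)) = x" using mem germ_val_germ[OF pfp x] by (simp add: spec_section_def)
    ultimately have "y = \<theta> x" using val[OF \<sigma> p] mem by simp
    then show "\<theta> x \<in> local_ring p" using yp by simp
  next
    fix y assume y: "y \<in> local_ring p"
    let ?W = "U \<inter> {q. prime_pt q \<and> y \<in> local_ring q}"
    have W: "openin Spec ?W" using U openin_regular by blast
    let ?V = "f ` ?W"
    have V: "openin Spec ?V" by (rule im[OF W]) blast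
    have VU: "?V \<subseteq> U'" using fU by blast
    have pW: "p \<in> ?W" using p pp y by blast
    have WV: "{p \<in> U. f p \<in> ?V} = ?W" using inj by (auto simp: inj_on_def)
    obtain \<phi> where \<phi>: "\<phi> \<in> ring_iso (spec_sheaf ?V)
              (spec_sheaf ?W)"
      and val: "\<And>\<sigma> p. \<sigma> \<in> carrier (spec_sheaf ?V) \<Longrightarrow> p \<in> U \<Longrightarrow> f p \<in> ?V \<Longrightarrow>
             germ_val (\<phi> \<sigma> p) = \<theta> (germ_val (\<sigma> (f p)))"
      using sheaf[OF V VU] unfolding WV by blast
    have sec: "spec_section ?W y \<in> carrier (spec_sheaf ?W)"
      unfolding carrier_structure_sheaf[OF W] by (rule imageI) (simp add: regular_on_def)
    have "\<phi> ` carrier (spec_sheaf ?V) =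
        carrier (spec_sheaf ?W)"
      using \<phi> by (simp add: ring_iso_def bij_betw_def)
    from sec[folded this] obtain \<sigma> where \<phi>\<sigma>: "\<phi> \<sigma> = spec_section ?W y"
      and \<sigma>: "\<sigma> \<in> carrier (spec_sheaf ?V)"
      by (rule imageE) (erule that[OF sym])
    from \<sigma> obtain x where x: "x \<in> regular_on ?V" and \<sigma>x: "\<sigma> = spec_section ?V x"
      unfolding carrier_structure_sheaf[OF V] by blast
    have xp: "x \<in> local_ring (f p)" using x pW unfolding regular_on_def by blast
    have fpV: "f p \<in> ?V" using pW by blast
    have "y = germ_val (\<phi> \<sigma> p)" unfolding \<phi>\<sigma> using pW germ_val_germ[OF pp y]
      by (simp add: spec_section_def)
    also have "\<dots> = \<theta> (germ_val (\<sigma> (f p)))" by (rule val[OF \<sigma> p fpV])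
    also have "germ_val (\<sigma> (f p)) = x" unfolding \<sigma>x using fpV germ_val_germ[OF pfp xp]
      by (simp add: spec_section_def)
    finally show "y \<in> \<theta> ` local_ring (f p)" using xp by blast
  qed
qed

text \<open>The largest open set on which the map with comorphism \<open>\<theta>\<close> is an isomorphism onto an open
  set.\<close>

definition iso_domain ::
    "('i::{finite, linorder} function_field \<Rightarrow> 'i function_field) \<Rightarrow> 'i patch_ring set set" where
  "iso_domain \<theta> = {q. prime_pt q \<and> (\<exists>q'. prime_pt q' \<and> \<theta> ` local_ring q' = local_ring q)}"

lemma iso_domain_map:
  assumes \<theta>: "is_automorphism \<theta>" and \<eta>: "is_automorphism \<eta>"
    and \<theta>\<eta>: "\<And>x. \<theta> (\<eta> x) = x" and \<eta>\<theta>: "\<And>x. \<eta> (\<theta> x) = x"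
  obtains f where "\<And>q. q \<in> iso_domain \<theta> \<Longrightarrow> prime_pt (f q) \<and> \<theta> ` local_ring (f q) = local_ring q"
    "\<And>q q'. \<lbrakk>prime_pt q; prime_pt q'; \<theta> ` local_ring q' = local_ring q\<rbrakk> \<Longrightarrow> q \<in> iso_domain \<theta> \<and> f q = q'"
    "\<And>V. openin Spec V \<Longrightarrow> openin Spec {q \<in> iso_domain \<theta>. f q \<in> V}"
proof -
  define f where "f q = (SOME q'. prime_pt q' \<and> \<theta> ` local_ring q' = local_ring q)" for q
  have 1: "prime_pt (f q) \<and> \<theta> ` local_ring (f q) = local_ring q" if "q \<in> iso_domain \<theta>" for q
    using that unfolding f_def iso_domain_def by (intro someI_ex[of "\<lambda>q'. prime_pt q' \<and> _ q'"]) blast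
  have 2: "q \<in> iso_domain \<theta> \<and> f q = q'"
    if q: "prime_pt q" "prime_pt q'" "\<theta> ` local_ring q' = local_ring q" for q q'
  proof
    show dom: "q \<in> iso_domain \<theta>" using q by (auto simp: iso_domain_def)
    have "inj \<theta>" using \<theta> by (simp add: is_automorphism_def bij_is_inj)
    then have "local_ring (f q) = local_ring q'" using 1[OF dom] q(3) by (metis inj_image_eq_iff)
    then show "f q = q'" using 1[OF dom] q(2) local_ring_inject by blast
  qed
  have 3: "openin Spec {q \<in> iso_domain \<theta>. f q \<in> V}" if V: "openin Spec V" for V
  proof -
    have "q \<in> {q \<in> iso_domain \<theta>. f q \<in> V} \<longleftrightarrow>
        q \<in> {q. prime_pt q \<and> (\<exists>q' \<in> V. \<theta> ` local_ring q' = local_ring q)}" for q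
      using 1[of q] 2[of q] openin_Spec_prime[OF V] by (auto simp: iso_domain_def)
    then have "{q \<in> iso_domain \<theta>. f q \<in> V} =
        {q. prime_pt q \<and> (\<exists>q' \<in> V. \<theta> ` local_ring q' = local_ring q)}" by blast
    then show ?thesis using openin_transport[OF \<theta> \<eta> \<theta>\<eta> V] by simp
  qed
  show thesis by (rule that[of f]) (use 1 2 3 in auto)
qed

lemma restricts_to_iso_of_local_ring:
  fixes \<theta> \<eta> :: "'i::{finite, linorder} function_field \<Rightarrow> 'i function_field"
  assumes \<theta>: "is_automorphism \<theta>" and \<eta>: "is_automorphism \<eta>"
    and \<theta>\<eta>: "\<And>x. \<theta> (\<eta> x) = x" and \<eta>\<theta>: "\<And>x. \<eta> (\<theta> x) = x"
    and pp: "prime_pt p" "prime_pt p'" and pp': "\<theta> ` local_ring p' = local_ring p"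
  shows "\<exists>U U' f. restricts_to_iso \<theta> U U' f \<and> p \<in> U \<and> p' = f p"
proof -
  have hom: "ring_morphism \<theta>" using \<theta> by (simp add: is_automorphism_def)
  have inj: "inj \<theta>" by (rule ring_morphism_field(4)[OF hom])
  obtain f where f: "\<And>q. q \<in> iso_domain \<theta> \<Longrightarrow> prime_pt (f q) \<and> \<theta> ` local_ring (f q) = local_ring q"
    and f_eq: "\<And>q q'. \<lbrakk>prime_pt q; prime_pt q'; \<theta> ` local_ring q' = local_ring q\<rbrakk> \<Longrightarrow>
      q \<in> iso_domain \<theta> \<and> f q = q'"
    and pre_f: "\<And>V. openin Spec V \<Longrightarrow> openin Spec {q \<in> iso_domain \<theta>. f q \<in> V}"
    using iso_domain_map[OF \<theta> \<eta> \<theta>\<eta> \<eta>\<theta>] by blast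
  obtain g where g: "\<And>q. q \<in> iso_domain \<eta> \<Longrightarrow> prime_pt (g q) \<and> \<eta> ` local_ring (g q) = local_ring q"
    and g_eq: "\<And>q q'. \<lbrakk>prime_pt q; prime_pt q'; \<eta> ` local_ring q' = local_ring q\<rbrakk> \<Longrightarrow>
      q \<in> iso_domain \<eta> \<and> g q = q'"
    and pre_g: "\<And>V. openin Spec V \<Longrightarrow> openin Spec {q \<in> iso_domain \<eta>. g q \<in> V}"
    using iso_domain_map[OF \<eta> \<theta> \<eta>\<theta> \<theta>\<eta>] by blast
  define U where "U = iso_domain \<theta>"
  define U' where "U' = iso_domain \<eta>"
  have inv: "\<theta> ` A = B \<longleftrightarrow> \<eta> ` B = A" for A B
    by (auto simp: image_image \<theta>\<eta> \<eta>\<theta>)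
  have U_prime: "prime_pt q" if "q \<in> U \<or> q \<in> U'" for q
    using that by (auto simp: U_def U'_def iso_domain_def)
  note pre_f = pre_f[folded U_def] and pre_g = pre_g[folded U'_def]
  have fU: "prime_pt (f q)" "\<theta> ` local_ring (f q) = local_ring q" "f q \<in> U'" "g (f q) = q"
    if "q \<in> U" for q
    using f[of q] g_eq[of "f q" q] U_prime[of q] that inv by (simp_all add: U_def U'_def)
  have gU: "g q \<in> U" "f (g q) = q" if "q \<in> U'" for q
    using g[of q] f_eq[of "g q" q] U_prime[of q] that inv by (simp_all add: U_def U'_def)
  have "{q \<in> U. f q \<in> {p. prime_pt p}} = U" "{q \<in> U'. g q \<in> {p. prime_pt p}} = U'"
    using fU(1) gU(1) U_prime by auto
  then have U: "openin Spec U" and U': "openin Spec U'"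
    using pre_f[OF openin_Spec_all] pre_g[OF openin_Spec_all] by simp_all
  have tops: "topspace (subtopology Spec U) = U" "topspace (subtopology Spec U') = U'"
    using openin_subset[OF U] openin_subset[OF U'] by (auto simp: topspace_subtopology)
  have "homeomorphic_maps (subtopology Spec U) (subtopology Spec U') f g"
    unfolding homeomorphic_maps_def continuous_map_def tops
    using fU(3,4) gU pre_f pre_g U U' by (auto simp: openin_open_subtopology)
  then have homeo: "homeomorphic_map (subtopology Spec U) (subtopology Spec U') f"
    using homeomorphic_map_maps by blast
  have sheaf: "\<exists>\<phi> \<in> ring_iso (spec_sheaf V)
              (spec_sheaf {p \<in> U. f p \<in> V}).
           \<forall>\<sigma> \<in> carrier (spec_sheaf V). \<forall>p \<in> U. f p \<in> V \<longrightarrow>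
             germ_val (\<phi> \<sigma> p) = \<theta> (germ_val (\<sigma> (f p)))"
    if V: "openin Spec V" "V \<subseteq> U'" for V
  proof -
    let ?W = "{p \<in> U. f p \<in> V}"
    have W: "openin Spec ?W" by (rule pre_f[OF V(1)])
    have VW: "V = f ` ?W"
    proof (intro equalityI subsetI)
      fix q assume "q \<in> V"
      then show "q \<in> f ` ?W" using V(2) gU[of q] by (intro image_eqI[of _ _ "g q"]) auto
    qed auto
    \<comment> \<open>so \<open>\<theta>\<close> itself is the isomorphism of the rings of sections\<close>
    have reg: "x \<in> regular_on V \<longleftrightarrow> \<theta> x \<in> regular_on ?W" for x
    proof -
      have "x \<in> local_ring (f q) \<longleftrightarrow> \<theta> x \<in> local_ring q" if "q \<in> U" for q
        unfolding fU(2)[OF that, symmetric] using inj by (simp add: inj_image_mem_iff)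
      then have "(\<forall>q \<in> ?W. x \<in> local_ring (f q)) \<longleftrightarrow> (\<forall>q \<in> ?W. \<theta> x \<in> local_ring q)" by blast
      moreover have "(\<forall>q \<in> V. x \<in> local_ring q) \<longleftrightarrow> (\<forall>q \<in> ?W. x \<in> local_ring (f q))"
        using arg_cong[OF VW, of "\<lambda>V. \<forall>q \<in> V. x \<in> local_ring q"] by (simp only: ball_simps)
      ultimately show ?thesis unfolding regular_on_def by simp
    qed
    have "\<exists>\<phi> \<in> ring_iso (spec_sheaf V) (spec_sheaf ?W).
        \<forall>x \<in> regular_on V. \<phi> (spec_section V x) = spec_section ?W (\<theta> x)"
    proof (rule ring_image_iso[OF ring_image_structure_sheaf[OF V(1)] ring_image_structure_sheaf[OF W]])
      show "\<theta> ` regular_on V = regular_on ?W"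
      proof (intro equalityI subsetI)
        fix y assume "y \<in> regular_on ?W"
        then have "\<eta> y \<in> regular_on V" using reg[of "\<eta> y"] by (simp add: \<theta>\<eta>)
        from imageI[OF this, of \<theta>] show "y \<in> \<theta> ` regular_on V" by (simp only: \<theta>\<eta>)
      qed (use reg in auto)
      show "spec_section V x = spec_section V y \<longleftrightarrow> spec_section ?W (\<theta> x) = spec_section ?W (\<theta> y)"
        if "x \<in> regular_on V" "y \<in> regular_on V" for x y
      proof -
        have "V = {} \<longleftrightarrow> ?W = {}" using VW by blast
        moreover have "\<theta> x = \<theta> y \<longleftrightarrow> x = y" using \<eta>\<theta> by metis
        ultimately show ?thesis
          using spec_section_eq_iff[OF V(1) that(1)] spec_section_eq_iff[OF W, of "\<theta> x"] reg that by simp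
      qed
    qed (simp_all add: ring_morphismD[OF hom])
    then obtain \<phi> where \<phi>: "\<phi> \<in> ring_iso (spec_sheaf V) (spec_sheaf ?W)"
      and val: "\<And>x. x \<in> regular_on V \<Longrightarrow> \<phi> (spec_section V x) = spec_section ?W (\<theta> x)" by blast
    have "germ_val (\<phi> \<sigma> q) = \<theta> (germ_val (\<sigma> (f q)))"
      if \<sigma>: "\<sigma> \<in> carrier (spec_sheaf V)" and q: "q \<in> U" "f q \<in> V" for \<sigma> q
    proof -
      obtain x where x: "x \<in> regular_on V" "\<sigma> = spec_section V x"
        using \<sigma> unfolding carrier_structure_sheaf[OF V(1)] by blast
      have "x \<in> local_ring (f q)" "\<theta> x \<in> local_ring q"
        using x reg[of x] q by (auto simp: regular_on_def)
      then show ?thesis using q fU(1)[OF q(1)] openin_Spec_prime[OF U q(1)] unfolding x(2) val[OF x(1)]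
        by (simp add: spec_section_def germ_val_germ)
    qed
    then show ?thesis using \<phi> by blast
  qed
  have "restricts_to_iso \<theta> U U' f"
    unfolding restricts_to_iso_def patch_eq using U U' homeo sheaf by blast
  moreover have "p \<in> U" "p' = f p" using f_eq[OF pp pp'] by (simp_all add: U_def)
  ultimately show ?thesis by blast
qed


section \<open>The glued scheme\<close>

abbreviation pt :: "('i::{finite, linorder}, 'n::ab_group_add) fixed_data \<Rightarrow> ('i \<Rightarrow> 'n) \<Rightarrow> 'i list
    \<Rightarrow> 'i patch_ring set \<Rightarrow> 'i Xhat_point" where
  "pt D e0 w p \<equiv> glue_rel D e0 `` {(w, p)}"

text \<open>The function fields of all patches are moved to the one of the initial patch: there \<open>point_ring\<close> is
  the local ring of the point \<open>p\<close> of the patch at \<open>w\<close>, and \<open>chart\<close> rewrites an element in the coordinates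
  of that patch.\<close>

definition point_ring :: "('i::{finite, linorder}, 'n::ab_group_add) fixed_data \<Rightarrow> ('i \<Rightarrow> 'n) \<Rightarrow> 'i list
    \<Rightarrow> 'i patch_ring set \<Rightarrow> 'i function_field set" where
  "point_ring D e0 w p = comorphism_from_initial D e0 w ` local_ring p"

definition chart :: "('i::{finite, linorder}, 'n::ab_group_add) fixed_data \<Rightarrow> ('i \<Rightarrow> 'n) \<Rightarrow> 'i list
    \<Rightarrow> 'i function_field \<Rightarrow> 'i function_field" where
  "chart D e0 w = inv_into UNIV (comorphism_from_initial D e0 w)"

definition regular_Xhat :: "('i::{finite, linorder}, 'n::ab_group_add) fixed_data \<Rightarrow> ('i \<Rightarrow> 'n)
    \<Rightarrow> 'i Xhat_point set \<Rightarrow> 'i function_field set" where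
  "regular_Xhat D e0 W = {x. \<forall>w \<in> words D. chart D e0 w x \<in> regular_on (in_patch D e0 w W)}"

definition Xhat_section :: "('i::{finite, linorder}, 'n::ab_group_add) fixed_data \<Rightarrow> ('i \<Rightarrow> 'n)
    \<Rightarrow> 'i Xhat_point set \<Rightarrow> 'i function_field \<Rightarrow> 'i Xhat_section" where
  "Xhat_section D e0 W x = (\<lambda>w \<in> words D. spec_section (in_patch D e0 w W) (chart D e0 w x))"

lemma Nil_in_words: "[] \<in> words D"
  by (simp add: words_def)

lemma in_patch_prime: "p \<in> in_patch D e0 w W \<Longrightarrow> prime_pt p"
  by (simp add: in_patch_def patch_eq)

lemma in_patch_Int: "in_patch D e0 w (W \<inter> W') = in_patch D e0 w W \<inter> in_patch D e0 w W'"
  by (auto simp: in_patch_def)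

lemma in_patch_Union: "in_patch D e0 w (\<Union>\<K>) = (\<Union>W\<in>\<K>. in_patch D e0 w W)"
  by (auto simp: in_patch_def)

lemma in_patch_mono: "W \<subseteq> W' \<Longrightarrow> in_patch D e0 w W \<subseteq> in_patch D e0 w W'"
  by (auto simp: in_patch_def)

lemma openin_Xhat:
  "openin (Xhat_top D e0) W \<longleftrightarrow>
     W \<subseteq> Xhat_points D e0 \<and> (\<forall>w \<in> words D. openin Spec (in_patch D e0 w W))"
proof -
  have "istopology (\<lambda>W. W \<subseteq> Xhat_points D e0 \<and> (\<forall>w \<in> words D. openin Spec (in_patch D e0 w W)))"
    unfolding istopology_def
    by (auto simp: in_patch_Int in_patch_Union openin_Int intro!: openin_Union)
  then show ?thesis by (simp add: Xhat_top_def patch_eq topology_inverse')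
qed

lemma regular_Xhat_mono: "W \<subseteq> W' \<Longrightarrow> regular_Xhat D e0 W' \<subseteq> regular_Xhat D e0 W"
  using in_patch_mono unfolding regular_Xhat_def regular_on_def by blast

lemma Xhat_res_section:
  "W' \<subseteq> W \<Longrightarrow> Xhat_res D e0 W W' (Xhat_section D e0 W x) = Xhat_section D e0 W' x"
  unfolding Xhat_res_def Xhat_section_def
  by (intro restrict_ext) (simp add: spec_section_restrict in_patch_mono)

lemma Xhat_section_empty: "Xhat_section D e0 {} x = Xhat_section D e0 {} y"
  by (simp add: Xhat_section_def in_patch_def spec_section_def restrict_def)

lemma local_ring_const: "prime_pt p \<Longrightarrow> const_K r \<in> local_ring p"
  unfolding to_K_def by (rule local_ring_base)

lemma local_ring_sum: "prime_pt p \<Longrightarrow> (\<And>i. i \<in> I \<Longrightarrow> f i \<in> local_ring p) \<Longrightarrow> (\<Sum>i\<in>I. f i) \<in> local_ring p"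
  by (induction I rule: infinite_finite_induct) (auto simp: local_ring_0 local_ring_add)

text \<open>By the quotient rule, whose denominator is the square of the given one.\<close>

lemma local_ring_euler:
  assumes p: "prime_pt p" and x: "x \<in> local_ring p" shows "euler_K i x \<in> local_ring p"
proof -
  obtain a s where as: "x = Fract a s" "s \<notin> p" using x by (elim local_ringE)
  show ?thesis
    unfolding as(1) euler_K_def fract_derivation_Fract[OF derivation_euler prime_nonzero[OF p as(2)]]
    by (rule local_ringI) (use as(2) in \<open>simp add: prime_mult_iff[OF p]\<close>)
qed

lemma local_ring_bracket:
  assumes p: "prime_pt p" and "x \<in> local_ring p" "y \<in> local_ring p"
  shows "bracket_K (seed_matrix D e) x y \<in> local_ring p"
  unfolding deriv_bracket_def seed_matrix_def
  by (intro local_ring_sum[OF p] local_ring_mult[OF p] local_ring_euler[OF p] local_ring_const[OF p] assms)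

context
  fixes D :: "('i::{finite, linorder}, 'n::ab_group_add) fixed_data" and e0 :: "'i \<Rightarrow> 'n"
  assumes D: "valid_fixed_data D" and e0: "is_seed D e0"
begin

abbreviation Reg :: "'i Xhat_point set \<Rightarrow> 'i function_field set" where
  "Reg \<equiv> regular_Xhat D e0"

abbreviation Sec :: "'i Xhat_point set \<Rightarrow> 'i function_field \<Rightarrow> 'i Xhat_section" where
  "Sec \<equiv> Xhat_section D e0"

abbreviation Xhat_open :: "'i Xhat_point set \<Rightarrow> bool" where
  "Xhat_open \<equiv> openin (Xhat_top D e0)"

abbreviation (input) \<Theta> :: "'i list \<Rightarrow> 'i function_field \<Rightarrow> 'i function_field" where
  "\<Theta> \<equiv> comorphism_from_initial D e0"

lemma automorphism_initial: "w \<in> words D \<Longrightarrow> is_automorphism (\<Theta> w)"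
  using comorphism_from_initial_poisson[OF D e0] by (simp add: is_automorphism_def)

lemma initial_chart: "w \<in> words D \<Longrightarrow> \<Theta> w (chart D e0 w x) = x"
  and chart_initial: "w \<in> words D \<Longrightarrow> chart D e0 w (\<Theta> w x) = x"
  using automorphism_initial[of w]
  by (simp_all add: chart_def is_automorphism_def bij_is_surj surj_f_inv_f bij_is_inj)

lemma automorphism_chart: "w \<in> words D \<Longrightarrow> is_automorphism (chart D e0 w)"
  using automorphism_initial[of w] chart_initial[of w] ring_morphism_inv[of "\<Theta> w"]
  unfolding is_automorphism_def chart_def by (metis bij_imp_bij_inv)

lemma chart_hom:
  assumes "w \<in> words D" shows "ring_morphism (chart D e0 w)" "chart D e0 w (const_K r) = const_K r"
  using automorphism_chart[OF assms] by (simp_all add: is_automorphism_def)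

lemma initial_hom: "w \<in> words D \<Longrightarrow> ring_morphism (\<Theta> w)"
  using automorphism_initial by (simp add: is_automorphism_def)

lemma chart_bracket:
  assumes w: "w \<in> words D"
  shows "chart D e0 w (bracket_K (seed_matrix D e0) x y) =
    bracket_K (seed_matrix D (seed_at D e0 w)) (chart D e0 w x) (chart D e0 w y)"
proof -
  have "bracket_K (seed_matrix D e0) (\<Theta> w (chart D e0 w x)) (\<Theta> w (chart D e0 w y)) =
      \<Theta> w (bracket_K (seed_matrix D (seed_at D e0 w)) (chart D e0 w x) (chart D e0 w y))"
    using comorphism_from_initial_poisson[OF D e0 w] by blast
  then show ?thesis by (simp add: initial_chart w chart_initial)
qed

lemma comorphism_eq: "comorphism D e0 w w' x = chart D e0 w (\<Theta> w' x)"
  by (simp add: comorphism_def chart_def)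

lemma automorphism_comorphism:
  assumes "w \<in> words D" "w' \<in> words D" shows "is_automorphism (comorphism D e0 w w')"
proof -
  have eq: "comorphism D e0 w w' = chart D e0 w \<circ> \<Theta> w'" by (simp add: fun_eq_iff comorphism_eq)
  show ?thesis unfolding eq
    using automorphism_chart[OF assms(1)] automorphism_initial[OF assms(2)]
    unfolding is_automorphism_def by (intro conjI ring_morphism_comp bij_comp) simp_all
qed

lemma mem_point_ring:
  assumes "w \<in> words D" shows "x \<in> point_ring D e0 w p \<longleftrightarrow> chart D e0 w x \<in> local_ring p"
  unfolding point_ring_def
proof
  assume "chart D e0 w x \<in> local_ring p"
  from imageI[OF this, of "\<Theta> w"] show "x \<in> \<Theta> w ` local_ring p" by (simp only: initial_chart[OF assms])
qed (auto simp: chart_initial[OF assms])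

lemma comorphism_image_iff:
  assumes "w \<in> words D" "w' \<in> words D"
  shows "comorphism D e0 w w' ` local_ring p' = local_ring p \<longleftrightarrow>
    point_ring D e0 w p = point_ring D e0 w' p'"
proof -
  have "comorphism D e0 w w' ` local_ring p' = chart D e0 w ` point_ring D e0 w' p'"
    by (simp add: comorphism_eq point_ring_def image_image)
  moreover have "chart D e0 w ` A = B \<longleftrightarrow> \<Theta> w ` B = A" for A B
    by (auto simp: image_image initial_chart[OF assms(1)] chart_initial[OF assms(1)])
  ultimately show ?thesis by (simp add: point_ring_def)
qed

text \<open>So the glued scheme is a set of local subrings of the function field, and the gluing relation is
  visibly an equivalence.\<close>

lemma glue_rel_iff:
  "((w, p), (w', p')) \<in> glue_rel D e0 \<longleftrightarrow> w \<in> words D \<and> w' \<in> words D \<and> prime_pt p \<and> prime_pt p' \<and>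
     point_ring D e0 w p = point_ring D e0 w' p'" (is "?l \<longleftrightarrow> ?r")
proof
  assume ?l
  then obtain U U' f where w: "w \<in> words D" "w' \<in> words D"
    and f: "restricts_to_iso (comorphism D e0 w w') U U' f" "p \<in> U" "p' = f p"
    by (auto simp: glue_rel_def)
  then show ?r using restricts_to_iso_local_ring[OF f(1,2)] comorphism_image_iff[OF w] by simp
next
  assume r: ?r
  then have w: "w \<in> words D" "w' \<in> words D" by auto
  have "\<exists>U U' f. restricts_to_iso (comorphism D e0 w w') U U' f \<and> p \<in> U \<and> p' = f p"
    using r comorphism_image_iff[OF w]
    by (intro restricts_to_iso_of_local_ring[OF automorphism_comorphism[OF w]
          automorphism_comorphism[OF w(2,1)]])
      (auto simp: comorphism_eq initial_chart chart_initial)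
  then show ?l using w by (simp add: glue_rel_def)
qed

lemma pt_eq_iff:
  assumes "w \<in> words D" "prime_pt p" "w' \<in> words D" "prime_pt p'"
  shows "pt D e0 w p = pt D e0 w' p' \<longleftrightarrow> point_ring D e0 w p = point_ring D e0 w' p'"
proof
  assume "pt D e0 w p = pt D e0 w' p'"
  moreover have "(w', p') \<in> pt D e0 w' p'" using assms by (simp add: glue_rel_iff)
  ultimately show "point_ring D e0 w p = point_ring D e0 w' p'" using glue_rel_iff by blast
next
  assume "point_ring D e0 w p = point_ring D e0 w' p'"
  then show "pt D e0 w p = pt D e0 w' p'" using assms by (auto simp: glue_rel_iff)
qed

lemma Xhat_points_eq: "Xhat_points D e0 = {pt D e0 w p | w p. w \<in> words D \<and> prime_pt p}"
  by (auto simp: Xhat_points_def quotient_def patch_eq)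

lemma point_ring_inject:
  assumes "w \<in> words D" "prime_pt p" "prime_pt p'" "point_ring D e0 w p = point_ring D e0 w p'"
  shows "p = p'"
proof -
  have "local_ring p = local_ring p'"
    using assms(4) mem_point_ring[OF assms(1)] chart_initial[OF assms(1)] by (metis subsetI subset_antisym)
  then show ?thesis using local_ring_inject assms by blast
qed

text \<open>All local rings at generic points are the whole function field.\<close>

lemma generic_pt: "w \<in> words D \<Longrightarrow> w' \<in> words D \<Longrightarrow> pt D e0 w {0} = pt D e0 w' {0}"
  using mem_point_ring by (subst pt_eq_iff) (auto simp: zero_prime local_ring_generic)

lemma in_patch_pt: "in_patch D e0 w W = {p. prime_pt p \<and> pt D e0 w p \<in> W}"
  by (simp add: in_patch_def patch_eq)

lemma generic_in_patch:
  assumes W: "Xhat_open W" "W \<noteq> {}" and w: "w \<in> words D"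
  shows "{0} \<in> in_patch D e0 w W"
proof -
  obtain w1 p where p: "w1 \<in> words D" "prime_pt p" "pt D e0 w1 p \<in> W"
    using W unfolding openin_Xhat Xhat_points_eq by blast
  then have "in_patch D e0 w1 W \<noteq> {}" "openin Spec (in_patch D e0 w1 W)"
    using W by (auto simp: in_patch_pt openin_Xhat)
  then have "{0} \<in> in_patch D e0 w1 W" using generic_in_open by blast
  then show ?thesis using generic_pt[OF w p(1)] by (simp add: in_patch_pt zero_prime)
qed

lemma openin_in_patch: "Xhat_open W \<Longrightarrow> w \<in> words D \<Longrightarrow> openin Spec (in_patch D e0 w W)"
  by (simp add: openin_Xhat)

text \<open>A section consists of one element of the function field for each patch. Compatibility at the generic
  point, which is common to all patches, identifies these elements with each other.\<close>

lemma carrier_Xhat_sheaf: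
  assumes W: "Xhat_open W"
  shows "carrier (Xhat_sheaf D e0 W) = Sec W ` Reg W"
proof (intro equalityI subsetI)
  note op = openin_in_patch[OF W]
  fix \<sigma> assume "\<sigma> \<in> carrier (Xhat_sheaf D e0 W)"
  then have \<sigma>: "\<sigma> \<in> (\<Pi>\<^sub>E w \<in> words D. carrier (spec_sheaf (in_patch D e0 w W)))"
    and comp: "\<And>w p w' p'. ((w, p), (w', p')) \<in> glue_rel D e0 \<Longrightarrow> p \<in> in_patch D e0 w W \<Longrightarrow>
             germ_val (\<sigma> w p) = comorphism D e0 w w' (germ_val (\<sigma> w' p'))"
    unfolding Xhat_sheaf_def patch_eq by auto
  have "\<forall>w \<in> words D. \<exists>y. y \<in> regular_on (in_patch D e0 w W) \<and> \<sigma> w = spec_section (in_patch D e0 w W) y"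
    using PiE_mem[OF \<sigma>] by (auto simp: carrier_structure_sheaf[OF op])
  then obtain y where y: "\<And>w. w \<in> words D \<Longrightarrow> y w \<in> regular_on (in_patch D e0 w W)"
    "\<And>w. w \<in> words D \<Longrightarrow> \<sigma> w = spec_section (in_patch D e0 w W) (y w)" by metis
  show "\<sigma> \<in> Sec W ` Reg W"
  proof (cases "W = {}")
    case True
    then have e: "in_patch D e0 w W = {}" for w by (simp add: in_patch_pt)
    have "\<sigma> = Sec W 0"
      using y(2) \<sigma> by (auto simp: Xhat_section_def e spec_section_def fun_eq_iff restrict_def PiE_def extensional_def)
    moreover have "0 \<in> Reg W" by (simp add: regular_Xhat_def regular_on_def e)
    ultimately show ?thesis by blast
  next
    case False
    define x where "x = \<Theta> [] (y [])"
    have yx: "y w = chart D e0 w x" if w: "w \<in> words D" for w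
    proof -
      have gen: "{0} \<in> in_patch D e0 w' W" if "w' \<in> words D" for w'
        using generic_in_patch[OF W False that] .
      have val: "germ_val (\<sigma> w' {0}) = y w'" if "w' \<in> words D" for w'
      proof -
        have "germ_val (germ {0} (y w')) = y w'"
          by (rule germ_val_germ[OF zero_prime]) (simp add: local_ring_generic)
        then show ?thesis using gen[OF that] y(2)[OF that] by (simp add: spec_section_def)
      qed
      have "point_ring D e0 w {0} = point_ring D e0 [] {0}"
        using generic_pt[OF w Nil_in_words] pt_eq_iff[OF w zero_prime Nil_in_words zero_prime] by blast
      then have "((w, {0}), ([], {0})) \<in> glue_rel D e0"
        by (simp add: glue_rel_iff w Nil_in_words zero_prime)
      from comp[OF this gen[OF w]] show ?thesis
        by (simp add: val w Nil_in_words x_def comorphism_eq)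
    qed
    have "\<sigma> w = Sec W x w" for w
      using y(2) yx \<sigma> by (cases "w \<in> words D") (auto simp: Xhat_section_def PiE_def extensional_def)
    then have "\<sigma> = Sec W x" by (rule ext)
    moreover have "x \<in> Reg W" using y(1) yx by (simp add: regular_Xhat_def)
    ultimately show ?thesis by blast
  qed
next
  note op = openin_in_patch[OF W]
  fix \<sigma> assume "\<sigma> \<in> Sec W ` Reg W"
  then obtain x where x: "\<And>w. w \<in> words D \<Longrightarrow> chart D e0 w x \<in> regular_on (in_patch D e0 w W)"
    and \<sigma>: "\<sigma> = Sec W x" by (auto simp: regular_Xhat_def)
  have val: "germ_val (\<sigma> w p) = chart D e0 w x" if "w \<in> words D" "p \<in> in_patch D e0 w W" for w p
    using that x[OF that(1)] in_patch_prime[OF that(2)]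
    by (simp add: \<sigma> Xhat_section_def spec_section_def germ_val_germ regular_on_def)
  have "germ_val (\<sigma> w p) = comorphism D e0 w w' (germ_val (\<sigma> w' p'))"
    if "((w, p), (w', p')) \<in> glue_rel D e0" "p \<in> in_patch D e0 w W" for w p w' p'
  proof -
    have w: "w \<in> words D" "w' \<in> words D" "prime_pt p" "prime_pt p'" "pt D e0 w p = pt D e0 w' p'"
      using that(1) pt_eq_iff unfolding glue_rel_iff by blast+
    then have "p' \<in> in_patch D e0 w' W" using that(2) by (simp add: in_patch_pt)
    then show ?thesis using w that(2) by (simp add: val comorphism_eq initial_chart)
  qed
  moreover have "\<sigma> \<in> (\<Pi>\<^sub>E w \<in> words D. carrier (spec_sheaf (in_patch D e0 w W)))"
    using x by (auto simp: \<sigma> Xhat_section_def carrier_structure_sheaf op)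
  ultimately show "\<sigma> \<in> carrier (Xhat_sheaf D e0 W)"
    unfolding Xhat_sheaf_def patch_eq by auto
qed

lemma Xhat_section_eq_iff:
  assumes W: "Xhat_open W" and x: "x \<in> Reg W"
  shows "Sec W x = Sec W y \<longleftrightarrow> W = {} \<or> x = y"
proof (cases "W = {}")
  case True
  then show ?thesis using Xhat_section_empty by simp
next
  case False
  have "x = y" if "Sec W x = Sec W y"
  proof -
    note w = Nil_in_words[of D]
    have "spec_section (in_patch D e0 [] W) (chart D e0 [] x) = spec_section (in_patch D e0 [] W) (chart D e0 [] y)"
      using fun_cong[OF that, of "[]"] w by (simp add: Xhat_section_def)
    moreover have "chart D e0 [] x \<in> regular_on (in_patch D e0 [] W)" using x w by (simp add: regular_Xhat_def)
    ultimately have "chart D e0 [] x = chart D e0 [] y"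
      using spec_section_eq_iff[OF openin_in_patch[OF W w]] generic_in_patch[OF W False w] by blast
    then show ?thesis by (metis initial_chart w)
  qed
  then show ?thesis using False by blast
qed

lemma algebra_image_Xhat:
  assumes W: "Xhat_open W"
  shows "algebra_image (Reg W) (Sec W) (Xhat_sheaf D e0 W) const_K"
proof -
  note op = openin_in_patch[OF W]
  note H = ring_morphismD[OF chart_hom(1)] chart_hom(2)
  have S: "ring_image (regular_on (in_patch D e0 w W)) (spec_section (in_patch D e0 w W))
      (spec_sheaf (in_patch D e0 w W))" if "w \<in> words D" for w
    by (rule ring_image_structure_sheaf[OF op[OF that]])
  note S' = ring_image.zero_mem[OF S] ring_image.one_mem[OF S] ring_image.add_mem[OF S]
    ring_image.mult_mem[OF S] ring_image.uminus_mem[OF S]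
  have smult: "r \<odot>\<^bsub>Xhat_sheaf D e0 W\<^esub> Sec W x = Sec W (const_K r * x)"
    if x: "x \<in> Reg W" for r x
  proof -
    have "loc_frac ring_of_type_algebra p (coeff_emb r) 1 \<otimes>\<^bsub>localization ring_of_type_algebra p\<^esub>
        germ p (chart D e0 w x) = germ p (const_K r * chart D e0 w x)"
      if "w \<in> words D" "p \<in> in_patch D e0 w W" for w p
    proof -
      have p: "prime_pt p" using in_patch_prime that(2) .
      have "chart D e0 w x \<in> local_ring p" using x that by (auto simp: regular_Xhat_def regular_on_def)
      then show ?thesis
        by (simp add: loc_frac_eq_germ[OF p] prime_one[OF p] localization_mult[OF p] to_K_def local_ring_base[OF p])
    qed
    then show ?thesis
      by (auto simp: Xhat_sheaf_def patch_eq Xhat_section_def spec_section_def fun_eq_iff restrict_def H)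
  qed
  have add: "Sec W x \<oplus>\<^bsub>Xhat_sheaf D e0 W\<^esub> Sec W y = Sec W (x + y)"
    and mult: "Sec W x \<otimes>\<^bsub>Xhat_sheaf D e0 W\<^esub> Sec W y = Sec W (x * y)"
    if "x \<in> Reg W" "y \<in> Reg W" for x y
    using that unfolding regular_Xhat_def
    by (auto simp: Xhat_sheaf_def patch_eq Xhat_section_def H spec_section_add[OF op]
        spec_section_mult[OF op] intro!: restrict_ext)
  have one: "\<one>\<^bsub>Xhat_sheaf D e0 W\<^esub> = Sec W 1"
    and zero: "\<zero>\<^bsub>Xhat_sheaf D e0 W\<^esub> = Sec W 0"
    by (auto simp: Xhat_sheaf_def patch_eq Xhat_section_def H spec_section_one[OF op]
        spec_section_zero[OF op] intro!: restrict_ext)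
  show ?thesis
  proof
    show "const_K r \<in> Reg W" for r
      by (auto simp: regular_Xhat_def regular_on_def H local_ring_const in_patch_prime)
  qed (use smult add mult one zero carrier_Xhat_sheaf[OF W] S' in
      \<open>auto simp: regular_Xhat_def H const_K_hom coeff_emb_hom to_K_hom\<close>)
qed

lemma Xhat_sections_cases:
  assumes "Xhat_open W" "f \<in> carrier (Xhat_sheaf D e0 W)"
  obtains x where "x \<in> Reg W" "f = Sec W x"
  using assms carrier_Xhat_sheaf by auto

lemma Xhat_section_mem:
  "Xhat_open W \<Longrightarrow> x \<in> Reg W \<Longrightarrow> Sec W x \<in> carrier (Xhat_sheaf D e0 W)"
  using carrier_Xhat_sheaf by auto

text \<open>Nonempty open sets meet in the generic point, so compatible sections over them come from
  one element of the function field.\<close>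

lemma Xhat_glueing:
  assumes op: "\<forall>V \<in> \<C>. Xhat_open V"
    and car: "\<forall>V \<in> \<C>. \<sigma> V \<in> carrier (Xhat_sheaf D e0 V)"
    and comp: "\<forall>V \<in> \<C>. \<forall>W \<in> \<C>. Xhat_res D e0 V (V \<inter> W) (\<sigma> V) = Xhat_res D e0 W (V \<inter> W) (\<sigma> W)"
  shows "\<exists>!f. f \<in> carrier (Xhat_sheaf D e0 (\<Union>\<C>)) \<and> (\<forall>V \<in> \<C>. Xhat_res D e0 (\<Union>\<C>) V f = \<sigma> V)"
proof -
  have U: "Xhat_open (\<Union>\<C>)" using op by blast
  have "\<forall>V \<in> \<C>. \<exists>x. x \<in> Reg V \<and> \<sigma> V = Sec V x"
    using op car by (auto simp: carrier_Xhat_sheaf)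
  then obtain x where x: "\<And>V. V \<in> \<C> \<Longrightarrow> x V \<in> Reg V"
    "\<And>V. V \<in> \<C> \<Longrightarrow> \<sigma> V = Sec V (x V)" by metis
  have empty: "Reg {} = UNIV" "Sec {} y = Sec {} z" for y z
    using Xhat_section_empty by (simp_all add: regular_Xhat_def regular_on_def in_patch_pt)
  have "x V = x W" if "V \<in> \<C>" "W \<in> \<C>" "V \<noteq> {}" "W \<noteq> {}" for V W
  proof -
    have VW: "Xhat_open (V \<inter> W)" using op that by blast
    have "{0} \<in> in_patch D e0 [] (V \<inter> W)"
      unfolding in_patch_Int using generic_in_patch op that Nil_in_words by blast
    then have "V \<inter> W \<noteq> {}" by (auto simp: in_patch_pt)
    moreover have "Sec (V \<inter> W) (x V) = Sec (V \<inter> W) (x W)"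
      using comp[rule_format, OF that(1,2)] that by (simp add: x(2) Xhat_res_section)
    moreover have "x V \<in> Reg (V \<inter> W)"
      using x(1)[OF that(1)] regular_Xhat_mono[of "V \<inter> W" V] by blast
    ultimately show ?thesis using Xhat_section_eq_iff[OF VW] by blast
  qed
  then obtain y where y: "\<And>V. V \<in> \<C> \<Longrightarrow> V \<noteq> {} \<Longrightarrow> x V = y" by metis
  have yV: "y \<in> Reg V" "\<sigma> V = Sec V y" if "V \<in> \<C>" for V
    using x[OF that] y[OF that] empty by (cases "V = {}"; auto)+
  have yU: "y \<in> Reg (\<Union>\<C>)"
    using yV(1) by (auto simp: regular_Xhat_def regular_on_def in_patch_Union)
  show ?thesis
  proof (intro ex1I conjI ballI)
    show "Sec (\<Union>\<C>) y \<in> carrier (Xhat_sheaf D e0 (\<Union>\<C>))" by (rule Xhat_section_mem[OF U yU])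
    show "Xhat_res D e0 (\<Union>\<C>) V (Sec (\<Union>\<C>) y) = \<sigma> V" if "V \<in> \<C>" for V
      using that yV by (simp add: Xhat_res_section Union_upper)
    fix f assume f: "f \<in> carrier (Xhat_sheaf D e0 (\<Union>\<C>)) \<and> (\<forall>V \<in> \<C>. Xhat_res D e0 (\<Union>\<C>) V f = \<sigma> V)"
    then obtain z where z: "z \<in> Reg (\<Union>\<C>)" "f = Sec (\<Union>\<C>) z"
      using Xhat_sections_cases[OF U] by metis
    show "f = Sec (\<Union>\<C>) y"
    proof (cases "\<Union>\<C> = {}")
      case True
      then show ?thesis unfolding z(2) True by (intro empty(2))
    next
      case False
      then obtain V where V: "V \<in> \<C>" "V \<noteq> {}" by blast
      have "Sec V z = Sec V y"
        using f V yV(2) by (simp add: z(2) Xhat_res_section Union_upper)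
      moreover have "z \<in> Reg V" using z(1) regular_Xhat_mono[of V "\<Union>\<C>"] V by blast
      ultimately have "z = y" using Xhat_section_eq_iff[of V] op V by blast
      then show ?thesis using z by simp
    qed
  qed
qed

lemma algebra_sheaf_Xhat: "algebra_sheaf R_poly (Xhat_top D e0) (Xhat_sheaf D e0) (Xhat_res D e0)"
proof (rule algebra_sheaf.intro)
  fix U assume U: "Xhat_open U"
  interpret U: algebra_image "Reg U" "Sec U" "Xhat_sheaf D e0 U" const_K
    by (rule algebra_image_Xhat[OF U])
  show "algebra R_poly (Xhat_sheaf D e0 U)" unfolding R_poly_def by (rule U.algebra)
  show "Xhat_res D e0 U U f = f" if "f \<in> carrier (Xhat_sheaf D e0 U)" for f
    using Xhat_sections_cases[OF U that] by (metis Xhat_res_section order_refl)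
  fix V assume V: "Xhat_open V" "V \<subseteq> U"
  interpret V: algebra_image "Reg V" "Sec V" "Xhat_sheaf D e0 V" const_K
    by (rule algebra_image_Xhat[OF V(1)])
  note m = subsetD[OF regular_Xhat_mono[OF V(2), of D e0]]
  show "Xhat_res D e0 U V \<in> ring_hom (Xhat_sheaf D e0 U) (Xhat_sheaf D e0 V)"
    by (rule ring_hom_memI)
      (auto simp: U.carrier_image V.carrier_image Xhat_res_section[OF V(2)] U.image_add V.image_add
        U.image_mult V.image_mult U.image_one V.image_one m)
  show "Xhat_res D e0 U V (r \<odot>\<^bsub>Xhat_sheaf D e0 U\<^esub> f) = r \<odot>\<^bsub>Xhat_sheaf D e0 V\<^esub> Xhat_res D e0 U V f"
    if "f \<in> carrier (Xhat_sheaf D e0 U)" for r f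
    using that by (auto simp: U.carrier_image Xhat_res_section[OF V(2)] U.image_smult V.image_smult m)
  fix W assume W: "Xhat_open W" "W \<subseteq> V"
  show "Xhat_res D e0 V W (Xhat_res D e0 U V f) = Xhat_res D e0 U W f"
    if "f \<in> carrier (Xhat_sheaf D e0 U)" for f
    using that V(2) W(2) by (auto simp: U.carrier_image Xhat_res_section)
next
  fix \<C> and \<sigma> :: "'i Xhat_point set \<Rightarrow> 'i Xhat_section"
  assume "\<forall>V \<in> \<C>. Xhat_open V" "\<forall>V \<in> \<C>. \<sigma> V \<in> carrier (Xhat_sheaf D e0 V)"
    "\<forall>V \<in> \<C>. \<forall>W \<in> \<C>. Xhat_res D e0 V (V \<inter> W) (\<sigma> V) = Xhat_res D e0 W (V \<inter> W) (\<sigma> W)"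
  then show "\<exists>!f. f \<in> carrier (Xhat_sheaf D e0 (\<Union>\<C>)) \<and> (\<forall>V \<in> \<C>. Xhat_res D e0 (\<Union>\<C>) V f = \<sigma> V)"
    by (rule Xhat_glueing)
qed


subsection \<open>The patches are open affine subschemes\<close>

lemma in_patch_image:
  assumes w: "w \<in> words D" "w' \<in> words D" and V: "V \<subseteq> {p. prime_pt p}"
  shows "in_patch D e0 w' (pt D e0 w ` V) =
    {q. prime_pt q \<and> (\<exists>p \<in> V. comorphism D e0 w' w ` local_ring p = local_ring q)}"
  unfolding in_patch_pt comorphism_image_iff[OF w(2,1)]
  using pt_eq_iff[OF w(2) _ w(1)] V by blast

lemma openin_pt_image:
  assumes w: "w \<in> words D" and V: "openin Spec V"
  shows "Xhat_open (pt D e0 w ` V)"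
  unfolding openin_Xhat
proof (intro conjI ballI)
  show "pt D e0 w ` V \<subseteq> Xhat_points D e0"
    using w openin_Spec_prime[OF V] by (auto simp: Xhat_points_eq)
  fix w' assume w': "w' \<in> words D"
  show "openin Spec (in_patch D e0 w' (pt D e0 w ` V))"
    unfolding in_patch_image[OF w w' openin_Spec_subset[OF V]]
    by (rule openin_transport[OF automorphism_comorphism[OF w' w] automorphism_comorphism[OF w w'] _ V])
      (simp add: comorphism_eq initial_chart chart_initial w w')
qed

lemma patch_open_eq: "patch_open D e0 w = pt D e0 w ` {p. prime_pt p}"
  by (simp add: patch_open_def patch_eq)

lemma openin_patch_open: "w \<in> words D \<Longrightarrow> Xhat_open (patch_open D e0 w)"
  unfolding patch_open_eq by (rule openin_pt_image[OF _ openin_Spec_all])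

lemma pt_inj_on: "w \<in> words D \<Longrightarrow> inj_on (pt D e0 w) {p. prime_pt p}"
  using point_ring_inject pt_eq_iff by (auto simp: inj_on_def)

lemma in_patch_own_image:
  assumes "w \<in> words D" "V \<subseteq> {p. prime_pt p}"
  shows "in_patch D e0 w (pt D e0 w ` V) = V"
  using pt_inj_on[OF assms(1)] assms(2) by (auto simp: in_patch_pt inj_on_def)

text \<open>Over the image of \<open>V\<close> in the glued scheme, every point has the same local ring as a point of
  \<open>V\<close>, so regularity may be checked in the one patch.\<close>

lemma regular_pt_image:
  assumes w: "w \<in> words D" and V: "V \<subseteq> {p. prime_pt p}"
  shows "x \<in> Reg (pt D e0 w ` V) \<longleftrightarrow> chart D e0 w x \<in> regular_on V"
proof
  assume "x \<in> Reg (pt D e0 w ` V)"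
  then show "chart D e0 w x \<in> regular_on V"
    using w in_patch_own_image[OF w V] by (auto simp: regular_Xhat_def)
next
  assume x: "chart D e0 w x \<in> regular_on V"
  show "x \<in> Reg (pt D e0 w ` V)"
    unfolding regular_Xhat_def regular_on_def mem_Collect_eq
  proof (intro ballI)
    fix w' q assume w': "w' \<in> words D" and "q \<in> in_patch D e0 w' (pt D e0 w ` V)"
    then obtain p where "p \<in> V" "point_ring D e0 w' q = point_ring D e0 w p"
      unfolding in_patch_image[OF w w' V] comorphism_image_iff[OF w' w] by blast
    then show "chart D e0 w' x \<in> local_ring q"
      using x mem_point_ring[OF w] mem_point_ring[OF w'] by (auto simp: regular_on_def)
  qed
qed

text \<open>The neighbourhood is the patch that contains the point. Its sections are compared with those of the
  glued scheme by the automorphism that leads from the coordinates of the patch to those of the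
  initial patch.\<close>

lemma has_affine_nbhd_Xhat:
  assumes "x \<in> topspace (Xhat_top D e0)"
  shows "has_affine_nbhd TYPE('i patch_ring) (Xhat_top D e0) (Xhat_sheaf D e0) (Xhat_res D e0) x"
proof -
  have "x \<in> Xhat_points D e0"
    using assms openin_topspace[of "Xhat_top D e0"] unfolding openin_Xhat by blast
  then obtain w p where w: "w \<in> words D" and p: "prime_pt p" "x = pt D e0 w p"
    unfolding Xhat_points_eq by blast
  define U where "U = patch_open D e0 w"
  define h where "h = inv_into {p. prime_pt p} (pt D e0 w)"
  have U: "Xhat_open U" unfolding U_def by (rule openin_patch_open[OF w])
  have Ueq: "U = pt D e0 w ` {p. prime_pt p}" unfolding U_def by (rule patch_open_eq)
  have hpt: "h (pt D e0 w q) = q" if "prime_pt q" for q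
    unfolding h_def by (rule inv_into_f_f[OF pt_inj_on[OF w]]) (simp add: that)
  have pre: "{y \<in> U. h y \<in> V} = pt D e0 w ` V" if "V \<subseteq> {q. prime_pt q}" for V
    using that hpt by (auto simp: Ueq)
  have tops: "topspace (subtopology (Xhat_top D e0) U) = U"
    using openin_subset[OF U] by (auto simp: topspace_subtopology)
  have "homeomorphic_maps (subtopology (Xhat_top D e0) U) Spec h (pt D e0 w)"
    unfolding homeomorphic_maps_def continuous_map_def tops topspace_Spec
  proof (intro conjI allI impI ballI)
    show "h \<in> U \<rightarrow> {p. prime_pt p}" "pt D e0 w \<in> {p. prime_pt p} \<rightarrow> U" using hpt by (auto simp: Ueq)
    show "pt D e0 w (h y) = y" if "y \<in> U" for y using that hpt by (auto simp: Ueq)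
    show "h (pt D e0 w q) = q" if "q \<in> {p. prime_pt p}" for q using that hpt by simp
    fix V :: "'i patch_ring set set" assume V: "openin Spec V"
    show "openin (subtopology (Xhat_top D e0) U) {y \<in> U. h y \<in> V}"
      unfolding pre[OF openin_Spec_subset[OF V]]
      using openin_pt_image[OF w V] openin_Spec_prime[OF V] U
      by (auto simp: openin_open_subtopology Ueq)
  next
    fix W assume "openin (subtopology (Xhat_top D e0) U) W"
    then have "Xhat_open W" using U by (simp add: openin_open_subtopology)
    then have "openin Spec (in_patch D e0 w W)" using openin_in_patch w by blast
    then show "openin Spec {q \<in> {p. prime_pt p}. pt D e0 w q \<in> W}" by (simp add: in_patch_pt)
  qed
  then have homeo: "homeomorphic_map (subtopology (Xhat_top D e0) U) (spec_top patch) h"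
    unfolding patch_eq using homeomorphic_map_maps by blast
  have "\<exists>\<phi> \<in> ring_iso (structure_sheaf patch V) (Xhat_sheaf D e0 {y \<in> U. h y \<in> V}).
      \<forall>z \<in> regular_on V. \<phi> (spec_section V z) = Sec {y \<in> U. h y \<in> V} (\<Theta> w z)"
    if V: "openin Spec V" for V
    unfolding pre[OF openin_Spec_subset[OF V]] patch_eq
  proof (rule ring_image_iso)
    note prV = openin_Spec_subset[OF V]
    have W: "Xhat_open (pt D e0 w ` V)" by (rule openin_pt_image[OF w V])
    show "ring_image (regular_on V) (spec_section V) (spec_sheaf V)"
      by (rule ring_image_structure_sheaf[OF V])
    show "ring_image (Reg (pt D e0 w ` V)) (Sec (pt D e0 w ` V))
        (Xhat_sheaf D e0 (pt D e0 w ` V))"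
      using algebra_image_Xhat[OF W] by (rule algebra_image.axioms(1))
    have reg: "\<Theta> w z \<in> Reg (pt D e0 w ` V) \<longleftrightarrow> z \<in> regular_on V" for z
      using regular_pt_image[OF w prV] by (simp add: chart_initial w)
    show "\<Theta> w ` regular_on V = Reg (pt D e0 w ` V)"
    proof (intro equalityI subsetI)
      fix y assume "y \<in> Reg (pt D e0 w ` V)"
      then have "chart D e0 w y \<in> regular_on V" using regular_pt_image[OF w prV] by blast
      from imageI[OF this, of "\<Theta> w"] show "y \<in> \<Theta> w ` regular_on V" by (simp only: initial_chart[OF w])
    qed (use reg in auto)
    show "spec_section V y = spec_section V z \<longleftrightarrow>
        Sec (pt D e0 w ` V) (\<Theta> w y) = Sec (pt D e0 w ` V) (\<Theta> w z)"
      if "y \<in> regular_on V" "z \<in> regular_on V" for y z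
    proof -
      have "\<Theta> w y \<in> Reg (pt D e0 w ` V)" using reg that by blast
      moreover have "\<Theta> w y = \<Theta> w z \<longleftrightarrow> y = z" using chart_initial[OF w] by metis
      ultimately show ?thesis
        using spec_section_eq_iff[OF V that(1)] Xhat_section_eq_iff[OF W] by simp
    qed
  qed (simp_all add: ring_morphismD[OF initial_hom[OF w]])
  then have "\<forall>V. \<exists>\<phi>. openin Spec V \<longrightarrow> \<phi> \<in> ring_iso (structure_sheaf patch V) (Xhat_sheaf D e0 {y \<in> U. h y \<in> V}) \<and>
      (\<forall>z \<in> regular_on V. \<phi> (spec_section V z) = Sec {y \<in> U. h y \<in> V} (\<Theta> w z))"
    by blast
  then obtain \<phi> where \<phi>: "\<And>V. openin Spec V \<Longrightarrow>
      \<phi> V \<in> ring_iso (structure_sheaf patch V) (Xhat_sheaf D e0 {y \<in> U. h y \<in> V})"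
    and \<phi>_val: "\<And>V z. openin Spec V \<Longrightarrow> z \<in> regular_on V \<Longrightarrow>
      \<phi> V (spec_section V z) = Sec {y \<in> U. h y \<in> V} (\<Theta> w z)"
    unfolding choice_iff by blast
  have res: "\<phi> W (restrict \<sigma> W) = Xhat_res D e0 {y \<in> U. h y \<in> V} {y \<in> U. h y \<in> W} (\<phi> V \<sigma>)"
    if V: "openin Spec V" and W: "openin Spec W" and WV: "W \<subseteq> V"
      and \<sigma>: "\<sigma> \<in> carrier (structure_sheaf patch V)" for V W \<sigma>
  proof -
    obtain z where z: "z \<in> regular_on V" "\<sigma> = spec_section V z"
      using \<sigma> unfolding patch_eq carrier_structure_sheaf[OF V] by blast
    have "z \<in> regular_on W" using z(1) regular_on_mono[OF WV] by blast
    moreover have "{y \<in> U. h y \<in> W} \<subseteq> {y \<in> U. h y \<in> V}" using WV by blast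
    ultimately show ?thesis
      by (simp add: z(2) spec_section_restrict[OF WV] \<phi>_val V W z(1) Xhat_res_section)
  qed
  have cr: "cring (patch :: 'i patch_ring ring)" unfolding patch_eq by (rule cring_from_type_algebra)
  have xU: "x \<in> U" using p by (auto simp: Ueq)
  show ?thesis
    unfolding has_affine_nbhd_def
    by (rule exI[of _ U], rule exI[of _ patch], rule exI[of _ h], rule exI[of _ \<phi>])
      (use U xU cr homeo \<phi> res in \<open>simp add: patch_eq\<close>)
qed


subsection \<open>The bracket on the glued scheme\<close>

text \<open>For a section over a nonempty open set the element is unique; over the empty set all elements give
  the same section.\<close>

definition Xhat_value :: "'i Xhat_point set \<Rightarrow> 'i Xhat_section \<Rightarrow> 'i function_field" where
  "Xhat_value W f = (SOME x. x \<in> Reg W \<and> Sec W x = f)"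

definition Xhat_bracket :: "'i Xhat_point set \<Rightarrow> 'i Xhat_section \<Rightarrow> 'i Xhat_section \<Rightarrow> 'i Xhat_section" where
  "Xhat_bracket W f g =
     Sec W (bracket_K (seed_matrix D e0) (Xhat_value W f) (Xhat_value W g))"

lemma Xhat_bracket_section:
  assumes W: "Xhat_open W" and x: "x \<in> Reg W" "y \<in> Reg W"
  shows "Xhat_bracket W (Sec W x) (Sec W y) =
    Sec W (bracket_K (seed_matrix D e0) x y)"
proof (cases "W = {}")
  case True
  then show ?thesis unfolding Xhat_bracket_def using Xhat_section_empty by simp
next
  case False
  have "Xhat_value W (Sec W z) = z" if "z \<in> Reg W" for z
    unfolding Xhat_value_def using that Xhat_section_eq_iff[OF W] False by (intro some_equality) auto
  then show ?thesis using x by (simp add: Xhat_bracket_def)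
qed

lemma regular_Xhat_bracket:
  assumes "x \<in> Reg W" "y \<in> Reg W"
  shows "bracket_K (seed_matrix D e0) x y \<in> Reg W"
  using assms by (auto simp: regular_Xhat_def regular_on_def chart_bracket in_patch_prime
      intro!: local_ring_bracket)

lemma poisson_sheaf_Xhat:
  "poisson_sheaf R_poly (Xhat_top D e0) (Xhat_sheaf D e0) (Xhat_res D e0) Xhat_bracket"
proof (intro poisson_sheaf.intro algebra_sheaf_Xhat poisson_sheaf_axioms.intro)
  fix U assume U: "Xhat_open U"
  show "poisson_algebra R_poly (Xhat_sheaf D e0 U) (Xhat_bracket U)"
    unfolding R_poly_def
    by (rule algebra_image.poisson_algebra[OF algebra_image_Xhat[OF U] poisson_seed_matrix[OF D]])
      (rule regular_Xhat_bracket Xhat_bracket_section[OF U]; assumption)+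
  fix V f g assume V: "Xhat_open V" "V \<subseteq> U"
    and "f \<in> carrier (Xhat_sheaf D e0 U)" "g \<in> carrier (Xhat_sheaf D e0 U)"
  then obtain x y where xy: "x \<in> Reg U" "f = Sec U x"
    "y \<in> Reg U" "g = Sec U y" using Xhat_sections_cases[OF U] by metis
  moreover have "x \<in> Reg V" "y \<in> Reg V"
    using xy regular_Xhat_mono[OF V(2), of D e0] by auto
  ultimately show "Xhat_bracket V (Xhat_res D e0 U V f) (Xhat_res D e0 U V g) =
      Xhat_res D e0 U V (Xhat_bracket U f g)"
    by (simp add: Xhat_res_section[OF V(2)] Xhat_bracket_section[OF U] Xhat_bracket_section[OF V(1)])
qed

lemma poisson_scheme_Xhat:
  "poisson_scheme_over TYPE('i patch_ring) R_poly (Xhat_top D e0) (Xhat_sheaf D e0) (Xhat_res D e0) Xhat_bracket"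
  by (intro poisson_scheme_over.intro scheme_over.intro algebra_sheaf_Xhat scheme_over_axioms.intro
      poisson_sheaf_Xhat has_affine_nbhd_Xhat)

lemma regular_patch_open:
  assumes "w \<in> words D" shows "\<Theta> w (to_K a) \<in> Reg (patch_open D e0 w)"
  unfolding patch_open_eq
  by (subst regular_pt_image) (auto simp: assms chart_initial regular_on_def to_K_def local_ring_base)

text \<open>A section over a patch is determined by its value at the generic point of the patch.\<close>

lemma patch_section_eq:
  assumes w: "w \<in> words D"
  shows "patch_section D e0 w a = Sec (patch_open D e0 w) (\<Theta> w (to_K a))"
  unfolding patch_section_def
proof (rule the_equality)
  let ?W = "patch_open D e0 w"
  have W: "Xhat_open ?W" by (rule openin_patch_open[OF w])
  have inp: "in_patch D e0 w ?W = {p. prime_pt p}"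
    unfolding patch_open_eq by (rule in_patch_own_image[OF w]) simp
  have frac: "loc_frac patch p a 1 = germ p (to_K a)" if "prime_pt p" for p
    using that by (simp add: patch_eq loc_frac_eq_germ prime_one to_K_def)
  show "Sec ?W (\<Theta> w (to_K a)) \<in> carrier (Xhat_sheaf D e0 ?W) \<and>
     (\<forall>p. primeideal p patch \<longrightarrow> Sec ?W (\<Theta> w (to_K a)) w p = loc_frac patch p a 1)"
    using Xhat_section_mem[OF W regular_patch_open[OF w]] w frac
    by (simp add: Xhat_section_def inp spec_section_def chart_initial patch_eq)
  fix \<sigma> assume \<sigma>: "\<sigma> \<in> carrier (Xhat_sheaf D e0 ?W) \<and>
     (\<forall>p. primeideal p patch \<longrightarrow> \<sigma> w p = loc_frac patch p a 1)"
  then obtain x where x: "x \<in> Reg ?W" "\<sigma> = Sec ?W x"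
    using Xhat_sections_cases[OF W] by metis
  have "\<sigma> w {0} = loc_frac patch {0} a 1" using \<sigma> by (simp add: patch_eq zero_prime)
  then have "\<sigma> w {0} = germ {0} (to_K a)" by (simp only: frac[OF zero_prime])
  then have "germ {0} (chart D e0 w x) = germ {0} (to_K a)"
    using w by (simp add: x(2) Xhat_section_def inp spec_section_def zero_prime)
  then have "chart D e0 w x = to_K a"
    by (simp add: germ_eq_iff[OF zero_prime] local_ring_generic)
  then show "\<sigma> = Sec ?W (\<Theta> w (to_K a))" using initial_chart[OF w] x(2) by metis
qed

lemma Xhat_bracket_patch_section:
  assumes w: "w \<in> words D"
  shows "Xhat_bracket (patch_open D e0 w) (patch_section D e0 w a) (patch_section D e0 w b) =
    patch_section D e0 w (patch_bracket D (seed_at D e0 w) a b)"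
proof -
  have "bracket_K (seed_matrix D e0) (\<Theta> w (to_K a)) (\<Theta> w (to_K b)) =
      \<Theta> w (to_K (patch_bracket D (seed_at D e0 w) a b))"
    using comorphism_from_initial_poisson[OF D e0 w] by (simp add: to_K_patch_bracket[OF D])
  then show ?thesis
    using openin_patch_open[OF w] regular_patch_open[OF w]
    by (simp add: patch_section_eq[OF w] Xhat_bracket_section)
qed

text \<open>Restriction to the nonempty intersection of \<open>U\<close> with the initial patch is injective. There every
  section is a quotient of regular functions on the patch, and a bracket, being a derivation in each
  argument, is determined on quotients by its values on these functions.\<close>

lemma Xhat_bracket_unique:
  assumes br: "poisson_sheaf R_poly (Xhat_top D e0) (Xhat_sheaf D e0) (Xhat_res D e0) br"
    and patches: "\<And>w a b. w \<in> words D \<Longrightarrow>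
      br (patch_open D e0 w) (patch_section D e0 w a) (patch_section D e0 w b) =
      patch_section D e0 w (patch_bracket D (seed_at D e0 w) a b)"
    and U: "Xhat_open U"
    and f: "f \<in> carrier (Xhat_sheaf D e0 U)" and g: "g \<in> carrier (Xhat_sheaf D e0 U)"
  shows "br U f g = Xhat_bracket U f g"
proof -
  interpret br: poisson_sheaf R_poly "Xhat_top D e0" "Xhat_sheaf D e0" "Xhat_res D e0" br by (rule br)
  let ?b = "bracket_K (seed_matrix D e0)"
  interpret K: poisson_bracket const_K ?b by (rule poisson_seed_matrix[OF D])
  note w = Nil_in_words[of D]
  let ?P = "patch_open D e0 []"
  let ?W = "U \<inter> ?P"
  have P: "Xhat_open ?P" by (rule openin_patch_open[OF w])
  have W: "Xhat_open ?W" using U P by blast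
  interpret W: algebra_image "Reg ?W" "Sec ?W" "Xhat_sheaf D e0 ?W" const_K
    by (rule algebra_image_Xhat[OF W])
  interpret WP: poisson_algebra R_poly "Xhat_sheaf D e0 ?W" "br ?W" by (rule br.poisson[OF W])
  obtain z where z: "z \<in> Reg U" "br U f g = Sec U z"
    using Xhat_sections_cases[OF U] poisson_algebra.br_closed[OF br.poisson[OF U] f g] by metis
  obtain x y where xy: "x \<in> Reg U" "f = Sec U x"
    "y \<in> Reg U" "g = Sec U y"
    using Xhat_sections_cases[OF U] f g by metis
  show ?thesis
  proof (cases "U = {}")
    case True
    then show ?thesis unfolding z(2) Xhat_bracket_def using Xhat_section_empty by simp
  next
    case False
    have "{0} \<in> in_patch D e0 [] U" using generic_in_patch[OF U False w] .
    then have ne: "?W \<noteq> {}" by (auto simp: in_patch_pt patch_open_eq zero_prime)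
    \<comment> \<open>\<open>c\<close> is the given bracket over \<open>U \<inter> P\<close>, as an operation on elements of the function field\<close>
    define v where "v s = (SOME x. x \<in> Reg ?W \<and> Sec ?W x = s)" for s
    let ?s = "Sec ?W"
    have eqW: "?s x = ?s y \<longleftrightarrow> x = y" if "x \<in> Reg ?W" for x y
      using Xhat_section_eq_iff[OF W that] ne by blast
    define c where "c x y = v (br ?W (?s x) (?s y))" for x y
    have c: "c x y \<in> Reg ?W" "br ?W (?s x) (?s y) = ?s (c x y)"
      if "x \<in> Reg ?W" "y \<in> Reg ?W" for x y
    proof -
      have "\<exists>z. z \<in> Reg ?W \<and> ?s z = br ?W (?s x) (?s y)"
        using Xhat_sections_cases[OF W WP.br_closed[OF Xhat_section_mem[OF W] Xhat_section_mem[OF W]]] that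
        by metis
      from someI_ex[OF this] show "c x y \<in> Reg ?W" "br ?W (?s x) (?s y) = ?s (c x y)"
        by (simp_all add: c_def v_def)
    qed
    note mem = Xhat_section_mem[OF W]
    have c_skew: "c x y = - c y x" if "x \<in> Reg ?W" "y \<in> Reg ?W" for x y
    proof -
      have "br ?W (?s (x + y)) (?s (x + y)) = ?s (c x x + c y x + (c x y + c y y))"
        using that by (simp add: mem W.image_add[symmetric] WP.br_add_left WP.br_add_right W.add_mem c
            del: W.image_add)
      moreover have "?s (c x x) = ?s 0" if "x \<in> Reg ?W" for x
        using WP.br_alternating[OF mem[OF that]] c[OF that that] by (simp add: W.image_zero)
      then have z: "c x x = 0" if "x \<in> Reg ?W" for x
        using eqW c(1)[OF that that] that by blast
      moreover have "br ?W (?s (x + y)) (?s (x + y)) = ?s 0"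
        using that WP.br_alternating[OF mem[OF W.add_mem]] by (simp add: W.image_zero)
      ultimately have "?s (c y x + c x y) = ?s 0" using that by simp
      then have "c y x + c x y = 0" using eqW[of "c y x + c x y" 0] that c W.add_mem by simp
      then show ?thesis by (simp add: eq_neg_iff_add_eq_0 add.commute)
    qed
    have c_mult: "c (x * y) z = x * c y z + c x z * y"
      if "x \<in> Reg ?W" "y \<in> Reg ?W" "z \<in> Reg ?W" for x y z
    proof -
      have "?s (c (x * y) z) = ?s (x * c y z + c x z * y)"
        using WP.br_leibniz[OF mem mem mem, OF that] that
        by (simp add: W.image_mult W.image_add W.mult_mem c)
      moreover have "c (x * y) z \<in> Reg ?W" by (intro c(1) W.mult_mem that)
      ultimately show ?thesis using eqW by blast
    qed
    have regP: "\<Theta> [] (to_K a) \<in> Reg ?W" for a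
      using regular_patch_open[OF w] regular_Xhat_mono[of ?W ?P] by blast
    have c_base: "c (\<Theta> [] (to_K a)) (\<Theta> [] (to_K b)) = ?b (\<Theta> [] (to_K a)) (\<Theta> [] (to_K b))" for a b
    proof -
      let ?x = "\<Theta> [] (to_K a)" and ?y = "\<Theta> [] (to_K b)"
      have "br ?P (Sec ?P ?x) (Sec ?P ?y) = Sec ?P (?b ?x ?y)"
        using patches[OF w] Xhat_bracket_patch_section[OF w, of a b] Xhat_bracket_section[OF P] regular_patch_open[OF w]
        by (simp add: patch_section_eq[OF w])
      then have "br ?W (?s ?x) (?s ?y) = ?s (?b ?x ?y)"
        using br.res_br[OF P W _ Xhat_section_mem[OF P] Xhat_section_mem[OF P], of ?x ?y] regular_patch_open[OF w]
        by (simp add: Xhat_res_section)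
      then show ?thesis using c[OF regP regP] eqW by metis
    qed
    have quot: "\<exists>a s. s \<noteq> 0 \<and> \<Theta> [] (to_K s) * x = \<Theta> [] (to_K a)" for x
    proof -
      obtain a s where as: "chart D e0 [] x = Fract a s" "s \<noteq> 0" by (cases "chart D e0 [] x")
      have "to_K s * chart D e0 [] x = to_K a" using as by (simp add: Fract_eq_to_K to_K_eq_0_iff)
      then have "\<Theta> [] (to_K s * chart D e0 [] x) = \<Theta> [] (to_K a)" by simp
      then have "\<Theta> [] (to_K s) * x = \<Theta> [] (to_K a)"
        by (simp only: ring_morphismD(3)[OF initial_hom[OF w]] initial_chart[OF w])
      then show ?thesis using as by blast
    qed
    have nz: "\<Theta> [] (to_K s) \<noteq> 0" if "s \<noteq> 0" for s
      using that ring_morphism_field(1)[OF initial_hom[OF w]] by (simp add: to_K_eq_0_iff)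
    \<comment> \<open>compare the brackets of \<open>s x = a\<close> with \<open>y\<close> and cancel \<open>s\<close>\<close>
    have extend: "c x y = ?b x y" if x: "x \<in> Reg ?W" and y: "y \<in> Reg ?W"
      and base: "\<And>a. c (\<Theta> [] (to_K a)) y = ?b (\<Theta> [] (to_K a)) y" for x y
    proof -
      obtain a s where as: "s \<noteq> 0" "\<Theta> [] (to_K s) * x = \<Theta> [] (to_K a)" using quot by blast
      have "\<Theta> [] (to_K s) * c x y + c (\<Theta> [] (to_K s)) y * x = \<Theta> [] (to_K s) * ?b x y + ?b (\<Theta> [] (to_K s)) y * x"
        using base[of a] unfolding as(2)[symmetric] K.leibniz c_mult[OF regP x y] .
      then have "\<Theta> [] (to_K s) * c x y = \<Theta> [] (to_K s) * ?b x y"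
        by (simp only: base add_right_cancel)
      then show ?thesis using nz[OF as(1)] by (simp only: mult_cancel_left simp_thms)
    qed
    have half: "c x (\<Theta> [] (to_K b)) = ?b x (\<Theta> [] (to_K b))" if "x \<in> Reg ?W" for x b
      by (rule extend[OF that regP c_base])
    have xyW: "x \<in> Reg ?W" "y \<in> Reg ?W" "z \<in> Reg ?W"
      using xy z regular_Xhat_mono[of ?W U] by blast+
    have cxy: "c x y = ?b x y"
    proof (rule extend[OF xyW(1,2)])
      fix a
      show "c (\<Theta> [] (to_K a)) y = ?b (\<Theta> [] (to_K a)) y"
        using half[OF xyW(2), of a] c_skew[OF regP xyW(2)] K.skew[of y] by simp
    qed
    have "?s z = br ?W (?s x) (?s y)"
      using br.res_br[OF U W _ f g] unfolding z(2) unfolding xy(2,4) by (simp add: Xhat_res_section)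
    also have "\<dots> = ?s (?b x y)" using c[OF xyW(1,2)] cxy by simp
    finally have "z = ?b x y" using eqW[OF xyW(3)] by blast
    then show ?thesis using z(2) Xhat_bracket_section[OF U xy(1,3)] by (simp add: xy)
  qed
qed

end

theorem proposition5p3:
  fixes D :: "('i::{finite, linorder}, 'n::ab_group_add) fixed_data"
    and e0 :: "'i \<Rightarrow> 'n"
  assumes "valid_fixed_data D" and "is_seed D e0"
  shows "(\<forall>w \<in> words D.
            poisson_algebra R_poly patch_algebra (patch_bracket D (seed_at D e0 w)) \<and>
            (\<forall>m n. patch_bracket D (seed_at D e0 w) (monomial m) (monomial n) =
               coeff_emb (rat_const (2 * form D (lattice_vec (seed_at D e0 w) m)
                                              (lattice_vec (seed_at D e0 w) n)))
               * monomial (m + n)))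
       \<and> (\<exists>br.
            poisson_scheme_over TYPE('i patch_ring) R_poly
              (Xhat_top D e0) (Xhat_sheaf D e0) (Xhat_res D e0) br
          \<and> (\<forall>w \<in> words D. \<forall>a b.
               br (patch_open D e0 w) (patch_section D e0 w a) (patch_section D e0 w b) =
               patch_section D e0 w (patch_bracket D (seed_at D e0 w) a b))
          \<and> (\<forall>br'.
               poisson_sheaf R_poly (Xhat_top D e0) (Xhat_sheaf D e0) (Xhat_res D e0) br' \<and>
               (\<forall>w \<in> words D. \<forall>a b.
                  br' (patch_open D e0 w) (patch_section D e0 w a) (patch_section D e0 w b) =
                  patch_section D e0 w (patch_bracket D (seed_at D e0 w) a b)) \<longrightarrow>
               (\<forall>U f g. openin (Xhat_top D e0) U \<and> f \<in> carrier (Xhat_sheaf D e0 U) \<and>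
                  g \<in> carrier (Xhat_sheaf D e0 U) \<longrightarrow> br' U f g = br U f g)))"
proof (intro conjI ballI allI impI exI[of _ "Xhat_bracket D e0"])
  fix w :: "'i list" and m n :: "'i \<Rightarrow>\<^sub>0 nat"
  show "poisson_algebra R_poly patch_algebra (patch_bracket D (seed_at D e0 w))"
    by (rule poisson_patch_bracket[OF assms(1)])
  show "patch_bracket D (seed_at D e0 w) (monomial m) (monomial n) =
       coeff_emb (rat_const (2 * form D (lattice_vec (seed_at D e0 w) m) (lattice_vec (seed_at D e0 w) n)))
       * monomial (m + n)"
    unfolding monomial_def[of m] monomial_def[of n] patch_bracket_single by simp
qed (use poisson_scheme_Xhat[OF assms] Xhat_bracket_patch_section[OF assms]
  Xhat_bracket_unique[OF assms] in blast)+

end
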